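(* Let $\Phi:(\mathbb{C}^2,0)\to(\mathbb{C}^3,0)$ be a holomorphic germ singular only at the origin. Then $\Omega_{\mathbb{C}}(\Phi)=C(\Phi)$.
   Context: $\Phi$ is singular only at the origin if $\{z:\operatorname{rank}_{\mathbb{C}} d\Phi_z<2\}\subset\{0\}$ in a small representative. The complex Smale invariant $\Omega_{\mathbb{C}}(\Phi)$ is the homotopy class of $d\Phi|_{S^3}:S^3\to V_2(\mathbb{C}^3)$ (complex Stiefel manifold, via standard trivializations of the tangent bundles, $S^3$ a small sphere around $0$), regarded as an integer via $\pi_3(V_2(\mathbb{C}^3))\cong\pi_3(U(3))\cong\pi_3(U)\cong\mathbb{Z}$ with generator $[u]$, $u_q=\begin{pmatrix}z&-\bar w\\ w&\bar z\end{pmatrix}$ for the unit quaternion $q=z+wj$ ($\mathbb{C}^2\cong\mathbb{H}$ via $(z,w)\leftrightarrow z+wj$). $C(\Phi)$ is the number of cross caps (points locally equivalent to $(s,t)\mapsto(s^2,st,t)$) of a generic holomorphic deformation $\Phi_\lambda$, $\lambda\neq0$ small, which is independent of the deformation. *)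

theory Defs
  imports "HOL-Analysis.Analysis"
begin

text \<open>C^2 is modelled as complex \<times> complex, C^3 as complex \<times> complex \<times> complex
 (product norms are the Euclidean norms). Complex scalar actions:\<close>

definition csc2 :: "complex \<Rightarrow> complex \<times> complex \<Rightarrow> complex \<times> complex" where
  "csc2 c v = (c * fst v, c * snd v)"

definition csc3 :: "complex \<Rightarrow> complex \<times> complex \<times> complex \<Rightarrow> complex \<times> complex \<times> complex" where
  "csc3 c v = (c * fst v, c * fst (snd v), c * snd (snd v))"

definition holo_wrt ::
  "(complex \<Rightarrow> 'a \<Rightarrow> 'a) \<Rightarrow> (complex \<Rightarrow> 'b \<Rightarrow> 'b) \<Rightarrow>
   ('a::real_normed_vector \<Rightarrow> 'b::real_normed_vector) \<Rightarrow> 'a set \<Rightarrow> bool" where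
  "holo_wrt sA sB f S \<longleftrightarrow> (\<forall>z\<in>S. \<exists>D. (f has_derivative D) (at z) \<and>
      (\<forall>c v. D (sA c v) = sB c (D v)))"

abbreviation holo22 :: "(complex \<times> complex \<Rightarrow> complex \<times> complex) \<Rightarrow> _" where
  "holo22 \<equiv> holo_wrt csc2 csc2"
abbreviation holo23 :: "(complex \<times> complex \<Rightarrow> complex \<times> complex \<times> complex) \<Rightarrow> _" where
  "holo23 \<equiv> holo_wrt csc2 csc3"
abbreviation holo33 :: "(complex \<times> complex \<times> complex \<Rightarrow> complex \<times> complex \<times> complex) \<Rightarrow> _" where
  "holo33 \<equiv> holo_wrt csc3 csc3"

definition dcols :: "(complex \<times> complex \<Rightarrow> complex \<times> complex \<times> complex) \<Rightarrow> complex \<times> complex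
    \<Rightarrow> (complex \<times> complex \<times> complex) \<times> (complex \<times> complex \<times> complex)" where
  "dcols f z = (frechet_derivative f (at z) (1, 0), frechet_derivative f (at z) (0, 1))"

text \<open>Pairs of C-linearly independent vectors of C^3 (non-compact Stiefel manifold,
 homotopy equivalent to V_2(C^3) via Gram-Schmidt).\<close>
definition cindep2 :: "((complex \<times> complex \<times> complex) \<times> (complex \<times> complex \<times> complex)) set" where
  "cindep2 = {(P, Q). \<forall>a b. csc3 a P + csc3 b Q = 0 \<longrightarrow> a = 0 \<and> b = 0}"

definition singular_at :: "(complex \<times> complex \<Rightarrow> complex \<times> complex \<times> complex) \<Rightarrow> complex \<times> complex \<Rightarrow> bool" where
  "singular_at f z \<longleftrightarrow> dcols f z \<notin> cindep2"

text \<open>2x2 complex matrices (a,b,c,d) = [[a,b],[c,d]].\<close>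
type_synonym cmat2 = "complex \<times> complex \<times> complex \<times> complex"

fun mmul2 :: "cmat2 \<Rightarrow> cmat2 \<Rightarrow> cmat2" where
  "mmul2 (a, b, c, d) (a', b', c', d') =
     (a * a' + b * c', a * b' + b * d', c * a' + d * c', c * b' + d * d')"

fun mpow2 :: "cmat2 \<Rightarrow> nat \<Rightarrow> cmat2" where
  "mpow2 M 0 = (1, 0, 0, 1)"
| "mpow2 M (Suc n) = mmul2 M (mpow2 M n)"

text \<open>u_q for the quaternion q = z + w j.\<close>
definition umat :: "complex \<times> complex \<Rightarrow> cmat2" where
  "umat q = (fst q, - cnj (snd q), snd q, cnj (fst q))"

text \<open>u_q^n (n an integer); for n < 0 use u_q^{-1} = u_{conj q}. This represents n[u].\<close>
definition upow :: "int \<Rightarrow> complex \<times> complex \<Rightarrow> cmat2" where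
  "upow n q = (if 0 \<le> n then mpow2 (umat q) (nat n)
               else mpow2 (umat (cnj (fst q), - snd q)) (nat (- n)))"

text \<open>First two columns of diag(u_q^n, 1) in U(3), i.e. a 2-frame in C^3.\<close>
definition rep_frame :: "int \<Rightarrow> complex \<times> complex
    \<Rightarrow> (complex \<times> complex \<times> complex) \<times> (complex \<times> complex \<times> complex)" where
  "rep_frame n q = (case upow n q of (a, b, c, d) \<Rightarrow> ((a, c, 0), (b, d, 0)))"

definition smale_invariant_is ::
  "(complex \<times> complex \<Rightarrow> complex \<times> complex \<times> complex) \<Rightarrow> int \<Rightarrow> bool" where
  "smale_invariant_is \<Phi> n \<longleftrightarrow> (\<exists>r0>0. \<forall>r. 0 < r \<and> r < r0 \<longrightarrow>
      homotopic_with_canon (\<lambda>_. True) (sphere 0 1) cindep2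
        (\<lambda>q. dcols \<Phi> (r *\<^sub>R q)) (rep_frame n))"

definition crosscap_map :: "complex \<times> complex \<Rightarrow> complex \<times> complex \<times> complex" where
  "crosscap_map p = ((fst p)\<^sup>2, fst p * snd p, snd p)"

definition is_crosscap :: "(complex \<times> complex \<Rightarrow> complex \<times> complex \<times> complex) \<Rightarrow> complex \<times> complex \<Rightarrow> bool" where
  "is_crosscap f z \<longleftrightarrow> (\<exists>U V h g k g'.
      open U \<and> z \<in> U \<and> open V \<and> f ` U \<subseteq> V \<and>
      holo22 h U \<and> inj_on h U \<and> open (h ` U) \<and> holo22 g (h ` U) \<and> (\<forall>p\<in>U. g (h p) = p) \<and>
      holo33 k V \<and> inj_on k V \<and> open (k ` V) \<and> holo33 g' (k ` V) \<and> (\<forall>y\<in>V. g' (k y) = y) \<and>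
      h z = 0 \<and> k (f z) = 0 \<and> (\<forall>p\<in>U. k (f p) = crosscap_map (h p)))"

end

theory Submission
  imports Defs "HOL-Complex_Analysis.Complex_Analysis"
begin

text \<open>
  Fix a small parameter \<open>l \<noteq> 0\<close> and let \<open>P, Q\<close> be the columns of the derivative of \<open>F l\<close> on a small ball.
  At a cross cap the rank is exactly one, so for all but finitely many \<open>\<alpha>\<close> the vector field \<open>Q + \<alpha> P\<close>
  has no zeros and can be completed to a frame \<open>E1, E2, Q + \<alpha> P\<close> over the ball. Contracting
  the frame shows that \<open>(P, Q)\<close> restricted to the sphere is homotopic to \<open>((a, b, 0), e3)\<close>, where \<open>a, b\<close> are
  the coordinates of \<open>P\<close> along \<open>E1, E2\<close>. The common zeros of \<open>a, b\<close> are the cross caps, and the derivative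
  of \<open>(a, b)\<close> there is complex linear and invertible. Dividing by the quaternions \<open>z - p\<close>, one zero \<open>p\<close> at a time,
  shows that \<open>(a, b)\<close> is homotopic on the sphere to the quaternionic power \<open>q\<close> to the number of zeros,
  which is the first column of the generator power. The number of cross caps is locally constant
  in \<open>l\<close> by the inverse function theorem, hence constant on a punctured disc, and the derivatives of \<open>\<Phi>\<close>
  and \<open>F l\<close> are homotopic on the sphere by compactness.
\<close>

section \<open>Homotopies of maps on spheres\<close>

text \<open>No homotopy group and no degree is computed: an explicit homotopy to
  \<open>rep_frame\<close> is built. All cross caps count with the same sign because invertible
  complex matrices can be joined to the identity: along the complex line through two matrices the
  determinant is a polynomial, and its finitely many roots do not separate the plane. The shear by
  \<alpha> is there because \<open>Q\<close> itself vanishes at a cross cap where the second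
  coordinate direction spans the kernel. The fields \<open>E1\<close>, \<open>E2\<close> are only
  continuous, so \<open>a\<close> and \<open>b\<close> need not be holomorphic; their
  differentiability is claimed only at their zeros, near which they are combinations of the chart
  coordinates with continuous coefficients. Division by \<open>z - p\<close> does not preserve
  complex linearity of derivatives, so the induction over the zeros carries a homotopy condition,
  \<open>simple_zero\<close>, instead of the derivative. At \<open>l = 0\<close> the singularity may
  be degenerate, hence the count is compared along the punctured disc, which is still
  connected.\<close>

abbreviation sphere_homotopic ::
    "'b::topological_space set \<Rightarrow> ('a::real_normed_vector \<Rightarrow> 'b) \<Rightarrow> ('a \<Rightarrow> 'b) \<Rightarrow> bool" where
  "sphere_homotopic T f g \<equiv> homotopic_with_canon (\<lambda>_. True) (sphere 0 1) T f g"

lemma homotopic_with_canonI: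
  assumes "continuous_on ({0..1} \<times> S) (\<lambda>(t, x). h t x)"
    and "\<And>t x. t \<in> {0..1::real} \<Longrightarrow> x \<in> S \<Longrightarrow> h t x \<in> T"
    and "\<And>x. x \<in> S \<Longrightarrow> h 0 x = f x" "\<And>x. x \<in> S \<Longrightarrow> h 1 x = g x"
  shows "homotopic_with_canon (\<lambda>_. True) S T f g"
  by (subst homotopic_with; simp; intro exI[of _ "\<lambda>(t, x). h t x"]) (use assms in \<open>auto simp: Pi_def\<close>)

lemma homotopic_with_canon_eq:
  assumes "homotopic_with_canon (\<lambda>_. True) S T f g"
    and "\<And>x. x \<in> S \<Longrightarrow> f' x = f x" "\<And>x. x \<in> S \<Longrightarrow> g' x = g x"
  shows "homotopic_with_canon (\<lambda>_. True) S T f' g'"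
  by (rule homotopic_with_eq[OF assms(1)]) (use assms in auto)

lemma homotopic_with_canon_combine:
  assumes "homotopic_with_canon (\<lambda>_. True) S T f f'" "homotopic_with_canon (\<lambda>_. True) S T' g g'"
    and m: "continuous_on (T \<times> T') (\<lambda>(x, y). m x y)"
    and mT: "\<And>x y. x \<in> T \<Longrightarrow> y \<in> T' \<Longrightarrow> m x y \<in> T''"
  shows "homotopic_with_canon (\<lambda>_. True) S T'' (\<lambda>x. m (f x) (g x)) (\<lambda>x. m (f' x) (g' x))"
proof -
  from assms(1) obtain h where h: "continuous_on ({0..1} \<times> S) h" "h \<in> {0..1::real} \<times> S \<rightarrow> T"
     "\<And>x. x \<in> S \<Longrightarrow> h (0, x) = f x" "\<And>x. x \<in> S \<Longrightarrow> h (1, x) = f' x"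
    by (subst (asm) homotopic_with) (auto simp: image_subset_iff_funcset)
  from assms(2) obtain k where k: "continuous_on ({0..1} \<times> S) k" "k \<in> {0..1::real} \<times> S \<rightarrow> T'"
     "\<And>x. x \<in> S \<Longrightarrow> k (0, x) = g x" "\<And>x. x \<in> S \<Longrightarrow> k (1, x) = g' x"
    by (subst (asm) homotopic_with) (auto simp: image_subset_iff_funcset)
  show ?thesis
  proof (rule homotopic_with_canonI[where h = "\<lambda>t x. m (h (t, x)) (k (t, x))"])
    have "continuous_on ({0..1} \<times> S) (\<lambda>p. (h p, k p))"
      by (intro continuous_intros h k)
    then have "continuous_on ({0..1} \<times> S) ((\<lambda>(x, y). m x y) \<circ> (\<lambda>p. (h p, k p)))"
      by (rule continuous_on_compose) (rule continuous_on_subset[OF m], use h k in auto)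
    then show "continuous_on ({0..1} \<times> S) (\<lambda>(t, x). m (h (t, x)) (k (t, x)))"
      by (simp add: o_def case_prod_beta)
  qed (use h k mT in \<open>auto simp: Pi_iff\<close>)
qed

lemma path_connected_punctured: "path_connected (- {0 :: 'a::euclidean_space})" if "2 \<le> DIM('a)"
  using path_connected_open_diff_countable[of "UNIV :: 'a set" "{0}"] that
  by (simp add: Compl_eq_Diff_UNIV connected_UNIV)

text \<open>An extension over the ball contracts the map to some constant \<open>d\<close>; in
  dimension at least 2 the punctured space is path connected, so \<open>d\<close> can be moved to
  the prescribed \<open>c\<close>.\<close>

lemma sphere_homotopic_const_of_cball:
  fixes k :: "'a::euclidean_space \<Rightarrow> 'b::euclidean_space"
  assumes "2 \<le> DIM('b)" and k: "continuous_on (cball 0 1) k" "\<And>x. x \<in> cball 0 1 \<Longrightarrow> k x \<noteq> 0"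
    and c: "c \<noteq> 0"
  shows "sphere_homotopic (- {0}) k (\<lambda>_. c)"
proof -
  have "\<exists>g. continuous_on (cball 0 1) g \<and> g ` cball 0 1 \<subseteq> - {0} \<and> (\<forall>x\<in>sphere 0 1. g x = k x)"
    using k by (intro exI[of _ k]) auto
  then obtain d where d: "sphere_homotopic (- {0}) k (\<lambda>_. d)"
    using nullhomotopic_from_sphere_extension[of 0 1 "-{0}" k] by metis
  show ?thesis
  \<comment> \<open>That \<open>d\<close> is nonzero is known only because it is a value of the
    homotopy, which takes a point of the sphere.\<close>
  proof (cases "sphere (0::'a) 1 = {}")
    case True
    then show ?thesis by (simp add: homotopic_with_canon_on_empty)
  next
    case False
    then have "d \<in> - {0}"
      using homotopic_with_imp_subset2[OF d] by (metis all_not_in_conv image_subset_iff)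
    then have "path_component (- {0}) d c"
      using path_connected_punctured[OF assms(1)] c by (auto simp: path_connected_component)
    then obtain \<gamma> where \<gamma>: "path \<gamma>" "path_image \<gamma> \<subseteq> - {0}" "pathstart \<gamma> = d" "pathfinish \<gamma> = c"
      by (auto simp: path_component_def)
    then have "sphere_homotopic (- {0}) (\<lambda>_. d) (\<lambda>_. c)"
      by (intro homotopic_with_canonI[where h = "\<lambda>t _. \<gamma> t"])
         (auto simp: path_def pathstart_def pathfinish_def path_image_def case_prod_beta
            intro!: continuous_on_compose2[of _ \<gamma> _ fst] continuous_intros)
    with d show ?thesis by (rule homotopic_with_trans)
  qed
qed

section \<open>Quaternions\<close>

text \<open>The product is the one for which \<^const>\<open>umat\<close> is multiplicative.\<close>

definition qmul :: "complex \<times> complex \<Rightarrow> complex \<times> complex \<Rightarrow> complex \<times> complex" where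
  "qmul p q = (fst p * fst q - cnj (snd p) * snd q, snd p * fst q + cnj (fst p) * snd q)"

definition qinv :: "complex \<times> complex \<Rightarrow> complex \<times> complex" where
  "qinv p = (1 / (norm p)\<^sup>2) *\<^sub>R (cnj (fst p), - snd p)"

fun qpow :: "complex \<times> complex \<Rightarrow> nat \<Rightarrow> complex \<times> complex" where
  "qpow q 0 = (1, 0)"
| "qpow q (Suc n) = qmul q (qpow q n)"

lemma qmul_assoc: "qmul (qmul p q) r = qmul p (qmul q r)"
  by (simp add: qmul_def algebra_simps)

lemma qmul_one [simp]: "qmul (1, 0) q = q" "qmul q (1, 0) = q"
  by (simp_all add: qmul_def)

lemma norm_prod_sq: "(norm (p :: complex \<times> complex))\<^sup>2 = (norm (fst p))\<^sup>2 + (norm (snd p))\<^sup>2"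
  by (simp add: norm_prod_def)

lemma of_real_norm_prod_sq:
  "complex_of_real ((norm (p :: complex \<times> complex))\<^sup>2) = fst p * cnj (fst p) + snd p * cnj (snd p)"
  by (simp add: norm_prod_sq complex_norm_square flip: of_real_power)

lemma qinv_eq:
  "qinv p = (cnj (fst p) / complex_of_real ((norm p)\<^sup>2), - snd p / complex_of_real ((norm p)\<^sup>2))"
  by (simp add: qinv_def scaleR_conv_of_real)

lemma qmul_qinv:
  assumes "p \<noteq> 0" shows "qmul p (qinv p) = (1, 0)" "qmul (qinv p) p = (1, 0)"
proof -
  have n: "complex_of_real ((norm p)\<^sup>2) \<noteq> 0" using assms by simp
  show "qmul p (qinv p) = (1, 0)" "qmul (qinv p) p = (1, 0)"
    using n
    by (simp_all add: qmul_def qinv_eq prod_eq_iff divide_simps del: of_real_power)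
       (simp_all only: of_real_norm_prod_sq, simp_all add: algebra_simps)
qed

lemma one_zero_nonzero [simp]: "(1, 0) \<noteq> (0 :: complex \<times> complex)"
  by (simp add: zero_prod_def)

lemma qmul_zero [simp]: "qmul 0 q = 0" "qmul q 0 = 0"
  by (simp_all add: qmul_def zero_prod_def)

lemma qmul_eq_0_iff: "qmul p q = 0 \<longleftrightarrow> p = 0 \<or> q = 0"
proof
  assume "qmul p q = 0"
  then have "q = 0" if "p \<noteq> 0"
    using qmul_assoc[of "qinv p" p q] qmul_qinv(2)[OF that] by simp
  then show "p = 0 \<or> q = 0" by blast
qed auto

lemma qinv_nonzero: "p \<noteq> 0 \<Longrightarrow> qinv p \<noteq> 0"
  using qmul_qinv(1)[of p] by auto

lemma continuous_on_qmul [continuous_intros]: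
  "continuous_on S f \<Longrightarrow> continuous_on S g \<Longrightarrow> continuous_on S (\<lambda>x. qmul (f x) (g x))"
  unfolding qmul_def by (intro continuous_intros)

lemma continuous_on_qinv [continuous_intros]:
  "continuous_on S f \<Longrightarrow> (\<And>x. x \<in> S \<Longrightarrow> f x \<noteq> 0) \<Longrightarrow> continuous_on S (\<lambda>x. qinv (f x))"
  unfolding qinv_def by (intro continuous_intros) auto

lemma continuous_on_qpow [continuous_intros]:
  "continuous_on S f \<Longrightarrow> continuous_on S (\<lambda>x. qpow (f x) n)"
  by (induction n) (auto intro!: continuous_intros)

lemma qpow_commute: "qmul (qpow q n) q = qmul q (qpow q n)"
  by (induction n) (simp_all add: qmul_assoc)

lemma qpow_eq_0: "qpow q n = 0 \<Longrightarrow> q = 0"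
  by (induction n) (auto simp: qmul_eq_0_iff)

text \<open>In terms of \<open>z + w j\<close>, \<open>qmul p q\<close> is the usual quaternion
  product of \<open>q\<close> and \<open>p\<close> in this order. It is the first column of the
  product of the matrices; powers do not feel the reversal.\<close>

lemma umat_qmul: "umat (qmul p q) = mmul2 (umat p) (umat q)"
  by (simp add: umat_def qmul_def algebra_simps)

lemma mpow2_umat: "mpow2 (umat q) n = umat (qpow q n)"
proof (induction n)
  case 0
  then show ?case by (simp add: umat_def)
next
  case (Suc n)
  then show ?case by (simp only: mpow2.simps qpow.simps umat_qmul)
qed

lemma rep_frame_qpow:
  "rep_frame (int n) q = ((fst (qpow q n), snd (qpow q n), 0),
     (- cnj (snd (qpow q n)), cnj (fst (qpow q n)), 0))"
  by (simp add: rep_frame_def upow_def mpow2_umat) (simp add: umat_def)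

lemma sphere_homotopic_qmul:
  assumes "sphere_homotopic (- {0}) f f'" "sphere_homotopic (- {0}) g g'"
  shows "sphere_homotopic (- {0}) (\<lambda>x. qmul (f x) (g x)) (\<lambda>x. qmul (f' x) (g' x))"
  by (rule homotopic_with_canon_combine[OF assms])
     (auto simp: case_prod_beta qmul_eq_0_iff intro!: continuous_intros)

section \<open>Counting simple zeros\<close>

definition simple_zero :: "(complex \<times> complex \<Rightarrow> complex \<times> complex) \<Rightarrow> complex \<times> complex \<Rightarrow> bool" where
  "simple_zero f p \<longleftrightarrow> (\<exists>\<rho>0>0. \<forall>\<rho>. 0 < \<rho> \<and> \<rho> < \<rho>0 \<longrightarrow>
     sphere_homotopic (- {0}) (\<lambda>x. f (p + \<rho> *\<^sub>R x)) (\<lambda>x. x))"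

text \<open>The segment from \<open>r *\<^sub>R q - p\<close> to \<open>q\<close> misses 0, since a
  zero would equate the norms \<open>(1 - t) * r + t\<close> and \<open>(1 - t) * norm p\<close>,
  and the first is larger.\<close>

lemma sphere_homotopic_shift_id:
  fixes p :: "'a::real_normed_vector"
  assumes "norm p < r"
  shows "sphere_homotopic (- {0}) (\<lambda>q. r *\<^sub>R q - p) (\<lambda>q. q)"
proof (rule homotopic_with_canonI[where h = "\<lambda>t q. ((1 - t) * r + t) *\<^sub>R q - (1 - t) *\<^sub>R p"])
  fix t :: real and x :: 'a assume t: "t \<in> {0..1}" and x: "x \<in> sphere 0 1"
  have r: "0 < r" using assms norm_ge_zero[of p] by linarith
  show "((1 - t) * r + t) *\<^sub>R x - (1 - t) *\<^sub>R p \<in> - {0}"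
  proof
    assume "((1 - t) * r + t) *\<^sub>R x - (1 - t) *\<^sub>R p \<in> {0}"
    then have "norm (((1 - t) * r + t) *\<^sub>R x) = norm ((1 - t) *\<^sub>R p)" by simp
    then have "(1 - t) * r + t = (1 - t) * norm p" using t x r by simp
    moreover have "(1 - t) * norm p \<le> (1 - t) * r" using t assms by (intro mult_left_mono) auto
    moreover have "(1 - t) * norm p < (1 - t) * r" if "t < 1" using that assms by simp
    ultimately show False using t unfolding atLeastAtMost_iff by (smt (verit, best))
  qed
qed (auto simp: case_prod_beta intro!: continuous_intros)

text \<open>On a ball around \<open>p\<close> the factor \<open>k\<close> has no zeros, so on small
  spheres it contracts to the quaternion 1. The equation for \<open>g\<close> may fail at
  \<open>p\<close> itself because the spheres avoid their centre.\<close>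

lemma simple_zero_qmul:
  assumes "simple_zero f p" "eventually (\<lambda>z. g z = qmul (f z) (k z)) (at p)"
    and "open U" "p \<in> U" "continuous_on U k" "\<And>z. z \<in> U \<Longrightarrow> k z \<noteq> 0"
  shows "simple_zero g p"
proof -
  obtain \<rho>1 where \<rho>1: "\<rho>1 > 0" "\<And>\<rho>. 0 < \<rho> \<Longrightarrow> \<rho> < \<rho>1 \<Longrightarrow>
     sphere_homotopic (- {0}) (\<lambda>x. f (p + \<rho> *\<^sub>R x)) (\<lambda>x. x)"
    using assms(1) unfolding simple_zero_def by blast
  obtain \<rho>2 where \<rho>2: "\<rho>2 > 0" "\<And>z. z \<noteq> p \<Longrightarrow> dist z p < \<rho>2 \<Longrightarrow> g z = qmul (f z) (k z)"
    using assms(2) unfolding eventually_at by auto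
  obtain \<rho>3 where \<rho>3: "\<rho>3 > 0" "cball p \<rho>3 \<subseteq> U"
    using assms(3,4) open_contains_cball by blast
  show ?thesis unfolding simple_zero_def
  proof (intro exI[of _ "min \<rho>1 (min \<rho>2 \<rho>3)"] conjI allI impI)
    show "0 < min \<rho>1 (min \<rho>2 \<rho>3)" using \<rho>1 \<rho>2 \<rho>3 by simp
    fix \<rho> assume \<rho>: "0 < \<rho> \<and> \<rho> < min \<rho>1 (min \<rho>2 \<rho>3)"
    have sub: "p + \<rho> *\<^sub>R x \<in> U" if "x \<in> cball 0 1" for x
    proof -
      have "\<rho> * norm x \<le> \<rho>3 * 1" using \<rho> that \<rho>3 by (intro mult_mono) auto
      then show ?thesis using \<rho>3 \<rho> by (intro subsetD[OF \<rho>3(2)]) (auto simp: dist_norm)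
    qed
    have "sphere_homotopic (- {0}) (\<lambda>x. k (p + \<rho> *\<^sub>R x)) (\<lambda>_. (1, 0))"
      by (intro sphere_homotopic_const_of_cball continuous_on_compose2[OF assms(5)] continuous_intros
            image_subsetI sub assms(6)) simp_all
    moreover have "sphere_homotopic (- {0}) (\<lambda>x. f (p + \<rho> *\<^sub>R x)) (\<lambda>x. x)" using \<rho> by (intro \<rho>1) auto
    ultimately have "sphere_homotopic (- {0}) (\<lambda>x. qmul (f (p + \<rho> *\<^sub>R x)) (k (p + \<rho> *\<^sub>R x))) (\<lambda>x. qmul x (1, 0))"
      by (intro sphere_homotopic_qmul)
    then show "sphere_homotopic (- {0}) (\<lambda>x. g (p + \<rho> *\<^sub>R x)) (\<lambda>x. x)"
    proof (rule homotopic_with_canon_eq)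
      fix x :: "complex \<times> complex" assume "x \<in> sphere 0 1"
      then show "g (p + \<rho> *\<^sub>R x) = qmul (f (p + \<rho> *\<^sub>R x)) (k (p + \<rho> *\<^sub>R x))"
        using \<rho> by (intro \<rho>2(2)) (auto simp: dist_norm)
    qed simp
  qed
qed

text \<open>A zero \<open>p\<close> is removed by dividing by the quaternion \<open>z - p\<close>: on a small sphere around \<open>p\<close>
  the quotient is null-homotopic, so it can be redefined inside without zeros.\<close>

lemma remove_simple_zero:
  assumes r: "r > 0" and f: "continuous_on (cball 0 r) f"
    and Z: "finite {z \<in> cball 0 r. f z = 0}" and p: "p \<in> ball 0 r" "f p = 0" "simple_zero f p"
  obtains f1 \<rho> where "continuous_on (cball 0 r) f1" "{z \<in> cball 0 r. f1 z = 0} = {z \<in> cball 0 r. f z = 0} - {p}"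
    "\<rho> > 0" "cball p \<rho> \<subseteq> ball 0 r" "cball p \<rho> \<inter> {z \<in> cball 0 r. f z = 0} = {p}"
    "\<forall>z\<in>- ball p \<rho>. f1 z = qmul (f z) (qinv (z - p))"
proof -
  let ?Z = "{z \<in> cball 0 r. f z = 0}"
  obtain \<rho>1 where \<rho>1: "\<rho>1 > 0" "\<And>\<rho>. 0 < \<rho> \<Longrightarrow> \<rho> < \<rho>1 \<Longrightarrow>
     sphere_homotopic (- {0}) (\<lambda>x. f (p + \<rho> *\<^sub>R x)) (\<lambda>x. x)"
    using p(3) unfolding simple_zero_def by blast
  have "open (ball 0 r - (?Z - {p}))" "p \<in> ball 0 r - (?Z - {p})"
    using Z p by (auto intro!: open_Diff finite_imp_closed)
  then obtain \<rho>2 where \<rho>2: "\<rho>2 > 0" "cball p \<rho>2 \<subseteq> ball 0 r - (?Z - {p})"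
    using open_contains_cball by blast
  define \<rho> where "\<rho> = min \<rho>1 \<rho>2 / 2"
  have \<rho>: "0 < \<rho>" "\<rho> < \<rho>1" "\<rho> \<le> \<rho>2" using \<rho>1 \<rho>2 by (auto simp: \<rho>_def)
  have sub: "cball p \<rho> \<subseteq> ball 0 r - (?Z - {p})" using \<rho>2 \<rho> by force
  \<comment> \<open>On the small sphere \<open>f\<close> can be replaced by \<open>x\<close>, and
    \<open>x\<close> times the inverse of \<open>\<rho> *\<^sub>R x\<close> is the constant
    \<open>1 / \<rho>\<close>.\<close>
  have "sphere_homotopic (- {0}) (\<lambda>x. qmul (f (p + \<rho> *\<^sub>R x)) (qinv (\<rho> *\<^sub>R x))) (\<lambda>x. qmul x (qinv (\<rho> *\<^sub>R x)))"
  proof (intro sphere_homotopic_qmul \<rho>1 \<rho> homotopic_with_canonI[where h = "\<lambda>t x. qinv (\<rho> *\<^sub>R x)"])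
    have nz: "\<rho> *\<^sub>R x \<noteq> 0" if "x \<in> sphere 0 1" for x :: "complex \<times> complex"
      using that \<rho> by (metis dist_0_norm mem_sphere norm_zero scaleR_eq_0_iff zero_neq_one less_irrefl)
    show "continuous_on ({0..1::real} \<times> sphere 0 1) (\<lambda>(t, x). qinv (\<rho> *\<^sub>R x))"
      unfolding case_prod_beta using nz by (intro continuous_intros) (auto simp del: mem_sphere)
    show "qinv (\<rho> *\<^sub>R x) \<in> - {0}" if "x \<in> sphere 0 1" for x
      using qinv_nonzero[OF nz[OF that]] by simp
  qed simp_all
  then have "sphere_homotopic (- {0}) (\<lambda>x. qmul (f (p + \<rho> *\<^sub>R x)) (qinv (\<rho> *\<^sub>R x))) (\<lambda>x. ((1 / \<rho>) *\<^sub>R (1, 0)))"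
  proof (rule homotopic_with_canon_eq)
    fix x :: "complex \<times> complex" assume "x \<in> sphere 0 1"
    then have "x \<noteq> 0" by auto
    have "qinv (\<rho> *\<^sub>R x) = (1 / \<rho>) *\<^sub>R qinv x"
      using \<rho> by (simp add: qinv_def power2_eq_square)
    then have "qmul x (qinv (\<rho> *\<^sub>R x)) = (1 / \<rho>) *\<^sub>R qmul x (qinv x)"
      by (simp add: qmul_def scaleR_conv_of_real algebra_simps)
    then show "(1 / \<rho>) *\<^sub>R (1, 0) = qmul x (qinv (\<rho> *\<^sub>R x))"
      using qmul_qinv(1)[OF \<open>x \<noteq> 0\<close>] by simp
  qed simp
  then have "homotopic_with_canon (\<lambda>_. True) (sphere p \<rho>) (- {0})
      ((\<lambda>x. qmul (f (p + \<rho> *\<^sub>R x)) (qinv (\<rho> *\<^sub>R x))) \<circ> (\<lambda>z. (1 / \<rho>) *\<^sub>R (z - p)))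
      ((\<lambda>x. ((1 / \<rho>) *\<^sub>R (1, 0))) \<circ> (\<lambda>z. (1 / \<rho>) *\<^sub>R (z - p)))"
    using \<rho> by (intro homotopic_with_compose_continuous_right)
      (auto intro!: continuous_intros simp: dist_norm norm_minus_commute)
  then have "homotopic_with_canon (\<lambda>_. True) (sphere p \<rho>) (- {0})
      (\<lambda>z. qmul (f z) (qinv (z - p))) (\<lambda>z. ((1 / \<rho>) *\<^sub>R (1, 0)))"
    by (rule homotopic_with_canon_eq) (use \<rho> in auto)
  then obtain g where g: "continuous_on (cball p \<rho>) g" "g ` cball p \<rho> \<subseteq> - {0}"
      "\<And>z. z \<in> sphere p \<rho> \<Longrightarrow> g z = qmul (f z) (qinv (z - p))"
    using nullhomotopic_from_sphere_extension[of p \<rho> "- {0}" "\<lambda>z. qmul (f z) (qinv (z - p))"] by blast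
  \<comment> \<open>The extension \<open>g\<close> without zeros fills the small ball; it agrees
    with the quotient on the bounding sphere, so the pieces glue continuously.\<close>
  define f1 where "f1 z = (if z \<in> cball p \<rho> then g z else qmul (f z) (qinv (z - p)))" for z
  show thesis
  proof (rule that[of f1 \<rho>])
    have "continuous_on (cball p \<rho> \<union> (cball 0 r - ball p \<rho>)) f1"
      unfolding f1_def
    proof (rule continuous_on_If)
      show "closed (cball p \<rho>)" "closed (cball 0 r - ball p \<rho>)"
        by auto
      show "continuous_on (cball 0 r - ball p \<rho>) (\<lambda>z. qmul (f z) (qinv (z - p)))"
        using \<rho> by (auto intro!: continuous_intros continuous_on_subset[OF f])
    qed (use g in auto)
    moreover have "cball p \<rho> \<union> (cball 0 r - ball p \<rho>) = cball 0 r"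
      using sub ball_subset_cball[of 0 r] ball_subset_cball[of p \<rho>] by blast
    ultimately show "continuous_on (cball 0 r) f1" by simp
    have "f1 z \<noteq> 0" if "z \<in> cball p \<rho>" for z using g(2) that by (auto simp: f1_def)
    moreover have "f1 z = 0 \<longleftrightarrow> f z = 0" if "z \<notin> cball p \<rho>" for z
    proof -
      have "z - p \<noteq> 0" using that \<rho> by auto
      then show ?thesis using that qinv_nonzero by (auto simp: f1_def qmul_eq_0_iff)
    qed
    moreover have "p \<in> cball p \<rho>" using \<rho> by simp
    ultimately show "{z \<in> cball 0 r. f1 z = 0} = ?Z - {p}"
      using sub by blast
    show "cball p \<rho> \<subseteq> ball 0 r" using sub by blast
    show "cball p \<rho> \<inter> ?Z = {p}" using sub \<open>p \<in> cball p \<rho>\<close> p by auto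
    show "\<forall>z\<in>- ball p \<rho>. f1 z = qmul (f z) (qinv (z - p))"
      using g(3) by (auto simp: f1_def)
  qed (use \<rho> in auto)
qed

text \<open>Induction on the number of zeros: on the outer sphere \<open>f\<close> is
  \<open>f1\<close> times \<open>z - p\<close>, where \<open>f1\<close> has lost the zero
  \<open>p\<close>, and \<open>z - p\<close> is homotopic to \<open>q\<close> there. Every zero thus
  contributes one factor \<open>q\<close>.\<close>

theorem sphere_homotopic_qpow_card_zeros:
  assumes "r > 0" "continuous_on (cball 0 r) f"
    and "finite {z \<in> cball 0 r. f z = 0}" "{z \<in> cball 0 r. f z = 0} \<subseteq> ball 0 r"
    and "\<And>p. p \<in> ball 0 r \<Longrightarrow> f p = 0 \<Longrightarrow> simple_zero f p"
  shows "sphere_homotopic (- {0}) (\<lambda>q. f (r *\<^sub>R q)) (\<lambda>q. qpow q (card {z \<in> cball 0 r. f z = 0}))"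
  using assms
proof (induction "card {z \<in> cball 0 r. f z = 0}" arbitrary: f)
  case 0
  then have "{z \<in> cball 0 r. f z = 0} = {}" by simp
  then have "f z \<noteq> 0" if "z \<in> cball 0 r" for z using that by blast
  then have "sphere_homotopic (- {0}) (\<lambda>q. f (r *\<^sub>R q)) (\<lambda>_. (1, 0))"
    using 0(2) by (intro sphere_homotopic_const_of_cball continuous_on_compose2[OF 0(3)]
        continuous_intros image_subsetI) (simp_all add: mult_left_le)
  then show ?case using 0(1) by simp
next
  case (Suc n)
  let ?Z = "{z \<in> cball 0 r. f z = 0}"
  obtain p where "p \<in> ?Z" using Suc(2) by (metis card.empty equals0I nat.distinct(1))
  then have p: "p \<in> ball 0 r" "f p = 0" "simple_zero f p"
    using subsetD[OF Suc.prems(4)] Suc.prems(5)[of p] by simp_all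
  obtain f1 \<rho> where f1: "continuous_on (cball 0 r) f1" "{z \<in> cball 0 r. f1 z = 0} = ?Z - {p}"
    "\<rho> > 0" "cball p \<rho> \<subseteq> ball 0 r" "cball p \<rho> \<inter> ?Z = {p}"
    "\<forall>z\<in>- ball p \<rho>. f1 z = qmul (f z) (qinv (z - p))"
    by (rule remove_simple_zero[OF Suc.prems(1,2,3) p]) (rule that)
  have card: "card {z \<in> cball 0 r. f1 z = 0} = n"
    unfolding f1(2) using Suc.hyps(2) \<open>p \<in> ?Z\<close> by (metis card_Diff_singleton diff_Suc_1)
  have "sphere_homotopic (- {0}) (\<lambda>q. f1 (r *\<^sub>R q)) (\<lambda>q. qpow q (card {z \<in> cball 0 r. f1 z = 0}))"
  proof (rule Suc.hyps(1))
    show "simple_zero f1 p'" if p': "p' \<in> ball 0 r" "f1 p' = 0" for p'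
    proof -
      have "p' \<in> {z \<in> cball 0 r. f1 z = 0}" using that by simp
      then have "p' \<in> ?Z - {p}" unfolding f1(2) .
      then have "f p' = 0" "p' \<notin> cball p \<rho>" using f1(5) by blast+
      \<comment> \<open>Away from \<open>p\<close> the quotient differs from \<open>f\<close> by the
        invertible factor \<open>qinv (z - p)\<close>, so the remaining zeros keep their
        index.\<close>
      show ?thesis
      proof (rule simple_zero_qmul)
        show "simple_zero f p'" by (rule Suc.prems) fact+
        show "p' \<in> - cball p \<rho>" using \<open>p' \<notin> cball p \<rho>\<close> by simp
        then show "eventually (\<lambda>z. f1 z = qmul (f z) (qinv (z - p))) (at p')"
          by (intro eventually_at_in_open'[of "- cball p \<rho>", THEN eventually_mono] bspec[OF f1(6)]) auto
        show "continuous_on (- cball p \<rho>) (\<lambda>z. qinv (z - p))" "\<And>z. z \<in> - cball p \<rho> \<Longrightarrow> qinv (z - p) \<noteq> 0"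
          using f1(3) by (auto intro!: continuous_intros qinv_nonzero)
      qed auto
    qed
    show "finite {z \<in> cball 0 r. f1 z = 0}" "{z \<in> cball 0 r. f1 z = 0} \<subseteq> ball 0 r"
      unfolding f1(2) using Suc.prems(3,4) by blast+
  qed (rule card[symmetric] Suc.prems f1)+
  then have "sphere_homotopic (- {0}) (\<lambda>q. qmul (f1 (r *\<^sub>R q)) (r *\<^sub>R q - p)) (\<lambda>q. qmul (qpow q n) q)"
    unfolding card by (intro sphere_homotopic_qmul sphere_homotopic_shift_id) (use p in auto)
  then show ?case
  proof (rule homotopic_with_canon_eq)
    fix q :: "complex \<times> complex" assume q: "q \<in> sphere 0 1"
    then have "r *\<^sub>R q \<notin> ball 0 r" using Suc.prems(1) by auto
    then have out: "r *\<^sub>R q \<notin> cball p \<rho>" using f1(4) by blast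
    then have "r *\<^sub>R q - p \<noteq> 0" using f1(3) by auto
    with out show "f (r *\<^sub>R q) = qmul (f1 (r *\<^sub>R q)) (r *\<^sub>R q - p)"
      by (subst bspec[OF f1(6)]) (auto simp: qmul_assoc qmul_qinv)
  next
    fix q :: "complex \<times> complex"
    show "qpow q (card ?Z) = qmul (qpow q n) q"
      unfolding Suc(2)[symmetric] by (simp add: qpow_commute)
  qed
qed

section \<open>Frames in three-space\<close>

text \<open>The ring is left open because \<open>sphere_homotopic_const_frame\<close> needs this
  determinant for triples of polynomials too.\<close>

definition det3 :: "'a::comm_ring_1 \<times> 'a \<times> 'a \<Rightarrow> 'a \<times> 'a \<times> 'a \<Rightarrow> 'a \<times> 'a \<times> 'a \<Rightarrow> 'a" where
  "det3 x y z =
     fst x * (fst (snd y) * snd (snd z) - snd (snd y) * fst (snd z))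
   + fst (snd x) * (snd (snd y) * fst z - fst y * snd (snd z))
   + snd (snd x) * (fst y * fst (snd z) - fst (snd y) * fst z)"

definition cr3 :: "complex \<times> complex \<times> complex \<Rightarrow> complex \<times> complex \<times> complex \<Rightarrow> complex \<times> complex \<times> complex" where
  "cr3 y z = (fst (snd y) * snd (snd z) - snd (snd y) * fst (snd z),
     snd (snd y) * fst z - fst y * snd (snd z), fst y * fst (snd z) - fst (snd y) * fst z)"

lemma continuous_on_det3 [continuous_intros]:
  fixes f g h :: "'a::topological_space \<Rightarrow> complex \<times> complex \<times> complex"
  shows "continuous_on S f \<Longrightarrow> continuous_on S g \<Longrightarrow> continuous_on S h \<Longrightarrow>
    continuous_on S (\<lambda>x. det3 (f x) (g x) (h x))"
  unfolding det3_def by (intro continuous_intros)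

lemma continuous_on_cr3 [continuous_intros]:
  "continuous_on S f \<Longrightarrow> continuous_on S g \<Longrightarrow> continuous_on S (\<lambda>x. cr3 (f x) (g x))"
  unfolding cr3_def by (intro continuous_intros)

lemma continuous_on_csc3 [continuous_intros]:
  "continuous_on S f \<Longrightarrow> continuous_on S g \<Longrightarrow> continuous_on S (\<lambda>x. csc3 (f x) (g x))"
  unfolding csc3_def by (intro continuous_intros)

lemma csc3_0 [simp]: "csc3 0 v = 0" "csc3 c 0 = 0"
  by (simp_all add: csc3_def zero_prod_def)

lemma csc3_1 [simp]: "csc3 1 v = v"
  by (simp add: csc3_def)

lemma csc3_eq_0_iff: "csc3 c v = 0 \<longleftrightarrow> c = 0 \<or> v = 0"
  by (auto simp: csc3_def zero_prod_def prod_eq_iff)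

text \<open>\<open>cr3\<close> collects the 2x2 minors. If they vanish, each coordinate
  \<open>i\<close> gives a relation \<open>Q_i P - P_i Q = 0\<close>, and some \<open>P_i\<close> is
  nonzero; conversely the cross product of a relation with \<open>Q\<close> or \<open>P\<close>
  isolates one coefficient.\<close>

lemma cindep2_iff: "(P, Q) \<in> cindep2 \<longleftrightarrow> cr3 P Q \<noteq> 0"
proof
  assume *: "(P, Q) \<in> cindep2"
  have "P \<noteq> 0"
  proof
    assume "P = 0"
    then have "csc3 1 P + csc3 0 Q = 0" by simp
    with * show False unfolding cindep2_def by fastforce
  qed
  show "cr3 P Q \<noteq> 0"
  proof
    assume "cr3 P Q = 0"
    then have eq: "csc3 (fst Q) P + csc3 (- fst P) Q = 0"
        "csc3 (fst (snd Q)) P + csc3 (- fst (snd P)) Q = 0"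
        "csc3 (snd (snd Q)) P + csc3 (- snd (snd P)) Q = 0"
      by (simp_all add: cr3_def csc3_def zero_prod_def prod_eq_iff algebra_simps)
    from * have "\<And>a b. csc3 a P + csc3 b Q = 0 \<Longrightarrow> b = 0" unfolding cindep2_def by blast
    from this[OF eq(1)] this[OF eq(2)] this[OF eq(3)] \<open>P \<noteq> 0\<close> show False
      by (simp add: prod_eq_iff)
  qed
next
  assume *: "cr3 P Q \<noteq> 0"
  have "a = 0 \<and> b = 0" if "csc3 a P + csc3 b Q = 0" for a b
  proof -
    have "csc3 a (cr3 P Q) = cr3 (csc3 a P + csc3 b Q) Q" "csc3 b (cr3 P Q) = cr3 P (csc3 a P + csc3 b Q)"
      by (simp_all add: cr3_def csc3_def algebra_simps)
    with that have "csc3 a (cr3 P Q) = 0" "csc3 b (cr3 P Q) = 0"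
      by (simp_all add: cr3_def zero_prod_def)
    with * show ?thesis by (simp add: csc3_eq_0_iff)
  qed
  then show "(P, Q) \<in> cindep2" by (simp add: cindep2_def)
qed

lemma cindep2_if_det3: "det3 X P Q \<noteq> 0 \<Longrightarrow> (P, Q) \<in> cindep2"
  by (auto simp: cindep2_iff cr3_def det3_def zero_prod_def)

text \<open>This turns a map to the punctured plane into a map to 2-frames. Adjoining
  \<open>Y\<close> or \<open>X\<close> to the pair gives the determinants
  \<open>- a * det3 X Y Z\<close> and \<open>b * det3 X Y Z\<close>.\<close>

lemma frame_combination_cindep2:
  assumes "det3 X Y Z \<noteq> 0" "(a, b) \<noteq> 0"
  shows "(csc3 a X + csc3 b Y, Z) \<in> cindep2"
proof -
  have "det3 Y (csc3 a X + csc3 b Y) Z = - a * det3 X Y Z" "det3 X (csc3 a X + csc3 b Y) Z = b * det3 X Y Z"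
    by (simp_all add: det3_def csc3_def algebra_simps)
  with assms have "det3 Y (csc3 a X + csc3 b Y) Z \<noteq> 0 \<or> det3 X (csc3 a X + csc3 b Y) Z \<noteq> 0"
    by (auto simp: zero_prod_def)
  then show ?thesis using cindep2_if_det3 by blast
qed

lemma cramer3:
  "csc3 (det3 x y z) w = csc3 (det3 w y z) x + csc3 (det3 x w z) y + csc3 (det3 x y w) z"
  by (simp add: det3_def csc3_def prod_eq_iff algebra_simps)

definition hinner :: "complex \<times> complex \<times> complex \<Rightarrow> complex \<times> complex \<times> complex \<Rightarrow> complex" where
  "hinner x y = fst x * cnj (fst y) + fst (snd x) * cnj (fst (snd y)) + snd (snd x) * cnj (snd (snd y))"

lemma Re_hinner: "Re (hinner x y) = x \<bullet> y"
  by (simp add: hinner_def inner_prod_def inner_complex_def)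

text \<open>Up to the factor \<open>hinner q q\<close>, which avoids a division, \<open>e\<close>
  and \<open>f\<close> are projected to the Hermitian complement of \<open>q\<close>. The
  projections span at most this plane, so only the component of \<open>q'\<close> along
  \<open>q\<close> enters.\<close>

lemma det3_project:
  "det3 (csc3 (hinner q q) e - csc3 (hinner e q) q) (csc3 (hinner q q) f - csc3 (hinner f q) q) q'
    = hinner q q * hinner q' q * det3 e f q"
  by (simp add: det3_def csc3_def hinner_def algebra_simps)

text \<open>Completing fields projected off \<open>Q\<close> also complete any \<open>Q'\<close>
  nowhere orthogonal to \<open>Q\<close>. The real inner product is the real part of
  \<open>hinner\<close>, so it suffices that the real one does not vanish.\<close>

lemma frame_step:
  fixes Q Q' E1 E2 :: "'a::topological_space \<Rightarrow> complex \<times> complex \<times> complex"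
  assumes "continuous_on S Q" "continuous_on S E1" "continuous_on S E2"
    and "\<And>z. z \<in> S \<Longrightarrow> det3 (E1 z) (E2 z) (Q z) \<noteq> 0"
    and "\<And>z. z \<in> S \<Longrightarrow> Q z \<noteq> 0" "\<And>z. z \<in> S \<Longrightarrow> Q' z \<bullet> Q z \<noteq> 0"
  obtains E1' E2' :: "'a \<Rightarrow> complex \<times> complex \<times> complex" where "continuous_on S E1'" "continuous_on S E2'"
    "\<forall>z\<in>S. det3 (E1' z) (E2' z) (Q' z) \<noteq> 0"
proof (rule that[of "\<lambda>z. csc3 (hinner (Q z) (Q z)) (E1 z) - csc3 (hinner (E1 z) (Q z)) (Q z)"
                    "\<lambda>z. csc3 (hinner (Q z) (Q z)) (E2 z) - csc3 (hinner (E2 z) (Q z)) (Q z)"])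
  have "hinner (Q z) (Q z) \<noteq> 0" "hinner (Q' z) (Q z) \<noteq> 0" if "z \<in> S" for z
    using assms(5,6)[OF that] Re_hinner[of "Q z" "Q z"] Re_hinner[of "Q' z" "Q z"] by auto
  then show "\<forall>z\<in>S. det3 (csc3 (hinner (Q z) (Q z)) (E1 z) - csc3 (hinner (E1 z) (Q z)) (Q z))
      (csc3 (hinner (Q z) (Q z)) (E2 z) - csc3 (hinner (E2 z) (Q z)) (Q z)) (Q' z) \<noteq> 0"
    using assms(4) by (simp add: det3_project)
qed (unfold hinner_def; intro continuous_intros assms)+

lemma ex_det3_nonzero: "Q \<noteq> 0 \<Longrightarrow> \<exists>E1 E2. det3 E1 E2 Q \<noteq> (0 :: complex)"
proof -
  assume "Q \<noteq> 0"
  then have "det3 (0, 1, 0) (0, 0, 1) Q \<noteq> 0 \<or> det3 (0, 0, 1) (1, 0, 0) Q \<noteq> 0 \<or> det3 (1, 0, 0) (0, 1, 0) Q \<noteq> 0"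
    by (auto simp: det3_def prod_eq_iff)
  then show ?thesis by blast
qed

text \<open>Deform \<open>Q\<close> to the constant \<open>Q 0\<close> through \<open>Q (k z / n)\<close>: consecutive maps are nowhere
  orthogonal, so \<open>frame_step\<close> carries a frame along.\<close>

lemma frame_completion:
  fixes Q :: "'a::euclidean_space \<Rightarrow> complex \<times> complex \<times> complex"
  assumes r: "r > 0" and Q: "continuous_on (cball 0 r) Q" and Q0: "\<And>z. z \<in> cball 0 r \<Longrightarrow> Q z \<noteq> 0"
  obtains E1 E2 where "continuous_on (cball 0 r) E1" "continuous_on (cball 0 r) E2"
    "\<forall>z\<in>cball 0 r. det3 (E1 z) (E2 z) (Q z) = 1"
proof -
  have "0 \<notin> Q ` cball 0 r" using Q0 by (metis imageE)
  moreover have "compact (Q ` cball 0 r)" by (intro compact_continuous_image Q compact_cball)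
  ultimately obtain m where m: "m > 0" "\<And>z. z \<in> cball 0 r \<Longrightarrow> m \<le> norm (Q z)"
    using separate_point_closed[of "Q ` cball 0 r" 0] compact_imp_closed by force
  have "uniformly_continuous_on (cball 0 r) Q"
    by (intro compact_uniformly_continuous Q compact_cball)
  then obtain d where d: "d > 0"
    "\<And>x y. x \<in> cball 0 r \<Longrightarrow> y \<in> cball 0 r \<Longrightarrow> dist x y < d \<Longrightarrow> dist (Q x) (Q y) < m"
    using m(1) unfolding uniformly_continuous_on_def by (metis dist_commute)
  \<comment> \<open>The points \<open>k z / n\<close> and \<open>(k + 1) z / n\<close> are at most
    \<open>r / n < d\<close> apart, so the values of \<open>Q\<close> there differ by less than the
    lower bound \<open>m\<close> of its norm.\<close>
  obtain n :: nat where n: "n > 0" "r / d < n"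
    by (metis reals_Archimedean2 r d(1) divide_pos_pos of_nat_0_less_iff order_less_trans)
  define R where "R k z = Q ((real k / n) *\<^sub>R z)" for k z
  have sub: "(real k / n) *\<^sub>R z \<in> cball 0 r" if "k \<le> n" "z \<in> cball 0 r" for k and z :: 'a
  proof -
    have "(real k / n) * norm z \<le> 1 * r" using that n by (intro mult_mono) auto
    then show ?thesis by simp
  qed
  have "\<exists>E1 E2. continuous_on (cball 0 r) E1 \<and> continuous_on (cball 0 r) E2 \<and>
      (\<forall>z\<in>cball 0 r. det3 (E1 z) (E2 z) (R k z) \<noteq> 0)" if "k \<le> n" for k
    using that
  proof (induction k)
    case 0
    obtain e f where "det3 e f (Q 0) \<noteq> 0" using ex_det3_nonzero[of "Q 0"] Q0[of 0] r by auto
    then show ?case by (intro exI[of _ "\<lambda>_. e"] exI[of _ "\<lambda>_. f"]) (simp add: R_def)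
  next
    case (Suc k)
    then obtain E1 E2 where E: "continuous_on (cball 0 r) E1" "continuous_on (cball 0 r) E2"
      "\<And>z. z \<in> cball 0 r \<Longrightarrow> det3 (E1 z) (E2 z) (R k z) \<noteq> 0" by auto
    have cont: "continuous_on (cball 0 r) (R k)"
      unfolding R_def using Suc sub by (intro continuous_on_compose2[OF Q] continuous_intros image_subsetI) simp_all
    have nz: "R k z \<noteq> 0" if "z \<in> cball 0 r" for z
      unfolding R_def using that Suc by (intro Q0 sub) auto
    have ort: "R (Suc k) z \<bullet> R k z \<noteq> 0" if z: "z \<in> cball 0 r" for z
    proof -
      let ?x = "(real (Suc k) / n) *\<^sub>R z" and ?y = "(real k / n) *\<^sub>R z"
      have "dist ?x ?y = norm ((1 / n) *\<^sub>R z)"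
        unfolding dist_norm by (simp add: scaleR_diff_left[symmetric] diff_divide_distrib[symmetric])
      also have "\<dots> \<le> r / n" using z by (simp add: divide_right_mono)
      also have "\<dots> < d" using n d by (simp add: field_simps)
      finally have "dist (Q ?x) (Q ?y) < m"
        by (intro d sub z) (use Suc in auto)
      \<comment> \<open>A change smaller than the vector itself leaves a positive inner product with
        it, by the Cauchy-Schwarz inequality.\<close>
      then have "norm (R (Suc k) z - R k z) < norm (R k z)"
        using m(2)[OF sub[OF _ z, of k]] Suc by (simp add: R_def dist_norm)
      then have "norm (R (Suc k) z - R k z) * norm (R k z) < norm (R k z) * norm (R k z)"
        using nz[OF z] by (intro mult_strict_right_mono) auto
      then have "\<bar>(R (Suc k) z - R k z) \<bullet> R k z\<bar> < R k z \<bullet> R k z"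
        using Cauchy_Schwarz_ineq2[of "R (Suc k) z - R k z" "R k z"]
        by (simp add: dot_square_norm power2_eq_square)
      then show ?thesis by (auto simp: inner_diff_left)
    qed
    show ?case
      by (rule frame_step[OF cont E(1,2), where Q' = "R (Suc k)"]) (use E(3) nz ort in blast)+
  qed
  from this[of n] obtain E1 E2 where E: "continuous_on (cball 0 r) E1" "continuous_on (cball 0 r) E2"
      "\<And>z. z \<in> cball 0 r \<Longrightarrow> det3 (E1 z) (E2 z) (Q z) \<noteq> 0"
    using n by (auto simp: R_def)
  \<comment> \<open>Rescaling \<open>E1\<close> makes the determinant 1, so that Cramer's rule gives
    the frame coordinates without a denominator.\<close>
  show thesis
  proof (rule that[of "\<lambda>z. csc3 (1 / det3 (E1 z) (E2 z) (Q z)) (E1 z)" E2])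
    show "continuous_on (cball 0 r) (\<lambda>z. csc3 (1 / det3 (E1 z) (E2 z) (Q z)) (E1 z))"
      using E by (intro continuous_intros Q) auto
    have "det3 (csc3 c x) y z = c * det3 x y z" for c and x y z :: "complex \<times> complex \<times> complex"
      by (simp add: det3_def csc3_def algebra_simps)
    then show "\<forall>z\<in>cball 0 r. det3 (csc3 (1 / det3 (E1 z) (E2 z) (Q z)) (E1 z)) (E2 z) (Q z) = 1"
      using E by simp
  qed (fact E)
qed

section \<open>Connectedness of linear groups\<close>

text \<open>Applied to the determinant along the complex line from a matrix to the identity, this
  replaces path connectedness of the complex linear groups. A real parameter could not go around the
  roots.\<close>

lemma path_avoiding_roots:
  fixes p :: "complex poly"
  assumes "poly p 0 \<noteq> 0" "poly p 1 \<noteq> 0"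
  obtains \<gamma> where "continuous_on {0..1::real} \<gamma>" "\<gamma> 0 = 0" "\<gamma> 1 = 1"
    "\<forall>t\<in>{0..1}. poly p (\<gamma> t) \<noteq> 0"
proof -
  have "p \<noteq> 0" using assms by auto
  define Z where "Z = {x. poly p x = 0}"
  have Z: "countable Z" unfolding Z_def by (intro countable_finite poly_roots_finite \<open>p \<noteq> 0\<close>)
  have "path_connected (UNIV - Z)"
    by (rule path_connected_open_diff_countable) (simp_all add: connected_UNIV Z)
  moreover have "0 \<in> UNIV - Z" "1 \<in> UNIV - Z" using assms by (simp_all add: Z_def)
  ultimately obtain \<gamma> where \<gamma>: "path \<gamma>" "path_image \<gamma> \<subseteq> UNIV - Z" "pathstart \<gamma> = 0" "pathfinish \<gamma> = 1"
    unfolding path_connected_def by blast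
  show thesis
  proof (rule that[of \<gamma>])
    have "\<gamma> t \<notin> Z" if "t \<in> {0..1}" for t using \<gamma>(2) that unfolding path_image_def by blast
    then show "\<forall>t\<in>{0..1}. poly p (\<gamma> t) \<noteq> 0" by (simp add: Z_def)
  qed (use \<gamma> in \<open>simp_all add: path_def pathstart_def pathfinish_def\<close>)
qed

lemma linear2_eq_0:
  fixes x y :: complex
  assumes "a * x + b * y = 0" "c * x + d * y = 0" "a * d - b * c \<noteq> 0"
  shows "x = 0" "y = 0"
proof -
  have "(a * d - b * c) * x = d * (a * x + b * y) - b * (c * x + d * y)"
    "(a * d - b * c) * y = a * (c * x + d * y) - c * (a * x + b * y)"
    by (simp_all add: algebra_simps)
  then have "(a * d - b * c) * x = 0" "(a * d - b * c) * y = 0"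
    unfolding assms(1,2) by simp_all
  with assms(3) show "x = 0" "y = 0" by simp_all
qed

lemma sphere_homotopic_linear2:
  fixes a b c d :: complex
  assumes "a * d - b * c \<noteq> 0"
  shows "sphere_homotopic (- {0}) (\<lambda>x. (a * fst x + b * snd x, c * fst x + d * snd x)) (\<lambda>x. x)"
proof -
  \<comment> \<open>\<open>poly p g\<close> is the determinant of \<open>(1 - g) M + g I\<close> for
    the matrix \<open>M\<close> of the map.\<close>
  define p where "p = [:a, 1 - a:] * [:d, 1 - d:] - [:b, - b:] * [:c, - c:]"
  have "poly p 0 \<noteq> 0" "poly p 1 \<noteq> 0"
    using assms unfolding p_def poly_mult poly_diff by simp_all
  then obtain \<gamma> where \<gamma>: "continuous_on {0..1::real} \<gamma>" "\<gamma> 0 = 0" "\<gamma> 1 = 1"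
    "\<forall>t\<in>{0..1}. poly p (\<gamma> t) \<noteq> 0"
    by (rule path_avoiding_roots)
  show ?thesis
  proof (rule homotopic_with_canonI[where h = "\<lambda>t x. ((a + \<gamma> t * (1 - a)) * fst x + (b + \<gamma> t * (- b)) * snd x,
         (c + \<gamma> t * (- c)) * fst x + (d + \<gamma> t * (1 - d)) * snd x)"])
    show "continuous_on ({0..1} \<times> sphere 0 1) (\<lambda>(t, x). ((a + \<gamma> t * (1 - a)) * fst x + (b + \<gamma> t * (- b)) * snd x,
         (c + \<gamma> t * (- c)) * fst x + (d + \<gamma> t * (1 - d)) * snd x))"
      unfolding case_prod_beta by (intro continuous_intros continuous_on_compose2[OF \<gamma>(1)]) auto
    fix t :: real and x :: "complex \<times> complex" assume t: "t \<in> {0..1}" and x: "x \<in> sphere 0 1"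
    have "x \<noteq> 0" using x by auto
    have "(a + \<gamma> t * (1 - a)) * (d + \<gamma> t * (1 - d)) - (b + \<gamma> t * (- b)) * (c + \<gamma> t * (- c)) \<noteq> 0"
      using bspec[OF \<gamma>(4) t] unfolding p_def poly_mult poly_diff by simp
    then show "((a + \<gamma> t * (1 - a)) * fst x + (b + \<gamma> t * (- b)) * snd x,
         (c + \<gamma> t * (- c)) * fst x + (d + \<gamma> t * (1 - d)) * snd x) \<in> - {0}"
      using \<open>x \<noteq> 0\<close> linear2_eq_0[of "a + \<gamma> t * (1 - a)" "fst x" "b + \<gamma> t * (- b)" "snd x" "c + \<gamma> t * (- c)" "d + \<gamma> t * (1 - d)"]
      by (auto simp: zero_prod_def prod_eq_iff)
  qed (use \<gamma> in auto)
qed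

section \<open>Invertible complex derivatives give simple zeros\<close>

lemma clinear2_eq:
  assumes "linear A" "\<And>c v. A (csc2 c v) = csc2 c (A v)"
  shows "A x = (fst (A (1, 0)) * fst x + fst (A (0, 1)) * snd x, snd (A (1, 0)) * fst x + snd (A (0, 1)) * snd x)"
proof -
  have "x = csc2 (fst x) (1, 0) + csc2 (snd x) (0, 1)" by (simp add: csc2_def)
  then have "A x = csc2 (fst x) (A (1, 0)) + csc2 (snd x) (A (0, 1))"
    by (metis assms(2) linear_add[OF assms(1)])
  then show ?thesis by (simp add: csc2_def algebra_simps)
qed

lemma clinear2_det_nonzero:
  assumes "linear A" "\<And>c v. A (csc2 c v) = csc2 c (A v)" and inj: "\<And>v. A v = 0 \<Longrightarrow> v = 0"
  shows "fst (A (1, 0)) * snd (A (0, 1)) - fst (A (0, 1)) * snd (A (1, 0)) \<noteq> 0"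
proof
  obtain a b c d where abcd: "A (1, 0) = (a, c)" "A (0, 1) = (b, d)" by fastforce
  have A: "A x = (a * fst x + b * snd x, c * fst x + d * snd x)" for x
    using clinear2_eq[OF assms(1,2), of x] by (simp add: abcd)
  assume "fst (A (1, 0)) * snd (A (0, 1)) - fst (A (0, 1)) * snd (A (1, 0)) = 0"
  \<comment> \<open>Up to sign these vectors are the columns of the adjugate matrix, which the
    matrix kills when its determinant is 0.\<close>
  then have "A (d, - c) = 0" "A (b, - a) = 0"
    by (simp_all add: A zero_prod_def algebra_simps)
  then have "(d, - c) = 0" "(b, - a) = 0" using inj by blast+
  then have "A (1, 0) = 0" by (simp add: A zero_prod_def)
  then show False using inj one_zero_nonzero by blast
qed

text \<open>On a small sphere the linearization error is at most half of the lower bound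
  \<open>m\<close> for \<open>A\<close>, so the segment from \<open>f\<close> to its linear part
  misses 0. The linear part is then joined to the identity through invertible complex
  matrices.\<close>

lemma simple_zero_if_derivative:
  assumes f: "(f has_derivative A) (at p)" "f p = 0"
    and A: "\<And>c v. A (csc2 c v) = csc2 c (A v)" "\<And>v. A v = 0 \<Longrightarrow> v = 0"
    and U: "open U" "p \<in> U" "continuous_on U f"
  shows "simple_zero f p"
proof -
  interpret bounded_linear A using f(1) by (rule has_derivative_bounded_linear)
  obtain a c where ac: "A (1, 0) = (a, c)" by fastforce
  obtain b d where bd: "A (0, 1) = (b, d)" by fastforce
  have A_eq: "A x = (a * fst x + b * snd x, c * fst x + d * snd x)" for x
    using clinear2_eq[OF linear_axioms A(1), of x] by (simp add: ac bd)
  have det: "a * d - b * c \<noteq> 0"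
    using clinear2_det_nonzero[OF linear_axioms A] by (simp add: ac bd)
  obtain m where m: "m > 0" "\<And>x. m * norm x \<le> norm (A x)"
    by (rule linear_inj_bounded_below_pos[of A]) (auto intro: A(2) simp: linear_injective_0 linear_axioms)
  have "m / 2 > 0" using m by simp
  with f(1) obtain e where e: "e > 0"
    "\<And>y. norm (y - p) < e \<Longrightarrow> norm (f y - f p - A (y - p)) \<le> m / 2 * norm (y - p)"
    unfolding has_derivative_at_alt by meson
  obtain e' where e': "e' > 0" "cball p e' \<subseteq> U" using U open_contains_cball by blast
  show ?thesis unfolding simple_zero_def
  proof (intro exI[of _ "min e e'"] conjI allI impI)
    show "0 < min e e'" using e e' by simp
    fix \<rho> assume \<rho>: "0 < \<rho> \<and> \<rho> < min e e'"
    have "sphere_homotopic (- {0}) (\<lambda>x. f (p + \<rho> *\<^sub>R x)) (\<lambda>x. \<rho> *\<^sub>R A x)"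
    proof (rule homotopic_with_linear)
      show "continuous_on (sphere 0 1) (\<lambda>x. f (p + \<rho> *\<^sub>R x))"
      proof (intro continuous_on_compose2[OF U(3)] continuous_intros image_subsetI)
        fix x :: "complex \<times> complex" assume "x \<in> sphere 0 1"
        then show "p + \<rho> *\<^sub>R x \<in> U" using \<rho> by (intro subsetD[OF e'(2)]) (simp add: dist_norm)
      qed
      show "continuous_on (sphere 0 1) (\<lambda>x. \<rho> *\<^sub>R A x)"
        by (intro continuous_intros linear_continuous_on bounded_linear_axioms)
      fix x :: "complex \<times> complex" assume x: "x \<in> sphere 0 1"
      have "norm (f (p + \<rho> *\<^sub>R x) - \<rho> *\<^sub>R A x) \<le> m / 2 * \<rho>"
        using e(2)[of "p + \<rho> *\<^sub>R x"] x \<rho> f(2) by (simp add: scaleR)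
      also have "\<dots> < m * \<rho>" using m \<rho> by simp
      also have "\<dots> \<le> norm (\<rho> *\<^sub>R A x)" using m(2)[of x] x \<rho> by (simp add: mult.commute)
      finally have less: "norm (\<rho> *\<^sub>R A x - f (p + \<rho> *\<^sub>R x)) < norm (\<rho> *\<^sub>R A x)"
        by (simp add: norm_minus_commute)
      show "closed_segment (f (p + \<rho> *\<^sub>R x)) (\<rho> *\<^sub>R A x) \<subseteq> - {0}"
      proof (rule subsetI)
        fix y assume "y \<in> closed_segment (f (p + \<rho> *\<^sub>R x)) (\<rho> *\<^sub>R A x)"
        then have "norm (\<rho> *\<^sub>R A x - y) \<le> norm (\<rho> *\<^sub>R A x - f (p + \<rho> *\<^sub>R x))"
          using segment_bound1 segment_bound by (metis norm_minus_commute)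
        with less show "y \<in> - {0}" by auto
      qed
    qed
    moreover have "sphere_homotopic (- {0}) (\<lambda>x. \<rho> *\<^sub>R A x) (\<lambda>x. x)"
    proof (rule homotopic_with_canon_eq)
      have "\<rho> * a * (\<rho> * d) - \<rho> * b * (\<rho> * c) = \<rho> * \<rho> * (a * d - b * c)" by (simp add: algebra_simps)
      then have "\<rho> * a * (\<rho> * d) - \<rho> * b * (\<rho> * c) \<noteq> 0" using det \<rho> by simp
      then show "sphere_homotopic (- {0}) (\<lambda>x. ((\<rho> * a) * fst x + (\<rho> * b) * snd x, (\<rho> * c) * fst x + (\<rho> * d) * snd x)) (\<lambda>x. x)"
        by (rule sphere_homotopic_linear2)
    qed (simp_all add: A_eq scaleR_conv_of_real algebra_simps)
    ultimately show "sphere_homotopic (- {0}) (\<lambda>x. f (p + \<rho> *\<^sub>R x)) (\<lambda>x. x)"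
      by (rule homotopic_with_trans)
  qed
qed

section \<open>Contraction of frames to the standard generator\<close>

lemma sphere_homotopic_const_frame:
  fixes X Y Z :: "complex \<times> complex \<times> complex" and f :: "'a::real_normed_vector \<Rightarrow> complex \<times> complex"
  assumes "det3 X Y Z \<noteq> 0" and f: "continuous_on (sphere 0 1) f" "\<And>q. q \<in> sphere 0 1 \<Longrightarrow> f q \<noteq> 0"
  shows "sphere_homotopic cindep2 (\<lambda>q. (csc3 (fst (f q)) X + csc3 (snd (f q)) Y, Z))
    (\<lambda>q. ((fst (f q), snd (f q), 0), (0, 0, 1)))"
proof -
  obtain x1 x2 x3 y1 y2 y3 z1 z2 z3 where xyz: "X = (x1, x2, x3)" "Y = (y1, y2, y3)" "Z = (z1, z2, z3)"
    by (metis prod.exhaust)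
  \<comment> \<open>The determinant of the frame moved along the complex line from
    \<open>X, Y, Z\<close> to the standard basis. Along a path off its roots,
    \<open>frame_combination_cindep2\<close> keeps the pair independent.\<close>
  define p where "p = det3 ([:x1, 1 - x1:], [:x2, - x2:], [:x3, - x3:])
     ([:y1, - y1:], [:y2, 1 - y2:], [:y3, - y3:]) ([:z1, - z1:], [:z2, - z2:], [:z3, 1 - z3:])"
  define X' where "X' g = (x1 + g * (1 - x1), x2 + g * (- x2), x3 + g * (- x3))" for g
  define Y' where "Y' g = (y1 + g * (- y1), y2 + g * (1 - y2), y3 + g * (- y3))" for g
  define Z' where "Z' g = (z1 + g * (- z1), z2 + g * (- z2), z3 + g * (1 - z3))" for g
  have p: "poly p g = det3 (X' g) (Y' g) (Z' g)" for g
    unfolding p_def det3_def X'_def Y'_def Z'_def poly_mult poly_diff poly_add fst_conv snd_conv by simp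
  have "poly p 0 = det3 X Y Z" "poly p 1 = 1"
    unfolding p by (simp_all add: X'_def Y'_def Z'_def xyz) (simp add: det3_def)
  with assms have "poly p 0 \<noteq> 0" "poly p 1 \<noteq> 0" by simp_all
  then obtain \<gamma> where \<gamma>: "continuous_on {0..1::real} \<gamma>" "\<gamma> 0 = 0" "\<gamma> 1 = 1"
    "\<forall>t\<in>{0..1}. poly p (\<gamma> t) \<noteq> 0"
    by (rule path_avoiding_roots)
  show ?thesis
  proof (rule homotopic_with_canonI[where h = "\<lambda>t q. (csc3 (fst (f q)) (X' (\<gamma> t)) + csc3 (snd (f q)) (Y' (\<gamma> t)), Z' (\<gamma> t))"])
    have g: "continuous_on ({0..1} \<times> sphere (0::'a) 1) (\<lambda>x. \<gamma> (fst x))"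
      by (intro continuous_on_compose2[OF \<gamma>(1)] continuous_intros) auto
    have f': "continuous_on ({0..1::real} \<times> sphere (0::'a) 1) (\<lambda>x. f (snd x))"
      by (intro continuous_on_compose2[OF f(1)] continuous_intros) auto
    show "continuous_on ({0..1} \<times> sphere 0 1)
       (\<lambda>(t, q). (csc3 (fst (f q)) (X' (\<gamma> t)) + csc3 (snd (f q)) (Y' (\<gamma> t)), Z' (\<gamma> t)))"
      unfolding case_prod_beta X'_def Y'_def Z'_def by (intro continuous_intros g f')
    fix t :: real and q :: 'a assume t: "t \<in> {0..1}" and q: "q \<in> sphere 0 1"
    show "(csc3 (fst (f q)) (X' (\<gamma> t)) + csc3 (snd (f q)) (Y' (\<gamma> t)), Z' (\<gamma> t)) \<in> cindep2"
      by (intro frame_combination_cindep2) (use bspec[OF \<gamma>(4) t] f(2)[OF q] in \<open>auto simp: p\<close>)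
  qed (auto simp: \<gamma> X'_def Y'_def Z'_def xyz csc3_def)
qed

text \<open>The frame lives on the whole ball, so it can be contracted to its value at the centre,
  while \<open>f\<close>, which lives only on the sphere, is held fixed.\<close>

lemma sphere_homotopic_frame:
  fixes f :: "complex \<times> complex \<Rightarrow> complex \<times> complex"
  assumes r: "r > 0" and X: "continuous_on (cball 0 r) X" and Y: "continuous_on (cball 0 r) Y"
    and Z: "continuous_on (cball 0 r) Z"
    and det: "\<And>z. z \<in> cball 0 r \<Longrightarrow> det3 (X z) (Y z) (Z z) \<noteq> 0"
    and f: "continuous_on (sphere 0 1) f" "\<And>q. q \<in> sphere 0 1 \<Longrightarrow> f q \<noteq> 0"
  shows "sphere_homotopic cindep2
    (\<lambda>q. (csc3 (fst (f q)) (X (r *\<^sub>R q)) + csc3 (snd (f q)) (Y (r *\<^sub>R q)), Z (r *\<^sub>R q)))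
    (\<lambda>q. ((fst (f q), snd (f q), 0), (0, 0, 1)))"
proof (rule homotopic_with_trans[OF _ sphere_homotopic_const_frame])
  show "det3 (X 0) (Y 0) (Z 0) \<noteq> 0" using det[of 0] r by simp
  have in_cball: "((1 - t) * r) *\<^sub>R q \<in> cball 0 r" if "t \<in> {0..1}" "q \<in> sphere 0 1" for t and q :: "complex \<times> complex"
    using that r by (simp add: mult_left_le_one_le)
  show "sphere_homotopic cindep2
     (\<lambda>q. (csc3 (fst (f q)) (X (r *\<^sub>R q)) + csc3 (snd (f q)) (Y (r *\<^sub>R q)), Z (r *\<^sub>R q)))
     (\<lambda>q. (csc3 (fst (f q)) (X 0) + csc3 (snd (f q)) (Y 0), Z 0))"
  proof (rule homotopic_with_canonI[where h = "\<lambda>t q. (csc3 (fst (f q)) (X (((1 - t) * r) *\<^sub>R q)) +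
       csc3 (snd (f q)) (Y (((1 - t) * r) *\<^sub>R q)), Z (((1 - t) * r) *\<^sub>R q))"])
    have f': "continuous_on ({0..1::real} \<times> sphere 0 1) (\<lambda>x. f (snd x))"
      by (intro continuous_on_compose2[OF f(1)] continuous_intros) auto
    show "continuous_on ({0..1} \<times> sphere 0 1) (\<lambda>(t, q). (csc3 (fst (f q)) (X (((1 - t) * r) *\<^sub>R q)) +
       csc3 (snd (f q)) (Y (((1 - t) * r) *\<^sub>R q)), Z (((1 - t) * r) *\<^sub>R q)))"
      unfolding case_prod_beta
      by (intro continuous_intros f' continuous_on_compose2[OF X] continuous_on_compose2[OF Y]
          continuous_on_compose2[OF Z] image_subsetI; rule in_cball; force)
    fix t :: real and q :: "complex \<times> complex" assume "t \<in> {0..1}" "q \<in> sphere 0 1"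
    then show "(csc3 (fst (f q)) (X (((1 - t) * r) *\<^sub>R q)) +
       csc3 (snd (f q)) (Y (((1 - t) * r) *\<^sub>R q)), Z (((1 - t) * r) *\<^sub>R q)) \<in> cindep2"
      using in_cball f(2) by (intro frame_combination_cindep2 det) auto
  qed simp_all
qed (use f in auto)

text \<open>The third basis vector is moved linearly to the second column of the power of
  \<open>umat q\<close>. The minors stay nonzero: two of them are the entries of
  \<open>qpow q n\<close> times \<open>1 - t\<close> up to sign, the third is \<open>t\<close> times
  the squared norm of \<open>qpow q n\<close>.\<close>

lemma sphere_homotopic_rep_frame:
  "sphere_homotopic cindep2 (\<lambda>q. ((fst (qpow q n), snd (qpow q n), 0), (0, 0, 1))) (rep_frame (int n))"
proof (rule homotopic_with_canonI[where h = "\<lambda>t q. ((fst (qpow q n), snd (qpow q n), 0),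
    (of_real t * - cnj (snd (qpow q n)), of_real t * cnj (fst (qpow q n)), 1 - of_real t))"])
  show "continuous_on ({0..1} \<times> sphere 0 1) (\<lambda>(t, q). ((fst (qpow q n), snd (qpow q n), 0),
    (of_real t * - cnj (snd (qpow q n)), of_real t * cnj (fst (qpow q n)), 1 - complex_of_real t)))"
    unfolding case_prod_beta by (intro continuous_intros)
  fix t :: real and q :: "complex \<times> complex" assume t: "t \<in> {0..1}" and q: "q \<in> sphere 0 1"
  have "q \<noteq> 0" using q by auto
  then have "qpow q n \<noteq> 0" using qpow_eq_0 by blast
  then have nz: "fst (qpow q n) \<noteq> 0 \<or> snd (qpow q n) \<noteq> 0" by (simp add: prod_eq_iff)
  have "complex_of_real ((norm (qpow q n))\<^sup>2) \<noteq> 0" using \<open>qpow q n \<noteq> 0\<close> by simp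
  then have sum: "fst (qpow q n) * cnj (fst (qpow q n)) + snd (qpow q n) * cnj (snd (qpow q n)) \<noteq> 0"
    by (simp only: of_real_norm_prod_sq not_False_eq_True)
  have "cr3 (fst (qpow q n), snd (qpow q n), 0)
      (of_real t * - cnj (snd (qpow q n)), of_real t * cnj (fst (qpow q n)), 1 - complex_of_real t)
    = (snd (qpow q n) * (1 - of_real t), - fst (qpow q n) * (1 - of_real t),
       of_real t * (fst (qpow q n) * cnj (fst (qpow q n)) + snd (qpow q n) * cnj (snd (qpow q n))))"
    by (simp add: cr3_def algebra_simps)
  also have "\<dots> \<noteq> 0"
    using nz sum by (cases "t = 1") (auto simp: zero_prod_def)
  finally show "((fst (qpow q n), snd (qpow q n), 0),
    (of_real t * - cnj (snd (qpow q n)), of_real t * cnj (fst (qpow q n)), 1 - complex_of_real t)) \<in> cindep2"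
    by (simp only: cindep2_iff not_False_eq_True)
qed (simp_all add: rep_frame_qpow)

section \<open>The homotopy class of a matrix map with nondegenerate singularities\<close>

lemma det3_shear: "det3 P E2 (Q + csc3 \<alpha> P) = det3 P E2 Q" "det3 E1 P (Q + csc3 \<alpha> P) = det3 E1 P Q"
  by (simp_all add: det3_def csc3_def algebra_simps)

text \<open>By Cramer's rule the two determinants are, up to the common factor, the coordinates of
  \<open>P\<close> along \<open>E1\<close> and \<open>E2\<close>. Both vanish exactly when
  \<open>P\<close> is a multiple of the nonzero vector \<open>Q + \<alpha> P\<close>.\<close>

lemma frame_coordinates_zero_iff:
  assumes "det3 E1 E2 (Q + csc3 \<alpha> P) \<noteq> 0"
  shows "(det3 P E2 Q, det3 E1 P Q) = 0 \<longleftrightarrow> (P, Q) \<notin> cindep2"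
proof
  let ?D = "det3 E1 E2 (Q + csc3 \<alpha> P)" and ?c = "det3 E1 E2 P"
  assume *: "(det3 P E2 Q, det3 E1 P Q) = 0"
  have "csc3 ?D P = csc3 ?c (Q + csc3 \<alpha> P)"
    using cramer3[of E1 E2 "Q + csc3 \<alpha> P" P] * by (simp add: det3_shear zero_prod_def[where 'a = complex and 'b = complex])
  then have eq: "csc3 (?D - ?c * \<alpha>) P + csc3 (- ?c) Q = 0"
    by (simp add: csc3_def prod_eq_iff algebra_simps)
  show "(P, Q) \<notin> cindep2"
  proof
    assume "(P, Q) \<in> cindep2"
    with eq have "?D - ?c * \<alpha> = 0 \<and> - ?c = 0" unfolding cindep2_def by blast
    then show False using assms by simp
  qed
next
  assume "(P, Q) \<notin> cindep2"
  then have "cr3 P Q = 0" by (simp add: cindep2_iff)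
  moreover have "det3 P E2 Q = - (fst E2 * fst (cr3 P Q) + fst (snd E2) * fst (snd (cr3 P Q)) + snd (snd E2) * snd (snd (cr3 P Q)))"
    "det3 E1 P Q = fst E1 * fst (cr3 P Q) + fst (snd E1) * fst (snd (cr3 P Q)) + snd (snd E1) * snd (snd (cr3 P Q))"
    by (simp_all add: det3_def cr3_def algebra_simps)
  ultimately show "(det3 P E2 Q, det3 E1 P Q) = 0" by (simp add: zero_prod_def)
qed

text \<open>Column operations bring the pair to \<open>a E1 + b E2\<close> and
  \<open>Q + \<alpha> P\<close>, whose frame contracts over the ball; what remains is the map
  \<open>(a, b)\<close> to the punctured plane. The assumption \<open>simple\<close> ranges over all
  completing fields because these are only found inside the proof.\<close>

theorem sphere_homotopic_rep_frame_card:
  fixes P Q :: "complex \<times> complex \<Rightarrow> complex \<times> complex \<times> complex"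
  assumes r: "r > 0" and P: "continuous_on (cball 0 r) P" and Q: "continuous_on (cball 0 r) Q"
    and \<alpha>: "\<And>z. z \<in> cball 0 r \<Longrightarrow> Q z + csc3 \<alpha> (P z) \<noteq> 0"
    and fin: "finite {z \<in> cball 0 r. (P z, Q z) \<notin> cindep2}" "{z \<in> cball 0 r. (P z, Q z) \<notin> cindep2} \<subseteq> ball 0 r"
    and simple: "\<And>E1 E2 p. continuous_on (cball 0 r) E1 \<Longrightarrow> continuous_on (cball 0 r) E2 \<Longrightarrow>
       \<forall>z\<in>cball 0 r. det3 (E1 z) (E2 z) (Q z + csc3 \<alpha> (P z)) = 1 \<Longrightarrow> p \<in> ball 0 r \<Longrightarrow>
       (P p, Q p) \<notin> cindep2 \<Longrightarrow> simple_zero (\<lambda>z. (det3 (P z) (E2 z) (Q z), det3 (E1 z) (P z) (Q z))) p"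
  shows "sphere_homotopic cindep2 (\<lambda>q. (P (r *\<^sub>R q), Q (r *\<^sub>R q)))
    (rep_frame (int (card {z \<in> cball 0 r. (P z, Q z) \<notin> cindep2})))"
proof -
  let ?Q = "\<lambda>z. Q z + csc3 \<alpha> (P z)" and ?Z = "{z \<in> cball 0 r. (P z, Q z) \<notin> cindep2}"
  have Q': "continuous_on (cball 0 r) ?Q" by (intro continuous_intros P Q)
  obtain E1 E2 where E: "continuous_on (cball 0 r) E1" "continuous_on (cball 0 r) E2"
    "\<forall>z\<in>cball 0 r. det3 (E1 z) (E2 z) (?Q z) = 1"
    by (rule frame_completion[OF r Q']) (rule \<alpha>, assumption, rule that)
  define f where "f z = (det3 (P z) (E2 z) (Q z), det3 (E1 z) (P z) (Q z))" for z
  have f: "continuous_on (cball 0 r) f" unfolding f_def by (intro continuous_intros P Q E)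
  have f0: "f z = 0 \<longleftrightarrow> (P z, Q z) \<notin> cindep2" if "z \<in> cball 0 r" for z
    unfolding f_def using E(3) that by (intro frame_coordinates_zero_iff[where \<alpha> = \<alpha>]) auto
  then have Z: "{z \<in> cball 0 r. f z = 0} = ?Z" by blast
  have "sphere_homotopic (- {0}) (\<lambda>q. f (r *\<^sub>R q)) (\<lambda>q. qpow q (card {z \<in> cball 0 r. f z = 0}))"
  proof (rule sphere_homotopic_qpow_card_zeros[OF r f])
    show "finite {z \<in> cball 0 r. f z = 0}" "{z \<in> cball 0 r. f z = 0} \<subseteq> ball 0 r"
      unfolding Z by (fact fin)+
    fix p assume p: "p \<in> ball 0 r" "f p = 0"
    then have "(P p, Q p) \<notin> cindep2" using f0[of p] by simp
    then show "simple_zero f p" unfolding f_def by (intro simple E p)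
  qed
  then have f_qpow: "sphere_homotopic (- {0}) (\<lambda>q. f (r *\<^sub>R q)) (\<lambda>q. qpow q (card ?Z))"
    unfolding Z .
  have sph: "r *\<^sub>R q \<in> cball 0 r" "r *\<^sub>R q \<notin> ball 0 r" if "q \<in> sphere 0 1"
    for q :: "complex \<times> complex" using that r by auto
  have nz: "(P (r *\<^sub>R q), Q (r *\<^sub>R q)) \<in> cindep2" if "q \<in> sphere 0 1" for q
    using fin(2) sph[OF that] by blast
  have Pr: "continuous_on ({0..1::real} \<times> sphere 0 1) (\<lambda>x. P (r *\<^sub>R snd x))"
    by (intro continuous_on_compose2[OF P] continuous_intros image_subsetI sph) auto
  have Qr: "continuous_on ({0..1::real} \<times> sphere 0 1) (\<lambda>x. Q (r *\<^sub>R snd x))"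
    by (intro continuous_on_compose2[OF Q] continuous_intros image_subsetI sph) auto
  have E1r: "continuous_on ({0..1::real} \<times> sphere 0 1) (\<lambda>x. E1 (r *\<^sub>R snd x))"
    by (intro continuous_on_compose2[OF E(1)] continuous_intros image_subsetI sph) auto
  have E2r: "continuous_on ({0..1::real} \<times> sphere 0 1) (\<lambda>x. E2 (r *\<^sub>R snd x))"
    by (intro continuous_on_compose2[OF E(2)] continuous_intros image_subsetI sph) auto
  \<comment> \<open>Adding a multiple of one column to the other does not change \<open>cr3\<close>,
    so this homotopy and the next one stay in \<open>cindep2\<close>.\<close>
  have "sphere_homotopic cindep2 (\<lambda>q. (P (r *\<^sub>R q), Q (r *\<^sub>R q))) (\<lambda>q. (P (r *\<^sub>R q), ?Q (r *\<^sub>R q)))"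
  proof (rule homotopic_with_canonI[where h = "\<lambda>t q. (P (r *\<^sub>R q), Q (r *\<^sub>R q) + csc3 (of_real t * \<alpha>) (P (r *\<^sub>R q)))"])
    show "continuous_on ({0..1} \<times> sphere 0 1) (\<lambda>(t, q). (P (r *\<^sub>R q), Q (r *\<^sub>R q) + csc3 (of_real t * \<alpha>) (P (r *\<^sub>R q))))"
      unfolding case_prod_beta by (intro continuous_intros Pr Qr)
    have "cr3 x (y + csc3 c x) = cr3 x y" for x y c by (simp add: cr3_def csc3_def algebra_simps)
    then show "(P (r *\<^sub>R q), Q (r *\<^sub>R q) + csc3 (of_real t * \<alpha>) (P (r *\<^sub>R q))) \<in> cindep2"
      if "q \<in> sphere 0 1" for t q using nz[OF that] by (simp add: cindep2_iff)
  qed simp_all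
  moreover have "sphere_homotopic cindep2 (\<lambda>q. (P (r *\<^sub>R q), ?Q (r *\<^sub>R q)))
    (\<lambda>q. (csc3 (fst (f (r *\<^sub>R q))) (E1 (r *\<^sub>R q)) + csc3 (snd (f (r *\<^sub>R q))) (E2 (r *\<^sub>R q)), ?Q (r *\<^sub>R q)))"
  proof (rule homotopic_with_canonI[where h = "\<lambda>t q. (P (r *\<^sub>R q) - csc3 (of_real t * det3 (E1 (r *\<^sub>R q)) (E2 (r *\<^sub>R q)) (P (r *\<^sub>R q))) (?Q (r *\<^sub>R q)), ?Q (r *\<^sub>R q))"])
    show "continuous_on ({0..1} \<times> sphere 0 1) (\<lambda>(t, q). (P (r *\<^sub>R q) - csc3 (of_real t * det3 (E1 (r *\<^sub>R q)) (E2 (r *\<^sub>R q)) (P (r *\<^sub>R q))) (?Q (r *\<^sub>R q)), ?Q (r *\<^sub>R q)))"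
      unfolding case_prod_beta by (intro continuous_intros Pr Qr E1r E2r)
    have "cr3 (x - csc3 c (y + csc3 \<alpha> x)) (y + csc3 \<alpha> x) = cr3 x y" for x y c
      by (simp add: cr3_def csc3_def algebra_simps)
    then show "(P (r *\<^sub>R q) - csc3 (of_real t * det3 (E1 (r *\<^sub>R q)) (E2 (r *\<^sub>R q)) (P (r *\<^sub>R q))) (?Q (r *\<^sub>R q)), ?Q (r *\<^sub>R q)) \<in> cindep2"
      if "q \<in> sphere 0 1" for t q using nz[OF that] by (simp add: cindep2_iff)
    fix q :: "complex \<times> complex" assume q: "q \<in> sphere 0 1"
    have "det3 (E1 (r *\<^sub>R q)) (E2 (r *\<^sub>R q)) (?Q (r *\<^sub>R q)) = 1" using E(3) sph[OF q] by blast
    \<comment> \<open>Cramer's rule; by \<open>det3_shear\<close> the shear drops out of the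
      coordinates along \<open>E1\<close> and \<open>E2\<close>.\<close>
    then have "P (r *\<^sub>R q) = csc3 (fst (f (r *\<^sub>R q))) (E1 (r *\<^sub>R q)) + csc3 (snd (f (r *\<^sub>R q))) (E2 (r *\<^sub>R q))
       + csc3 (det3 (E1 (r *\<^sub>R q)) (E2 (r *\<^sub>R q)) (P (r *\<^sub>R q))) (?Q (r *\<^sub>R q))"
      using cramer3[of "E1 (r *\<^sub>R q)" "E2 (r *\<^sub>R q)" "?Q (r *\<^sub>R q)" "P (r *\<^sub>R q)"]
      by (simp add: f_def det3_shear)
    then show "(P (r *\<^sub>R q) - csc3 (of_real 1 * det3 (E1 (r *\<^sub>R q)) (E2 (r *\<^sub>R q)) (P (r *\<^sub>R q))) (?Q (r *\<^sub>R q)), ?Q (r *\<^sub>R q))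
      = (csc3 (fst (f (r *\<^sub>R q))) (E1 (r *\<^sub>R q)) + csc3 (snd (f (r *\<^sub>R q))) (E2 (r *\<^sub>R q)), ?Q (r *\<^sub>R q))"
      by (simp add: diff_eq_eq)
  qed simp_all
  moreover have "sphere_homotopic cindep2
    (\<lambda>q. (csc3 (fst (f (r *\<^sub>R q))) (E1 (r *\<^sub>R q)) + csc3 (snd (f (r *\<^sub>R q))) (E2 (r *\<^sub>R q)), ?Q (r *\<^sub>R q)))
    (\<lambda>q. ((fst (f (r *\<^sub>R q)), snd (f (r *\<^sub>R q)), 0), (0, 0, 1)))"
  proof (rule sphere_homotopic_frame[OF r E(1,2) Q'])
    show "det3 (E1 z) (E2 z) (?Q z) \<noteq> 0" if "z \<in> cball 0 r" for z using E(3) that by auto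
    show "continuous_on (sphere 0 1) (\<lambda>q. f (r *\<^sub>R q))"
      by (intro continuous_on_compose2[OF f] continuous_intros image_subsetI sph)
    show "f (r *\<^sub>R q) \<noteq> 0" if "q \<in> sphere 0 1" for q using nz[OF that] f0[OF sph(1)[OF that]] by simp
  qed
  moreover have "sphere_homotopic cindep2 (\<lambda>q. ((fst (f (r *\<^sub>R q)), snd (f (r *\<^sub>R q)), 0), (0, 0, 1)))
     (\<lambda>q. ((fst (qpow q (card ?Z)), snd (qpow q (card ?Z)), 0), (0, 0, 1)))"
  proof -
    have "(\<lambda>w. ((fst w, snd w, 0), (0, 0, 1))) \<in> - {0} \<rightarrow> cindep2"
      by (auto simp: cindep2_iff cr3_def zero_prod_def)
    moreover have "continuous_on (- {0}) (\<lambda>w :: complex \<times> complex. ((fst w, snd w, 0 :: complex), (0 :: complex, 0 :: complex, 1 :: complex)))"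
      by (intro continuous_intros)
    ultimately show ?thesis
      using homotopic_with_compose_continuous_left[OF f_qpow, where h = "\<lambda>w. ((fst w, snd w, 0), (0, 0, 1))" and Z = cindep2]
      unfolding o_def by blast
  qed
  ultimately show ?thesis
    using sphere_homotopic_rep_frame by (blast intro: homotopic_with_trans)
qed

section \<open>Holomorphic maps of several variables\<close>

text \<open>A common interface to \<open>csc2\<close> and \<open>csc3\<close>:
  \<open>\<lambda>\<zeta>. z + s \<zeta> v\<close> parametrizes a complex line with velocity
  \<open>v\<close>, so one-variable theory applies along it.\<close>

definition complex_action :: "(complex \<Rightarrow> 'a::real_normed_vector \<Rightarrow> 'a) \<Rightarrow> bool" where
  "complex_action s \<longleftrightarrow> (\<forall>v. bounded_linear (\<lambda>c. s c v)) \<and> (\<forall>v. s 1 v = v)"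

lemma complex_action_csc2: "complex_action csc2"
  unfolding complex_action_def csc2_def
  by (auto intro!: bounded_linear_Pair bounded_linear_mult_left)

lemma complex_action_csc3: "complex_action csc3"
  unfolding complex_action_def csc3_def
  by (auto intro!: bounded_linear_Pair bounded_linear_mult_left)

lemma holo_wrt_frechet_derivative:
  assumes "holo_wrt sA sB f S" "z \<in> S"
  shows "(f has_derivative frechet_derivative f (at z)) (at z)"
    and "frechet_derivative f (at z) (sA c v) = sB c (frechet_derivative f (at z) v)"
proof -
  obtain D where D: "(f has_derivative D) (at z)" "\<forall>c v. D (sA c v) = sB c (D v)"
    using assms unfolding holo_wrt_def by blast
  then have "frechet_derivative f (at z) = D" using frechet_derivative_at by metis
  with D show "(f has_derivative frechet_derivative f (at z)) (at z)"
    "frechet_derivative f (at z) (sA c v) = sB c (frechet_derivative f (at z) v)" by simp_all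
qed

lemma holo_wrt_continuous_on: "holo_wrt sA sB f S \<Longrightarrow> continuous_on S f"
  by (meson continuous_at_imp_continuous_on has_derivative_continuous holo_wrt_frechet_derivative(1))

lemma holo_wrt_subset: "holo_wrt sA sB f S \<Longrightarrow> T \<subseteq> S \<Longrightarrow> holo_wrt sA sB f T"
  by (auto simp: holo_wrt_def)

section \<open>Cauchy's formulas along complex lines\<close>

lemma complex_action_tube:
  fixes v :: "'a::euclidean_space"
  assumes s: "complex_action s" and S: "open S" "z0 \<in> S"
  obtains d r where "d > 0" "r > 0" "cball z0 (2 * d) \<subseteq> S"
    "\<forall>z\<in>cball z0 d. \<forall>\<zeta>\<in>cball 0 r. z + s \<zeta> v \<in> cball z0 (2 * d)"
proof -
  obtain e where e: "e > 0" "cball z0 e \<subseteq> S" using S open_contains_cball by blast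
  obtain K where K: "K > 0" "\<And>\<zeta>. norm (s \<zeta> v) \<le> norm \<zeta> * K"
    using bounded_linear.pos_bounded[of "\<lambda>c. s c v"] s unfolding complex_action_def by blast
  show thesis
  \<comment> \<open>One disc radius has to serve all base points near \<open>z0\<close>: half of
    \<open>e\<close> goes to the base point, half to the disc, on which \<open>s \<zeta> v\<close>
    is bounded through \<open>K\<close>.\<close>
  proof (rule that[of "e / 2" "e / (2 * K)"], goal_cases)
    case 4
    show ?case
    proof (intro ballI)
      fix z and \<zeta> :: complex assume z: "z \<in> cball z0 (e / 2)" and "\<zeta> \<in> cball 0 (e / (2 * K))"
      then have \<zeta>: "norm \<zeta> \<le> e / (2 * K)" by simp
      have "norm (s \<zeta> v) \<le> e / (2 * K) * K"
        using K(1) \<zeta> by (intro order_trans[OF K(2)] mult_right_mono) auto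
      then have "norm (s \<zeta> v) \<le> e / 2" using K(1) by simp
      moreover have "dist z0 (z + s \<zeta> v) \<le> dist z0 z + norm (s \<zeta> v)"
        using dist_triangle[of z0 "z + s \<zeta> v" z] by (simp add: dist_norm norm_minus_commute)
      ultimately show "z + s \<zeta> v \<in> cball z0 (2 * (e / 2))" using z by simp
    qed
  qed (use e K in auto)
qed

lemma has_field_derivative_along_line:
  assumes s: "complex_action s" and f: "holo_wrt s (*) f S" and z: "z + s \<zeta> v \<in> S"
  shows "((\<lambda>\<zeta>. f (z + s \<zeta> v)) has_field_derivative frechet_derivative f (at (z + s \<zeta> v)) v) (at \<zeta>)"
proof -
  have "((\<lambda>\<zeta>. z + s \<zeta> v) has_derivative (\<lambda>h. s h v)) (at \<zeta>)"
    using s unfolding complex_action_def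
    by (auto intro!: derivative_eq_intros bounded_linear_imp_has_derivative)
  from has_derivative_compose[OF this holo_wrt_frechet_derivative(1)[OF f z]]
  show ?thesis
    by (simp add: has_field_derivative_def holo_wrt_frechet_derivative(2)[OF f z] mult.commute[of _ "frechet_derivative _ _ _"])
qed

text \<open>\<open>holo_wrt\<close> asks only for pointwise derivatives. Continuity follows from
  Cauchy's inequality for the difference of the restrictions of \<open>f\<close> to the parallel
  lines through \<open>z\<close> and \<open>z0\<close>, which is small by uniform
  continuity.\<close>

lemma continuous_on_frechet_derivative:
  fixes f :: "'a::euclidean_space \<Rightarrow> complex"
  assumes s: "complex_action s" and S: "open S" and f: "holo_wrt s (*) f S"
  shows "continuous_on S (\<lambda>z. frechet_derivative f (at z) v)"
proof (rule continuous_at_imp_continuous_on, rule ballI)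
  fix z0 assume z0: "z0 \<in> S"
  obtain d r where d: "d > 0" "r > 0" "cball z0 (2 * d) \<subseteq> S"
    and tube': "\<forall>z\<in>cball z0 d. \<forall>\<zeta>\<in>cball 0 r. z + s \<zeta> v \<in> cball z0 (2 * d)"
    by (rule complex_action_tube[OF s S z0, of v]) (rule that)
  have tube: "z + s \<zeta> v \<in> cball z0 (2 * d)" if "z \<in> cball z0 d" "norm \<zeta> \<le> r" for z \<zeta>
    using tube' that by simp
  have s0: "s 0 v = 0"
    using s unfolding complex_action_def by (metis bounded_linear.linear linear_0)
  have "uniformly_continuous_on (cball z0 (2 * d)) f"
    by (intro compact_uniformly_continuous compact_cball
        continuous_on_subset[OF holo_wrt_continuous_on[OF f] d(3)])
  show "isCont (\<lambda>z. frechet_derivative f (at z) v) z0"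
    unfolding isCont_def tendsto_iff eventually_at
  proof (intro allI impI)
    fix e :: real assume "e > 0"
    \<comment> \<open>Cauchy's inequality divides this bound by \<open>r\<close>, which leaves
      \<open>e / 2\<close>.\<close>
    then have "e * r / 2 > 0" using d by simp
    with \<open>uniformly_continuous_on (cball z0 (2 * d)) f\<close> obtain d' where d': "d' > 0"
      "\<And>x y. x \<in> cball z0 (2 * d) \<Longrightarrow> y \<in> cball z0 (2 * d) \<Longrightarrow> dist x y < d' \<Longrightarrow> dist (f x) (f y) < e * r / 2"
      unfolding uniformly_continuous_on_def by meson
    show "\<exists>d>0. \<forall>z\<in>UNIV. z \<noteq> z0 \<and> dist z z0 < d \<longrightarrow>
        dist (frechet_derivative f (at z) v) (frechet_derivative f (at z0) v) < e"
    proof (intro exI[of _ "min d d'"] conjI ballI impI)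
      fix z assume z: "z \<noteq> z0 \<and> dist z z0 < min d d'"
      then have zd: "z \<in> cball z0 d" "z0 \<in> cball z0 d" using d by (auto simp: dist_commute)
      define g where "g \<zeta> = f (z + s \<zeta> v) - f (z0 + s \<zeta> v)" for \<zeta>
      have g': "(g has_field_derivative frechet_derivative f (at (z + s \<zeta> v)) v
           - frechet_derivative f (at (z0 + s \<zeta> v)) v) (at \<zeta>)" if "norm \<zeta> \<le> r" for \<zeta>
        unfolding g_def using zd tube that d(3)
        by (intro DERIV_diff has_field_derivative_along_line[OF s f]) blast+
      have "norm ((deriv ^^ 1) g 0) \<le> fact 1 * (e * r / 2) / r ^ 1"
      proof (rule Cauchy_inequality)
        show "g holomorphic_on ball 0 r"
          unfolding holomorphic_on_open[OF open_ball] using g' by force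
        show "continuous_on (cball 0 r) g"
          by (intro continuous_at_imp_continuous_on ballI DERIV_isCont[OF g']) simp
        show "norm (g \<zeta>) \<le> e * r / 2" if "norm (0 - \<zeta>) = r" for \<zeta>
          unfolding g_def dist_norm[symmetric] using that z
          by (intro less_imp_le[OF d'(2)] tube zd) (auto simp: dist_norm)
      qed (use d in auto)
      moreover have "deriv g 0 = frechet_derivative f (at z) v - frechet_derivative f (at z0) v"
        using DERIV_imp_deriv[OF g'[of 0]] d by (simp add: s0)
      ultimately show "dist (frechet_derivative f (at z) v) (frechet_derivative f (at z0) v) < e"
        using d \<open>e > 0\<close> by (simp add: dist_norm)
    qed (use d d' in auto)
  qed
qed

text \<open>The directional derivative is a Cauchy integral of \<open>f\<close> over a circle in
  direction \<open>v\<close>. Differentiation under the integral sign uses the continuity just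
  proved, and complex linearity passes through the integral.\<close>

lemma holo_wrt_directional_derivative:
  fixes f :: "'a::euclidean_space \<Rightarrow> complex"
  assumes s: "complex_action s" and S: "open S" and f: "holo_wrt s (*) f S"
  shows "holo_wrt s (*) (\<lambda>z. frechet_derivative f (at z) v) S"
  unfolding holo_wrt_def
proof
  fix z0 assume z0: "z0 \<in> S"
  obtain d r where d: "d > 0" "r > 0" "cball z0 (2 * d) \<subseteq> S"
    and tube': "\<forall>z\<in>cball z0 d. \<forall>\<zeta>\<in>cball 0 r. z + s \<zeta> v \<in> cball z0 (2 * d)"
    by (rule complex_action_tube[OF s S z0, of v]) (rule that)
  have tube: "z + s \<zeta> v \<in> cball z0 (2 * d)" if "z \<in> cball z0 d" "norm \<zeta> \<le> r" for z \<zeta>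
    using tube' that by simp
  have bl: "bounded_linear (\<lambda>c. s c v)" using s by (simp add: complex_action_def)
  have s0: "s 0 v = 0" using bl by (metis bounded_linear.linear linear_0)
  define c where "c = circlepath 0 r"
  \<comment> \<open>The kernel of Cauchy's formula for the first derivative, times the velocity of
    the circle.\<close>
  define k where "k t = 1 / (2 * of_real pi * \<i>) * (1 / (c t)\<^sup>2 * (2 * of_real pi * \<i> * r * exp (2 * of_real pi * \<i> * of_real t)))"
    for t :: real
  have c: "norm (c t) = r" for t using d by (simp add: c_def circlepath norm_mult)
  then have c0: "c t \<noteq> 0" for t using d by (metis norm_zero less_irrefl)
  have cont_c: "continuous_on A c" for A unfolding c_def circlepath by (intro continuous_intros)
  have cont_k: "continuous_on A k" for A
    unfolding k_def using c0 by (intro continuous_intros cont_c) auto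
  have in_S: "z + s (c t) v \<in> S" if "z \<in> ball z0 d" for z t
    using tube[of z "c t"] that c d(3) by auto
  have eq: "frechet_derivative f (at z) v = integral (cbox 0 1) (\<lambda>t. f (z + s (c t) v) * k t)"
    if z: "z \<in> ball z0 d" for z
  proof -
    let ?g = "\<lambda>\<zeta>. f (z + s \<zeta> v)"
    have g': "(?g has_field_derivative frechet_derivative f (at (z + s \<zeta> v)) v) (at \<zeta>)" if "norm \<zeta> \<le> r" for \<zeta>
      using z tube[of z \<zeta>] that d(3) by (intro has_field_derivative_along_line[OF s f]) auto
    have "(?g has_field_derivative (1 / (2 * of_real pi * \<i>) * contour_integral (circlepath 0 r) (\<lambda>u. ?g u / (u - 0)\<^sup>2))) (at 0)"
    proof (rule Cauchy_derivative_integral_circlepath(2))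
      show "?g holomorphic_on ball 0 r"
        unfolding holomorphic_on_open[OF open_ball] using g' by force
      show "continuous_on (cball 0 r) ?g"
        by (intro continuous_at_imp_continuous_on ballI DERIV_isCont[OF g']) simp
    qed (use d in auto)
    then have "frechet_derivative f (at (z + s 0 v)) v =
       1 / (2 * of_real pi * \<i>) * contour_integral (circlepath 0 r) (\<lambda>u. ?g u / (u - 0)\<^sup>2)"
      using g'[of 0] d by (intro DERIV_unique[of ?g _ 0]) auto
    also have "\<dots> = integral {0..1} (\<lambda>t. f (z + s (c t) v) * k t)"
      unfolding contour_integral_integral integral_mult_right[symmetric] vector_derivative_circlepath k_def c_def
      by (intro integral_cong) (simp only: divide_inverse mult_1_left diff_zero of_real_mult of_real_numeral ac_simps)
    finally show ?thesis by (simp add: s0 cbox_interval)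
  qed
  \<comment> \<open>\<open>leibniz_rule\<close> takes the derivative as a bounded linear function.
    \<open>Blinfun\<close> is controlled only where \<open>f\<close> is differentiable, which
    \<open>in_S\<close> ensures for \<open>z\<close> in the ball.\<close>
  define F' where "F' z t = Blinfun (\<lambda>h. frechet_derivative f (at (z + s (c t) v)) h * k t)" for z t
  have F': "blinfun_apply (F' z t) = (\<lambda>h. frechet_derivative f (at (z + s (c t) v)) h * k t)"
    if "z \<in> ball z0 d" for z t
    unfolding F'_def
    by (intro bounded_linear_Blinfun_apply bounded_linear_compose[OF bounded_linear_mult_left]
       has_derivative_bounded_linear[OF holo_wrt_frechet_derivative(1)[OF f in_S[OF that]]])
  have cont_shift: "continuous_on (ball z0 d \<times> cbox (0::real) 1) (\<lambda>x. fst x + s (c (snd x)) v)"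
    by (intro continuous_intros bounded_linear.continuous_on[OF bl] continuous_on_compose2[OF cont_c[of UNIV]]) auto
  have cont_F': "continuous_on (ball z0 d \<times> cbox 0 1) (\<lambda>(z, t). F' z t)"
  proof (rule continuous_on_blinfun_componentwise)
    fix i :: 'a assume "i \<in> Basis"
    have "continuous_on (ball z0 d \<times> cbox 0 1) (\<lambda>x. frechet_derivative f (at (fst x + s (c (snd x)) v)) i * k (snd x))"
      by (intro continuous_intros continuous_on_compose2[OF continuous_on_frechet_derivative[OF s S f] cont_shift]
          continuous_on_compose2[OF cont_k[of UNIV]]) (auto intro: in_S)
    then show "continuous_on (ball z0 d \<times> cbox 0 1) (\<lambda>x. blinfun_apply (case x of (z, t) \<Rightarrow> F' z t) i)"
      by (rule continuous_on_eq) (auto simp: F')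
  qed
  have der: "((\<lambda>z. integral (cbox 0 1) (\<lambda>t. f (z + s (c t) v) * k t)) has_derivative
      integral (cbox 0 1) (F' z0)) (at z0 within ball z0 d)"
  proof (rule leibniz_rule[where f = "\<lambda>z t. f (z + s (c t) v) * k t"])
    fix z and t :: real assume z: "z \<in> ball z0 d"
    have "((\<lambda>z. z + s (c t) v) has_derivative (\<lambda>h. h)) (at z within ball z0 d)"
      by (auto intro!: derivative_eq_intros)
    from has_derivative_compose[OF this holo_wrt_frechet_derivative(1)[OF f in_S[OF z]]]
    have "((\<lambda>z. f (z + s (c t) v) * k t) has_derivative (\<lambda>h. frechet_derivative f (at (z + s (c t) v)) h * k t)) (at z within ball z0 d)"
      by (rule has_derivative_mult_left)
    then show "((\<lambda>z. f (z + s (c t) v) * k t) has_derivative blinfun_apply (F' z t)) (at z within ball z0 d)"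
      by (simp add: F'[OF z])
  next
    fix z assume z: "z \<in> ball z0 d"
    show "(\<lambda>t. f (z + s (c t) v) * k t) integrable_on cbox 0 1"
      using in_S[OF z]
      by (intro integrable_continuous continuous_intros cont_k continuous_on_compose2[OF holo_wrt_continuous_on[OF f]]
          bounded_linear.continuous_on[OF bl] cont_c) auto
  qed (use d cont_F' in auto)
  have "((\<lambda>z. frechet_derivative f (at z) v) has_derivative integral (cbox 0 1) (F' z0)) (at z0)"
  proof (rule has_derivative_transform_within_open[of _ _ _ UNIV, OF _ open_ball])
    show "((\<lambda>z. integral (cbox 0 1) (\<lambda>t. f (z + s (c t) v) * k t)) has_derivative integral (cbox 0 1) (F' z0)) (at z0)"
      using der d by (simp add: at_within_open[of z0 "ball z0 d"])
    show "z0 \<in> ball z0 d" using d by simp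
  qed (use eq in auto)
  moreover have "integral (cbox 0 1) (F' z0) (s a h) = a * integral (cbox 0 1) (F' z0) h" for a h
  proof -
    have z0d: "z0 \<in> ball z0 d" using d by simp
    have "continuous_on (cbox 0 1) (F' z0)"
      using continuous_on_compose2[OF cont_F', of "cbox 0 1" "\<lambda>t. (z0, t)"] z0d
      by (simp add: image_subset_iff continuous_on_Pair)
    then have int: "F' z0 integrable_on cbox 0 1" by (rule integrable_continuous)
    show ?thesis
      unfolding blinfun_apply_integral[OF int] integral_mult_right[symmetric] F'[OF z0d]
      using holo_wrt_frechet_derivative(2)[OF f in_S[OF z0d]] by (intro integral_cong) (simp add: mult.assoc)
  qed
  ultimately show "\<exists>D. ((\<lambda>z. frechet_derivative f (at z) v) has_derivative D) (at z0) \<and> (\<forall>c v. D (s c v) = c * D v)"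
    by blast
qed

section \<open>Passage from coordinates to vector-valued maps\<close>

lemma holo_wrt_compose_linear:
  assumes f: "holo_wrt s sB f S" and L: "bounded_linear L" "\<And>c w. L (sB c w) = c * L w"
  shows "holo_wrt s (*) (\<lambda>z. L (f z)) S"
    and "z \<in> S \<Longrightarrow> frechet_derivative (\<lambda>z. L (f z)) (at z) v = L (frechet_derivative f (at z) v)"
proof -
  have *: "((\<lambda>z. L (f z)) has_derivative (\<lambda>v. L (frechet_derivative f (at z) v))) (at z)" if "z \<in> S" for z
    by (rule bounded_linear.has_derivative[OF L(1) holo_wrt_frechet_derivative(1)[OF f that]])
  then show "holo_wrt s (*) (\<lambda>z. L (f z)) S"
    unfolding holo_wrt_def using holo_wrt_frechet_derivative(2)[OF f] L(2) by fastforce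
  show "frechet_derivative (\<lambda>z. L (f z)) (at z) v = L (frechet_derivative f (at z) v)" if "z \<in> S"
    using frechet_derivative_at[OF *[OF that]] by metis
qed

lemma continuous_on_frechet_derivative2:
  fixes f :: "'a::euclidean_space \<Rightarrow> complex \<times> complex"
  assumes s: "complex_action s" and S: "open S" and f: "holo_wrt s csc2 f S"
  shows "continuous_on S (\<lambda>z. frechet_derivative f (at z) v)"
proof -
  have 1: "bounded_linear fst" "\<And>c w. fst (csc2 c w) = c * fst w"
    "bounded_linear snd" "\<And>c w. snd (csc2 c w) = c * snd w"
    by (auto simp: csc2_def bounded_linear_fst bounded_linear_snd)
  have "continuous_on S (\<lambda>z. (frechet_derivative (\<lambda>z. fst (f z)) (at z) v, frechet_derivative (\<lambda>z. snd (f z)) (at z) v))"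
    by (intro continuous_on_Pair continuous_on_frechet_derivative[OF s S] holo_wrt_compose_linear(1)[OF f] 1)
  then show ?thesis
    by (rule continuous_on_eq)
       (simp add: holo_wrt_compose_linear(2)[OF f 1(1,2)] holo_wrt_compose_linear(2)[OF f 1(3,4)])
qed

lemma csc3_coordinates:
  "bounded_linear (fst :: complex \<times> complex \<times> complex \<Rightarrow> complex)" "\<And>c w. fst (csc3 c w) = c * fst w"
  "bounded_linear (\<lambda>w :: complex \<times> complex \<times> complex. fst (snd w))" "\<And>c w. fst (snd (csc3 c w)) = c * fst (snd w)"
  "bounded_linear (\<lambda>w :: complex \<times> complex \<times> complex. snd (snd w))" "\<And>c w. snd (snd (csc3 c w)) = c * snd (snd w)"
  by (auto simp: csc3_def bounded_linear_fst bounded_linear_snd bounded_linear_fst_comp bounded_linear_snd_comp)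

lemma frechet_derivative_triple:
  fixes f :: "'a::euclidean_space \<Rightarrow> complex \<times> complex \<times> complex"
  assumes f: "holo_wrt s csc3 f S" and z: "z \<in> S"
  shows "frechet_derivative f (at z) v = (frechet_derivative (\<lambda>z. fst (f z)) (at z) v,
    frechet_derivative (\<lambda>z. fst (snd (f z))) (at z) v, frechet_derivative (\<lambda>z. snd (snd (f z))) (at z) v)"
  using holo_wrt_compose_linear(2)[OF f csc3_coordinates(1,2) z] holo_wrt_compose_linear(2)[OF f csc3_coordinates(3,4) z]
    holo_wrt_compose_linear(2)[OF f csc3_coordinates(5,6) z] by simp

lemma continuous_on_frechet_derivative3:
  fixes f :: "'a::euclidean_space \<Rightarrow> complex \<times> complex \<times> complex"
  assumes s: "complex_action s" and S: "open S" and f: "holo_wrt s csc3 f S"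
  shows "continuous_on S (\<lambda>z. frechet_derivative f (at z) v)"
proof -
  have "continuous_on S (\<lambda>z. (frechet_derivative (\<lambda>z. fst (f z)) (at z) v,
    frechet_derivative (\<lambda>z. fst (snd (f z))) (at z) v, frechet_derivative (\<lambda>z. snd (snd (f z))) (at z) v))"
    by (intro continuous_on_Pair continuous_on_frechet_derivative[OF s S] holo_wrt_compose_linear(1)[OF f] csc3_coordinates)
  then show ?thesis
    by (rule continuous_on_eq) (simp add: frechet_derivative_triple[OF f])
qed

lemma holo_wrt_triple:
  assumes "holo_wrt s (*) f S" "holo_wrt s (*) g S" "holo_wrt s (*) h S"
  shows "holo_wrt s csc3 (\<lambda>z. (f z, g z, h z)) S"
  unfolding holo_wrt_def
proof
  fix z assume z: "z \<in> S"
  have "((\<lambda>z. (f z, g z, h z)) has_derivative (\<lambda>v. (frechet_derivative f (at z) v, frechet_derivative g (at z) v, frechet_derivative h (at z) v))) (at z)"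
    by (intro has_derivative_Pair holo_wrt_frechet_derivative(1)[OF assms(1) z]
        holo_wrt_frechet_derivative(1)[OF assms(2) z] holo_wrt_frechet_derivative(1)[OF assms(3) z])
  then show "\<exists>D. ((\<lambda>z. (f z, g z, h z)) has_derivative D) (at z) \<and> (\<forall>c v. D (s c v) = csc3 c (D v))"
    by (intro exI conjI allI) (auto simp: csc3_def holo_wrt_frechet_derivative(2)[OF assms(1) z]
      holo_wrt_frechet_derivative(2)[OF assms(2) z] holo_wrt_frechet_derivative(2)[OF assms(3) z])
qed

lemma holo_wrt_directional_derivative3:
  fixes f :: "'a::euclidean_space \<Rightarrow> complex \<times> complex \<times> complex"
  assumes s: "complex_action s" and S: "open S" and f: "holo_wrt s csc3 f S"
  shows "holo_wrt s csc3 (\<lambda>z. frechet_derivative f (at z) v) S"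
proof -
  have *: "holo_wrt s csc3 (\<lambda>z. (frechet_derivative (\<lambda>z. fst (f z)) (at z) v,
    frechet_derivative (\<lambda>z. fst (snd (f z))) (at z) v, frechet_derivative (\<lambda>z. snd (snd (f z))) (at z) v)) S"
    by (intro holo_wrt_triple holo_wrt_directional_derivative[OF s S] holo_wrt_compose_linear(1)[OF f] csc3_coordinates)
  show ?thesis unfolding holo_wrt_def
  proof
    fix z assume z: "z \<in> S"
    obtain D where D: "((\<lambda>z. (frechet_derivative (\<lambda>z. fst (f z)) (at z) v,
    frechet_derivative (\<lambda>z. fst (snd (f z))) (at z) v, frechet_derivative (\<lambda>z. snd (snd (f z))) (at z) v)) has_derivative D) (at z)"
      "\<forall>c v. D (s c v) = csc3 c (D v)"
      using * z unfolding holo_wrt_def by blast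
    have "((\<lambda>z. frechet_derivative f (at z) v) has_derivative D) (at z)"
      by (rule has_derivative_transform_within_open[OF D(1) S z]) (simp add: frechet_derivative_triple[OF f])
    then show "\<exists>D. ((\<lambda>z. frechet_derivative f (at z) v) has_derivative D) (at z) \<and> (\<forall>c v. D (s c v) = csc3 c (D v))"
      using D(2) by blast
  qed
qed

section \<open>Cross caps\<close>

text \<open>Continuity of \<open>g\<close> is enough: \<open>h z\<close> is of order
  \<open>norm (z - p)\<close>, so the error \<open>(g z - g p) * h z\<close> is of smaller
  order.\<close>

lemma has_derivative_mult_vanishing:
  fixes g h :: "'a::real_normed_vector \<Rightarrow> complex"
  assumes g: "isCont g p" and h: "(h has_derivative D) (at p)" "h p = 0"
  shows "((\<lambda>z. g z * h z) has_derivative (\<lambda>v. g p * D v)) (at p)"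
proof -
  have "((\<lambda>z. (g z - g p) * h z) has_derivative (\<lambda>v. 0)) (at p)"
    unfolding has_derivative_at_alt
  proof (intro conjI allI impI)
    fix e :: real assume "e > 0"
    obtain K where K: "K > 0" "\<And>v. norm (D v) \<le> norm v * K"
      using bounded_linear.pos_bounded[OF has_derivative_bounded_linear[OF h(1)]] by blast
    obtain d1 where d1: "d1 > 0" "\<And>z. norm (z - p) < d1 \<Longrightarrow> norm (h z - D (z - p)) \<le> 1 * norm (z - p)"
      using h unfolding has_derivative_at_alt by (metis diff_zero zero_less_one)
    have "e / (K + 1) > 0" using \<open>e > 0\<close> K by simp
    then obtain d2 where d2: "d2 > 0" "\<And>z. norm (z - p) < d2 \<Longrightarrow> norm (g z - g p) < e / (K + 1)"
      using g unfolding continuous_at_eps_delta dist_norm by blast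
    show "\<exists>d>0. \<forall>y. norm (y - p) < d \<longrightarrow> norm ((g y - g p) * h y - (g p - g p) * h p - 0) \<le> e * norm (y - p)"
    proof (intro exI[of _ "min d1 d2"] conjI allI impI)
      fix y assume y: "norm (y - p) < min d1 d2"
      have "norm (h y) \<le> norm (h y - D (y - p)) + norm (D (y - p))" by (metis diff_add_cancel norm_triangle_ineq)
      also have "\<dots> \<le> (K + 1) * norm (y - p)"
        using d1(2)[of y] K(2)[of "y - p"] y by (simp add: algebra_simps)
      finally have "norm (g y - g p) * norm (h y) \<le> e / (K + 1) * ((K + 1) * norm (y - p))"
        using d2(2)[of y] y \<open>e / (K + 1) > 0\<close> by (intro mult_mono) auto
      also have "\<dots> = e * norm (y - p)" using K by simp
      finally show "norm ((g y - g p) * h y - (g p - g p) * h p - 0) \<le> e * norm (y - p)"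
        by (simp add: norm_mult)
    qed (use d1 d2 in auto)
  qed simp
  from has_derivative_add[OF has_derivative_mult_right[OF h(1), of "g p"] this]
  show ?thesis by (simp add: algebra_simps)
qed

lemma clinear3_eq:
  assumes "linear A" "\<And>c v. A (csc3 c v) = csc3 c (A v)"
  shows "A x = csc3 (fst x) (A (1, 0, 0)) + csc3 (fst (snd x)) (A (0, 1, 0)) + csc3 (snd (snd x)) (A (0, 0, 1))"
proof -
  have "x = csc3 (fst x) (1, 0, 0) + csc3 (fst (snd x)) (0, 1, 0) + csc3 (snd (snd x)) (0, 0, 1)"
    by (simp add: csc3_def)
  then show ?thesis by (metis assms(2) linear_add[OF assms(1)])
qed

lemma det3_combination:
  "det3 (csc3 x1 a + csc3 x2 b + csc3 x3 c) (csc3 y1 a + csc3 y2 b + csc3 y3 c) (csc3 z1 a + csc3 z2 b + csc3 z3 c)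
    = det3 (x1, x2, x3) (y1, y2, y3) (z1, z2, z3) * det3 a b c"
  by (simp add: det3_def csc3_def algebra_simps)

text \<open>Stated for a right inverse because differentiating \<open>g' (k y) = y\<close> gives one
  for the derivative of \<open>g'\<close>. If the images of the basis were dependent, all vectors
  would be combinations of them and every determinant would vanish.\<close>

lemma clinear3_surj_det_nonzero:
  assumes "linear A" "\<And>c v. A (csc3 c v) = csc3 c (A v)" and B: "\<And>v. A (B v) = v"
  shows "det3 (A (1, 0, 0)) (A (0, 1, 0)) (A (0, 0, 1)) \<noteq> 0"
proof
  let ?a = "A (1, 0, 0)" and ?b = "A (0, 1, 0)" and ?c = "A (0, 0, 1)"
  have e: "v = csc3 (fst (B v)) ?a + csc3 (fst (snd (B v))) ?b + csc3 (snd (snd (B v))) ?c" for v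
    using clinear3_eq[OF assms(1,2), of "B v"] B by simp
  assume "det3 ?a ?b ?c = 0"
  then have "det3 u v w = 0" for u v w :: "complex \<times> complex \<times> complex"
    by (subst e[of u], subst e[of v], subst e[of w]) (simp only: det3_combination mult_zero_right)
  from this[of "(1, 0, 0)" "(0, 1, 0)" "(0, 0, 1)"] show False by (simp add: det3_def)
qed

lemma crosscap_map_derivative:
  "(crosscap_map has_derivative (\<lambda>v. (2 * fst x * fst v, snd x * fst v + fst x * snd v, snd v))) (at x)"
  unfolding crosscap_map_def by (auto intro!: derivative_eq_intros simp: algebra_simps)

lemma left_inverse_derivative:
  assumes "open S" "x \<in> S" "\<And>y. y \<in> S \<Longrightarrow> g (f y) = y"
    and "(f has_derivative D) (at x)" "(g has_derivative E) (at (f x))"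
  shows "E (D v) = v"
proof -
  have "((\<lambda>y. g (f y)) has_derivative (\<lambda>v. E (D v))) (at x)"
    by (rule has_derivative_compose[OF assms(4,5)])
  moreover have "((\<lambda>y. g (f y)) has_derivative (\<lambda>v. v)) (at x)"
    by (rule has_derivative_transform_within_open[OF has_derivative_ident assms(1,2)]) (simp add: assms(3))
  ultimately show ?thesis using has_derivative_unique by metis
qed

text \<open>In these coordinates \<open>s = fst (h z)\<close>, \<open>t = snd (h z)\<close>; the vectors \<open>K1, K2, K3\<close> are the columns of the
  derivative of the inverse target chart, \<open>w\<close> and \<open>\<omega>\<close> those of the source chart.\<close>

lemma crosscap_normal_form:
  assumes "is_crosscap f p"
  obtains U h K1 K2 K3 w \<omega> where "open U" "p \<in> U" "inj_on h U" "h p = 0"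
    "(h has_derivative frechet_derivative h (at p)) (at p)"
    "\<forall>c v. frechet_derivative h (at p) (csc2 c v) = csc2 c (frechet_derivative h (at p) v)"
    "\<forall>v. frechet_derivative h (at p) v = 0 \<longrightarrow> v = 0"
    "continuous_on U h" "continuous_on U K1" "continuous_on U K2" "continuous_on U K3"
    "continuous_on U w" "continuous_on U \<omega>"
    "\<forall>z\<in>U. det3 (K1 z) (K2 z) (K3 z) \<noteq> 0 \<and> fst (w z) * snd (\<omega> z) - fst (\<omega> z) * snd (w z) \<noteq> 0"
    "\<forall>z\<in>U. fst (dcols f z) = csc3 (2 * fst (h z) * fst (w z)) (K1 z)
        + csc3 (snd (h z) * fst (w z) + fst (h z) * snd (w z)) (K2 z) + csc3 (snd (w z)) (K3 z)"
    "\<forall>z\<in>U. snd (dcols f z) = csc3 (2 * fst (h z) * fst (\<omega> z)) (K1 z)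
        + csc3 (snd (h z) * fst (\<omega> z) + fst (h z) * snd (\<omega> z)) (K2 z) + csc3 (snd (\<omega> z)) (K3 z)"
proof -
  obtain U V h g k g' where U: "open U" "p \<in> U" and V: "open V" "f ` U \<subseteq> V"
    and h: "holo22 h U" "inj_on h U" "open (h ` U)" "holo22 g (h ` U)" "\<forall>p\<in>U. g (h p) = p"
    and k: "holo33 k V" "open (k ` V)" "holo33 g' (k ` V)" "\<forall>y\<in>V. g' (k y) = y"
    and hp: "h p = 0" and eq: "\<forall>p\<in>U. k (f p) = crosscap_map (h p)"
    using assms unfolding is_crosscap_def by (elim exE conjE) (rule that)
  define Dh where "Dh z = frechet_derivative h (at z)" for z
  define Dg where "Dg z = frechet_derivative g' (at (crosscap_map (h z)))" for z
  have ccV: "crosscap_map (h z) \<in> k ` V" if "z \<in> U" for z 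
  proof -
    have "f z \<in> V" using V(2) that by blast
    then have "k (f z) \<in> k ` V" by (rule imageI)
    then show ?thesis using bspec[OF eq that] by simp
  qed
  have Dh: "(h has_derivative Dh z) (at z)" "Dh z (csc2 c v) = csc2 c (Dh z v)" if "z \<in> U" for z c v
    unfolding Dh_def using holo_wrt_frechet_derivative[OF h(1) that] by blast+
  have Dg: "(g' has_derivative Dg z) (at (crosscap_map (h z)))" "Dg z (csc3 c v) = csc3 c (Dg z v)" if "z \<in> U" for z c v
    unfolding Dg_def using holo_wrt_frechet_derivative[OF k(3) ccV[OF that]] by blast+
  have Dh_inj: "v = 0" if "z \<in> U" "Dh z v = 0" for z v
  proof -
    have "(g has_derivative frechet_derivative g (at (h z))) (at (h z))"
      using holo_wrt_frechet_derivative(1)[OF h(4)] that(1) by blast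
    note g' = this
    have "frechet_derivative g (at (h z)) (Dh z v) = v"
      by (rule left_inverse_derivative[OF U(1) that(1) _ Dh(1)[OF that(1)] g']) (use h(5) in auto)
    then show ?thesis
      using that(2) linear_0[OF bounded_linear.linear[OF has_derivative_bounded_linear[OF g']]] by simp
  qed
  have Dg_surj: "Dg z (frechet_derivative k (at (f z)) v) = v" if "z \<in> U" for z v
  proof -
    have fz: "f z \<in> V" using V that by auto
    have *: "(g' has_derivative Dg z) (at (k (f z)))" using Dg(1)[OF that] eq that by simp
    show ?thesis
      by (rule left_inverse_derivative[OF V(1) fz _ holo_wrt_frechet_derivative(1)[OF k(1) fz] *]) (use k(4) in auto)
  qed
  have linh: "linear (Dh z)" if "z \<in> U" for z
    by (rule bounded_linear.linear[OF has_derivative_bounded_linear[OF Dh(1)[OF that]]])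
  have ling: "linear (Dg z)" if "z \<in> U" for z
    by (rule bounded_linear.linear[OF has_derivative_bounded_linear[OF Dg(1)[OF that]]])
  \<comment> \<open>On \<open>U\<close> the map \<open>f\<close> is \<open>g'\<close> after
    \<open>crosscap_map\<close> after \<open>h\<close>; the chain rule and linearity of
    \<open>Dg z\<close> give the three terms.\<close>
  have frechet: "frechet_derivative f (at z) v = csc3 (2 * fst (h z) * fst (Dh z v)) (Dg z (1, 0, 0))
        + csc3 (snd (h z) * fst (Dh z v) + fst (h z) * snd (Dh z v)) (Dg z (0, 1, 0)) + csc3 (snd (Dh z v)) (Dg z (0, 0, 1))"
    if z: "z \<in> U" for z v
  proof -
    have "((\<lambda>z. g' (crosscap_map (h z))) has_derivative (\<lambda>v. Dg z (2 * fst (h z) * fst (Dh z v),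
      snd (h z) * fst (Dh z v) + fst (h z) * snd (Dh z v), snd (Dh z v)))) (at z)"
      by (rule has_derivative_compose[OF has_derivative_compose[OF Dh(1)[OF z] crosscap_map_derivative] Dg(1)[OF z]])
    then have "(f has_derivative (\<lambda>v. Dg z (2 * fst (h z) * fst (Dh z v),
      snd (h z) * fst (Dh z v) + fst (h z) * snd (Dh z v), snd (Dh z v)))) (at z)"
    proof (rule has_derivative_transform_within_open[OF _ U(1) z])
      fix y assume "y \<in> U"
      then have "f y \<in> V" "k (f y) = crosscap_map (h y)" using V(2) eq by blast+
      then show "g' (crosscap_map (h y)) = f y" using bspec[OF k(4), of "f y"] by simp
    qed
    then have "frechet_derivative f (at z) = (\<lambda>v. Dg z (2 * fst (h z) * fst (Dh z v),
      snd (h z) * fst (Dh z v) + fst (h z) * snd (Dh z v), snd (Dh z v)))"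
      by (rule frechet_derivative_at[symmetric])
    then show ?thesis
      using clinear3_eq[OF ling[OF z] Dg(2)[OF z], of "(2 * fst (h z) * fst (Dh z v),
        snd (h z) * fst (Dh z v) + fst (h z) * snd (Dh z v), snd (Dh z v))"] by (simp only: fst_conv snd_conv)
  qed
  have cont_h: "continuous_on U h" by (rule holo_wrt_continuous_on[OF h(1)])
  have cont_g: "continuous_on U (\<lambda>z. Dg z v)" for v
  proof -
    have "continuous_on U (\<lambda>z. crosscap_map (h z))"
      unfolding crosscap_map_def by (intro continuous_intros cont_h)
    then show ?thesis unfolding Dg_def
      by (rule continuous_on_compose2[OF continuous_on_frechet_derivative3[OF complex_action_csc3 k(2,3)]]) (use ccV in auto)
  qed
  show thesis
  proof (rule that[of U h "\<lambda>z. Dg z (1, 0, 0)" "\<lambda>z. Dg z (0, 1, 0)" "\<lambda>z. Dg z (0, 0, 1)" "\<lambda>z. Dh z (1, 0)" "\<lambda>z. Dh z (0, 1)"])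
    show "(h has_derivative frechet_derivative h (at p)) (at p)"
      using Dh(1)[OF U(2)] unfolding Dh_def .
    show "\<forall>c v. frechet_derivative h (at p) (csc2 c v) = csc2 c (frechet_derivative h (at p) v)"
      using Dh(2)[OF U(2)] unfolding Dh_def by simp
    show "\<forall>v. frechet_derivative h (at p) v = 0 \<longrightarrow> v = 0"
      using Dh_inj[OF U(2)] unfolding Dh_def by simp
    show "continuous_on U (\<lambda>z. Dh z (1, 0))" "continuous_on U (\<lambda>z. Dh z (0, 1))"
      unfolding Dh_def by (intro continuous_on_frechet_derivative2[OF complex_action_csc2 U(1) h(1)])+
    show "\<forall>z\<in>U. det3 (Dg z (1, 0, 0)) (Dg z (0, 1, 0)) (Dg z (0, 0, 1)) \<noteq> 0 \<and>
      fst (Dh z (1, 0)) * snd (Dh z (0, 1)) - fst (Dh z (0, 1)) * snd (Dh z (1, 0)) \<noteq> 0"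
    proof (intro ballI conjI)
      fix z assume z: "z \<in> U"
      show "det3 (Dg z (1, 0, 0)) (Dg z (0, 1, 0)) (Dg z (0, 0, 1)) \<noteq> 0"
        by (rule clinear3_surj_det_nonzero[OF ling[OF z] Dg(2)[OF z] Dg_surj[OF z]])
      show "fst (Dh z (1, 0)) * snd (Dh z (0, 1)) - fst (Dh z (0, 1)) * snd (Dh z (1, 0)) \<noteq> 0"
        by (rule clinear2_det_nonzero[OF linh[OF z] Dh(2)[OF z] Dh_inj[OF z]])
    qed
    show "\<forall>z\<in>U. fst (dcols f z) = csc3 (2 * fst (h z) * fst (Dh z (1, 0))) (Dg z (1, 0, 0))
        + csc3 (snd (h z) * fst (Dh z (1, 0)) + fst (h z) * snd (Dh z (1, 0))) (Dg z (0, 1, 0)) + csc3 (snd (Dh z (1, 0))) (Dg z (0, 0, 1))"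
      unfolding dcols_def fst_conv by (intro ballI frechet)
    show "\<forall>z\<in>U. snd (dcols f z) = csc3 (2 * fst (h z) * fst (Dh z (0, 1))) (Dg z (1, 0, 0))
        + csc3 (snd (h z) * fst (Dh z (0, 1)) + fst (h z) * snd (Dh z (0, 1))) (Dg z (0, 1, 0)) + csc3 (snd (Dh z (0, 1))) (Dg z (0, 0, 1))"
      unfolding dcols_def snd_conv by (intro ballI frechet)
  qed (rule U hp h(2) cont_h cont_g)+
qed

lemma det3_linear_independent:
  assumes "csc3 x a + csc3 y b + csc3 z c = 0" "det3 a b c \<noteq> 0"
  shows "x = 0" "y = 0" "z = 0"
proof -
  have "det3 (csc3 x a + csc3 y b + csc3 z c) b c = x * det3 a b c"
    "det3 a (csc3 x a + csc3 y b + csc3 z c) c = y * det3 a b c"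
    "det3 a b (csc3 x a + csc3 y b + csc3 z c) = z * det3 a b c"
    by (simp_all add: det3_def csc3_def algebra_simps)
  moreover have "det3 0 b c = 0" "det3 a 0 c = 0" "det3 a b 0 = 0"
    by (simp_all add: det3_def)
  ultimately show "x = 0" "y = 0" "z = 0" unfolding assms(1) using assms(2) by simp_all
qed

text \<open>At \<open>p\<close> only the \<open>K3\<close> terms survive, and not both of their
  coefficients vanish because the source chart is invertible: the rank is exactly one. At other
  points of the chart \<open>h z\<close> is nonzero by injectivity, and this excludes
  relations.\<close>

lemma crosscap_isolated:
  assumes "is_crosscap f p"
  shows "singular_at f p" and "dcols f p \<noteq> 0"
    and "\<exists>U. open U \<and> p \<in> U \<and> (\<forall>z\<in>U. singular_at f z \<longrightarrow> z = p)"
proof -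
  obtain U h K1 K2 K3 w \<omega> where U: "open U" "p \<in> U" "inj_on h U" "h p = 0"
    and "(h has_derivative frechet_derivative h (at p)) (at p)"
    "\<forall>c v. frechet_derivative h (at p) (csc2 c v) = csc2 c (frechet_derivative h (at p) v)"
    "\<forall>v. frechet_derivative h (at p) v = 0 \<longrightarrow> v = 0"
    "continuous_on U h" "continuous_on U K1" "continuous_on U K2" "continuous_on U K3"
    "continuous_on U w" "continuous_on U \<omega>"
    and nz: "\<forall>z\<in>U. det3 (K1 z) (K2 z) (K3 z) \<noteq> 0 \<and> fst (w z) * snd (\<omega> z) - fst (\<omega> z) * snd (w z) \<noteq> 0"
    and P: "\<forall>z\<in>U. fst (dcols f z) = csc3 (2 * fst (h z) * fst (w z)) (K1 z)
        + csc3 (snd (h z) * fst (w z) + fst (h z) * snd (w z)) (K2 z) + csc3 (snd (w z)) (K3 z)"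
    and Q: "\<forall>z\<in>U. snd (dcols f z) = csc3 (2 * fst (h z) * fst (\<omega> z)) (K1 z)
        + csc3 (snd (h z) * fst (\<omega> z) + fst (h z) * snd (\<omega> z)) (K2 z) + csc3 (snd (\<omega> z)) (K3 z)"
    by (rule crosscap_normal_form[OF assms]) (rule that)
  have Pp: "fst (dcols f p) = csc3 (snd (w p)) (K3 p)" and Qp: "snd (dcols f p) = csc3 (snd (\<omega> p)) (K3 p)"
    using bspec[OF P U(2)] bspec[OF Q U(2)] U(4) by simp_all
  have wp: "snd (w p) \<noteq> 0 \<or> snd (\<omega> p) \<noteq> 0" using bspec[OF nz U(2)] by auto
  have "K3 p \<noteq> 0" using bspec[OF nz U(2)] by (auto simp: det3_def)
  then have "fst (dcols f p) \<noteq> 0 \<or> snd (dcols f p) \<noteq> 0"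
    unfolding Pp Qp csc3_eq_0_iff using wp by blast
  then show "dcols f p \<noteq> 0" by auto
  have "csc3 (snd (\<omega> p)) (fst (dcols f p)) + csc3 (- snd (w p)) (snd (dcols f p)) = 0"
    unfolding Pp Qp by (simp add: csc3_def zero_prod_def)
  then have "snd (\<omega> p) = 0 \<and> - snd (w p) = 0" if "(fst (dcols f p), snd (dcols f p)) \<in> cindep2"
    using that unfolding cindep2_def by blast
  with wp have "(fst (dcols f p), snd (dcols f p)) \<notin> cindep2" by auto
  then show "singular_at f p" by (simp add: singular_at_def)
  have "\<not> singular_at f z" if z: "z \<in> U" "z \<noteq> p" for z
  proof -
    have hz: "h z \<noteq> 0" using inj_onD[OF U(3), of z p] z U(2,4) by auto
    have "a = 0 \<and> b = 0" if ab: "csc3 a (fst (dcols f z)) + csc3 b (snd (dcols f z)) = 0" for a b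
    proof -
      \<comment> \<open>\<open>(A, B)\<close> is the image of \<open>(a, b)\<close> under the
        derivative of the source chart.\<close>
      define A where "A = fst (w z) * a + fst (\<omega> z) * b"
      define B where "B = snd (w z) * a + snd (\<omega> z) * b"
      have "csc3 (2 * fst (h z) * A) (K1 z) + csc3 (snd (h z) * A + fst (h z) * B) (K2 z) + csc3 B (K3 z) = 0"
      proof -
        have "csc3 (2 * fst (h z) * A) (K1 z) + csc3 (snd (h z) * A + fst (h z) * B) (K2 z) + csc3 B (K3 z)
          = csc3 a (fst (dcols f z)) + csc3 b (snd (dcols f z))"
          unfolding bspec[OF P z(1)] bspec[OF Q z(1)] A_def B_def by (simp add: csc3_def algebra_simps)
        then show ?thesis using ab by (rule trans)
      qed
      note det3_linear_independent[OF this conjunct1[OF bspec[OF nz z(1)]]]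
      then have "B = 0" "fst (h z) * A = 0" "snd (h z) * A = 0" by simp_all
      moreover from this have "A = 0" using hz by (auto simp: prod_eq_iff)
      moreover have "fst (w z) * snd (\<omega> z) - fst (\<omega> z) * snd (w z) \<noteq> 0" using nz z by blast
      ultimately show ?thesis
        using linear2_eq_0[of "fst (w z)" a "fst (\<omega> z)" b "snd (w z)" "snd (\<omega> z)"] unfolding A_def B_def by simp
    qed
    then have "(fst (dcols f z), snd (dcols f z)) \<in> cindep2" unfolding cindep2_def by blast
    then show ?thesis by (simp add: singular_at_def)
  qed
  then show "\<exists>U. open U \<and> p \<in> U \<and> (\<forall>z\<in>U. singular_at f z \<longrightarrow> z = p)" using U by blast
qed

lemma isCont_det3 [continuous_intros]:
  fixes f g h :: "'a::t2_space \<Rightarrow> complex \<times> complex \<times> complex"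
  shows "isCont f p \<Longrightarrow> isCont g p \<Longrightarrow> isCont h p \<Longrightarrow> isCont (\<lambda>x. det3 (f x) (g x) (h x)) p"
  unfolding det3_def by (intro continuous_intros)

text \<open>The combination \<open>(o2 + \<alpha> * w2) P - w2 (Q + \<alpha> P)\<close> cancels
  \<open>K3\<close> and leaves the Jacobian of the source chart times \<open>2 s K1 + t K2\<close>.
  Since multiples of \<open>Q + \<alpha> P\<close> do not affect the determinants, the coordinates
  are visibly linear in \<open>s\<close> and \<open>t\<close>, up to coefficients.\<close>

lemma det3_crosscap_identity:
  assumes P: "P = csc3 (2 * s * w1) K1 + csc3 (t * w1 + s * w2) K2 + csc3 w2 K3"
    and Q: "Q = csc3 (2 * s * o1) K1 + csc3 (t * o1 + s * o2) K2 + csc3 o2 K3"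
  shows "(o2 + \<alpha> * w2) * det3 P E Q = (w1 * o2 - o1 * w2) *
      (2 * det3 K1 E (Q + csc3 \<alpha> P) * s + det3 K2 E (Q + csc3 \<alpha> P) * t)"
    and "(o2 + \<alpha> * w2) * det3 E P Q = (w1 * o2 - o1 * w2) *
      (2 * det3 E K1 (Q + csc3 \<alpha> P) * s + det3 E K2 (Q + csc3 \<alpha> P) * t)"
proof -
  define R where "R = Q + csc3 \<alpha> P"
  have eq: "csc3 (o2 + \<alpha> * w2) P - csc3 w2 R = csc3 (w1 * o2 - o1 * w2) (csc3 (2 * s) K1 + csc3 t K2)"
    unfolding R_def P Q by (simp add: csc3_def algebra_simps)
  have "(o2 + \<alpha> * w2) * det3 P E Q = (o2 + \<alpha> * w2) * det3 P E R"
    by (simp add: R_def det3_shear)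
  also have "\<dots> = det3 (csc3 (o2 + \<alpha> * w2) P - csc3 w2 R) E R"
    by (simp add: det3_def csc3_def algebra_simps)
  finally show "(o2 + \<alpha> * w2) * det3 P E Q = (w1 * o2 - o1 * w2) *
      (2 * det3 K1 E (Q + csc3 \<alpha> P) * s + det3 K2 E (Q + csc3 \<alpha> P) * t)"
    unfolding eq R_def[symmetric] by (simp add: det3_def csc3_def algebra_simps)
  have "(o2 + \<alpha> * w2) * det3 E P Q = (o2 + \<alpha> * w2) * det3 E P R"
    by (simp add: R_def det3_shear)
  also have "\<dots> = det3 E (csc3 (o2 + \<alpha> * w2) P - csc3 w2 R) R"
    by (simp add: det3_def csc3_def algebra_simps)
  finally show "(o2 + \<alpha> * w2) * det3 E P Q = (w1 * o2 - o1 * w2) *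
      (2 * det3 E K1 (Q + csc3 \<alpha> P) * s + det3 E K2 (Q + csc3 \<alpha> P) * t)"
    unfolding eq R_def[symmetric] by (simp add: det3_def csc3_def algebra_simps)
qed

text \<open>Modulo \<open>q\<close> the vectors lie in a plane, and this is the determinant of the
  coordinates of \<open>a\<close> and \<open>b\<close> with respect to \<open>f\<close> and
  \<open>e\<close>.\<close>

lemma det3_plucker:
  "det3 a e q * det3 f b q - det3 b e q * det3 f a q = det3 f e q * det3 a b (q :: complex \<times> complex \<times> complex)"
  by (simp add: det3_def algebra_simps)

text \<open>Near a cross cap the coordinates vanish linearly in \<open>h\<close> with continuous coefficients, so they are
  differentiable there although \<open>E1\<close> and \<open>E2\<close> are only continuous.\<close>

theorem crosscap_frame_coordinates_derivative:
  assumes cc: "is_crosscap f p" and E: "isCont E1 p" "isCont E2 p"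
    and det: "det3 (E1 p) (E2 p) (snd (dcols f p) + csc3 \<alpha> (fst (dcols f p))) \<noteq> 0"
  shows "\<exists>A. ((\<lambda>z. (det3 (fst (dcols f z)) (E2 z) (snd (dcols f z)), det3 (E1 z) (fst (dcols f z)) (snd (dcols f z))))
      has_derivative A) (at p) \<and> (\<forall>c v. A (csc2 c v) = csc2 c (A v)) \<and> (\<forall>v. A v = 0 \<longrightarrow> v = 0)"
proof -
  obtain U h K1 K2 K3 w \<omega> where U: "open U" "p \<in> U" "inj_on h U" "h p = 0"
    and h: "(h has_derivative frechet_derivative h (at p)) (at p)"
    "\<forall>c v. frechet_derivative h (at p) (csc2 c v) = csc2 c (frechet_derivative h (at p) v)"
    "\<forall>v. frechet_derivative h (at p) v = 0 \<longrightarrow> v = 0"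
    and cont: "continuous_on U h" "continuous_on U K1" "continuous_on U K2" "continuous_on U K3"
    "continuous_on U w" "continuous_on U \<omega>"
    and nz: "\<forall>z\<in>U. det3 (K1 z) (K2 z) (K3 z) \<noteq> 0 \<and> fst (w z) * snd (\<omega> z) - fst (\<omega> z) * snd (w z) \<noteq> 0"
    and P: "\<forall>z\<in>U. fst (dcols f z) = csc3 (2 * fst (h z) * fst (w z)) (K1 z)
        + csc3 (snd (h z) * fst (w z) + fst (h z) * snd (w z)) (K2 z) + csc3 (snd (w z)) (K3 z)"
    and Q: "\<forall>z\<in>U. snd (dcols f z) = csc3 (2 * fst (h z) * fst (\<omega> z)) (K1 z)
        + csc3 (snd (h z) * fst (\<omega> z) + fst (h z) * snd (\<omega> z)) (K2 z) + csc3 (snd (\<omega> z)) (K3 z)"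
    by (rule crosscap_normal_form[OF cc]) (rule that)
  let ?P = "\<lambda>z. fst (dcols f z)" and ?Q = "\<lambda>z. snd (dcols f z)"
  define R where "R z = ?Q z + csc3 \<alpha> (?P z)" for z
  \<comment> \<open>The factor in front of the coordinates in \<open>det3_crosscap_identity\<close>,
    by which one has to divide. It is nonzero at \<open>p\<close>, since \<open>R p\<close> is
    \<open>W p\<close> times \<open>K3 p\<close> and the frame assumption excludes
    \<open>R p = 0\<close>.\<close>
  define W where "W z = snd (\<omega> z) + \<alpha> * snd (w z)" for z
  define \<delta> where "\<delta> z = (fst (w z) * snd (\<omega> z) - fst (\<omega> z) * snd (w z)) / W z" for z
  have isC: "isCont h p" "isCont K1 p" "isCont K2 p" "isCont K3 p" "isCont w p" "isCont \<omega> p"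
    using cont U(2) by (simp_all add: continuous_on_eq_continuous_at[OF U(1)])
  have contPQ: "continuous_on U ?P" "continuous_on U ?Q"
  proof -
    have "continuous_on U (\<lambda>z. csc3 (2 * fst (h z) * fst (w z)) (K1 z)
        + csc3 (snd (h z) * fst (w z) + fst (h z) * snd (w z)) (K2 z) + csc3 (snd (w z)) (K3 z))"
      by (intro continuous_intros cont)
    then show "continuous_on U ?P" by (rule continuous_on_eq) (rule bspec[OF P, symmetric])
    have "continuous_on U (\<lambda>z. csc3 (2 * fst (h z) * fst (\<omega> z)) (K1 z)
        + csc3 (snd (h z) * fst (\<omega> z) + fst (h z) * snd (\<omega> z)) (K2 z) + csc3 (snd (\<omega> z)) (K3 z))"
      by (intro continuous_intros cont)
    then show "continuous_on U ?Q" by (rule continuous_on_eq) (rule bspec[OF Q, symmetric])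
  qed
  have "continuous_on U R" unfolding R_def by (intro continuous_intros contPQ)
  then have isR: "isCont R p" using U by (simp add: continuous_on_eq_continuous_at)
  have isW: "isCont W p" unfolding W_def by (intro continuous_intros isC)
  have Rp: "R p = csc3 (W p) (K3 p)"
    unfolding R_def W_def bspec[OF P U(2)] bspec[OF Q U(2)] U(4) by (simp add: csc3_def algebra_simps)
  have Wp: "W p \<noteq> 0"
  proof
    assume "W p = 0"
    then have "R p = 0" using Rp by simp
    then show False using det unfolding R_def[symmetric] by (simp add: det3_def)
  qed
  have is\<delta>: "isCont \<delta> p" unfolding \<delta>_def using Wp by (intro continuous_intros isC isW)
  \<comment> \<open>The coefficients of \<open>s\<close> and \<open>t\<close> after division by
    \<open>W\<close>; they are continuous at \<open>p\<close>, which is what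
    \<open>has_derivative_mult_vanishing\<close> takes.\<close>
  define G11 where "G11 z = \<delta> z * (2 * det3 (K1 z) (E2 z) (R z))" for z
  define G12 where "G12 z = \<delta> z * det3 (K2 z) (E2 z) (R z)" for z
  define G21 where "G21 z = \<delta> z * (2 * det3 (E1 z) (K1 z) (R z))" for z
  define G22 where "G22 z = \<delta> z * det3 (E1 z) (K2 z) (R z)" for z
  have isG: "isCont G11 p" "isCont G12 p" "isCont G21 p" "isCont G22 p"
    unfolding G11_def G12_def G21_def G22_def by (intro continuous_intros isC isR E is\<delta>)+
  define D where "D = frechet_derivative h (at p)"
  have D: "((\<lambda>z. fst (h z)) has_derivative (\<lambda>v. fst (D v))) (at p)" "((\<lambda>z. snd (h z)) has_derivative (\<lambda>v. snd (D v))) (at p)"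
    using h(1) unfolding D_def by (auto intro!: derivative_eq_intros)
  define A where "A v = (G11 p * fst (D v) + G12 p * snd (D v), G21 p * fst (D v) + G22 p * snd (D v))" for v
  have "((\<lambda>z. (G11 z * fst (h z) + G12 z * snd (h z), G21 z * fst (h z) + G22 z * snd (h z))) has_derivative A) (at p)"
    unfolding A_def using U(4)
    by (intro has_derivative_Pair has_derivative_add has_derivative_mult_vanishing isG D) auto
  moreover have "\<forall>\<^sub>F z in at p. (G11 z * fst (h z) + G12 z * snd (h z), G21 z * fst (h z) + G22 z * snd (h z))
      = (det3 (?P z) (E2 z) (?Q z), det3 (E1 z) (?P z) (?Q z))"
  proof -
    have "\<forall>\<^sub>F z in at p. z \<in> U" using U by (intro eventually_at_in_open')
    moreover have "\<forall>\<^sub>F z in at p. W z \<noteq> 0"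
      using isW Wp unfolding isCont_def by (rule tendsto_imp_eventually_ne)
    ultimately show ?thesis
    proof eventually_elim
      case (elim z)
      note id = det3_crosscap_identity[OF bspec[OF P elim(1)] bspec[OF Q elim(1)], of \<alpha>]
      have \<delta>: "fst (w z) * snd (\<omega> z) - fst (\<omega> z) * snd (w z) = W z * \<delta> z"
        using elim(2) by (simp add: \<delta>_def)
      have "W z * det3 (?P z) (E2 z) (?Q z) = W z * (G11 z * fst (h z) + G12 z * snd (h z))"
        using id(1)[of "E2 z"] unfolding W_def[symmetric] R_def[symmetric] \<delta>
        by (simp add: G11_def G12_def algebra_simps)
      moreover have "W z * det3 (E1 z) (?P z) (?Q z) = W z * (G21 z * fst (h z) + G22 z * snd (h z))"
        using id(2)[of "E1 z"] unfolding W_def[symmetric] R_def[symmetric] \<delta>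
        by (simp add: G21_def G22_def algebra_simps)
      ultimately show ?case using elim(2) by simp
    qed
  qed
  moreover have "(G11 p * fst (h p) + G12 p * snd (h p), G21 p * fst (h p) + G22 p * snd (h p))
      = (det3 (?P p) (E2 p) (?Q p), det3 (E1 p) (?P p) (?Q p))"
  proof -
    have "W p * det3 (?P p) (E2 p) (?Q p) = 0"
      using det3_crosscap_identity(1)[OF bspec[OF P U(2)] bspec[OF Q U(2)], of \<alpha> "E2 p"]
      unfolding W_def U(4) by simp
    moreover have "W p * det3 (E1 p) (?P p) (?Q p) = 0"
      using det3_crosscap_identity(2)[OF bspec[OF P U(2)] bspec[OF Q U(2)], of \<alpha> "E1 p"]
      unfolding W_def U(4) by simp
    ultimately show ?thesis using Wp U(4) by simp
  qed
  ultimately have "((\<lambda>z. (det3 (?P z) (E2 z) (?Q z), det3 (E1 z) (?P z) (?Q z))) has_derivative A) (at p)"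
    by (rule has_derivative_transform_eventually) simp
  moreover have "A (csc2 c v) = csc2 c (A v)" for c v
  proof -
    have "D (csc2 c v) = csc2 c (D v)" using h(2) unfolding D_def by blast
    then show ?thesis unfolding A_def by (simp add: csc2_def algebra_simps)
  qed
  moreover have "v = 0" if "A v = 0" for v
  proof -
    \<comment> \<open>Up to the column factors \<open>2 * \<delta> p\<close> and
      \<open>\<delta> p\<close>, the matrix consists of coordinates of \<open>K1 p\<close> and
      \<open>K2 p\<close> modulo \<open>R p\<close>, so its determinant splits into two frame
      determinants.\<close>
    have "G11 p * G22 p - G12 p * G21 p = 2 * (\<delta> p)\<^sup>2 *
        (det3 (K1 p) (E2 p) (R p) * det3 (E1 p) (K2 p) (R p) - det3 (K2 p) (E2 p) (R p) * det3 (E1 p) (K1 p) (R p))"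
      by (simp add: G11_def G12_def G21_def G22_def power2_eq_square algebra_simps)
    also have "\<dots> = 2 * (\<delta> p)\<^sup>2 * (det3 (E1 p) (E2 p) (R p) * det3 (K1 p) (K2 p) (R p))"
      by (simp only: det3_plucker)
    also have "det3 (K1 p) (K2 p) (R p) = W p * det3 (K1 p) (K2 p) (K3 p)"
      by (simp add: Rp det3_def csc3_def algebra_simps)
    also have "2 * (\<delta> p)\<^sup>2 * (det3 (E1 p) (E2 p) (R p) * (W p * det3 (K1 p) (K2 p) (K3 p))) \<noteq> 0"
      using bspec[OF nz U(2)] Wp det unfolding R_def[symmetric] by (simp add: \<delta>_def)
    finally have G: "G11 p * G22 p - G12 p * G21 p \<noteq> 0" .
    have "G11 p * fst (D v) + G12 p * snd (D v) = 0" "G21 p * fst (D v) + G22 p * snd (D v) = 0"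
      using that unfolding A_def by (simp_all add: zero_prod_def)
    from linear2_eq_0[OF this G] have "D v = 0" by (simp add: prod_eq_iff)
    then show "v = 0" using h(3) unfolding D_def by blast
  qed
  ultimately show ?thesis by (intro exI[of _ A] conjI allI impI)
qed

section \<open>One map with isolated cross caps\<close>

lemma singular_at_iff: "singular_at f z \<longleftrightarrow> cr3 (fst (dcols f z)) (snd (dcols f z)) = 0"
  unfolding singular_at_def using cindep2_iff[of "fst (dcols f z)" "snd (dcols f z)"] by simp

lemma finite_shear_parameters:
  assumes "(P, Q) \<noteq> 0"
  shows "finite {\<alpha>. Q + csc3 \<alpha> P = 0}"
proof (cases "P = 0")
  case True
  then have "{\<alpha>. Q + csc3 \<alpha> P = 0} = {}" 
  proof -
    have "Q \<noteq> 0" using assms True by (metis zero_prod_def)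
    then show ?thesis using True by simp
  qed
  then show ?thesis by simp
next
  case False
  have "\<alpha> = \<beta>" if "Q + csc3 \<alpha> P = 0" "Q + csc3 \<beta> P = 0" for \<alpha> \<beta>
  proof -
    have "csc3 (\<alpha> - \<beta>) P = (Q + csc3 \<alpha> P) - (Q + csc3 \<beta> P)"
      by (simp add: csc3_def algebra_simps)
    with that have "csc3 (\<alpha> - \<beta>) P = 0" by simp
    with False show ?thesis by (simp add: csc3_eq_0_iff)
  qed
  then have "{\<alpha>. Q + csc3 \<alpha> P = 0} = {} \<or> (\<exists>\<beta>. {\<alpha>. Q + csc3 \<alpha> P = 0} = {\<beta>})" by blast
  then show ?thesis by (metis finite.emptyI finite.insertI)
qed

text \<open>The singular set in the closed ball is compact, as the zero set of the minors, and has
  no accumulation point because cross caps are isolated.\<close>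

lemma finite_singular_set:
  assumes cont: "continuous_on (cball 0 r) (dcols f)"
    and cc: "\<And>z. z \<in> cball 0 r \<Longrightarrow> singular_at f z \<Longrightarrow> is_crosscap f z"
  shows "finite {z \<in> cball 0 r. singular_at f z}"
proof -
  let ?Z = "{z \<in> cball 0 r. singular_at f z}"
  have "?Z = {z \<in> cball 0 r. cr3 (fst (dcols f z)) (snd (dcols f z)) = 0}"
    by (simp add: singular_at_iff)
  moreover have "closed {z \<in> cball 0 r. cr3 (fst (dcols f z)) (snd (dcols f z)) = 0}"
    by (intro continuous_closed_preimage_constant closed_cball continuous_intros cont)
  ultimately have "closed ?Z" by simp
  then have "compact ?Z"
    unfolding compact_eq_bounded_closed by (intro conjI bounded_subset[OF bounded_cball[of 0 r]]) auto
  then have "finite (?Z \<inter> ?Z)"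
  proof (rule finite_not_islimpt_in_compact)
    fix p assume "p \<in> ?Z"
    then obtain U where "open U" "p \<in> U" "\<forall>z\<in>U. singular_at f z \<longrightarrow> z = p"
      using crosscap_isolated(3)[OF cc] by blast
    then show "\<not> p islimpt ?Z" unfolding islimpt_def by blast
  qed
  then show ?thesis by simp
qed

theorem dcols_sphere_homotopic_rep_frame:
  assumes r: "r > 0" and cont: "continuous_on (cball 0 r) (dcols f)"
    and cc: "\<And>z. z \<in> cball 0 r \<Longrightarrow> singular_at f z \<Longrightarrow> is_crosscap f z"
    and reg: "\<And>z. z \<in> sphere 0 r \<Longrightarrow> \<not> singular_at f z"
  shows "sphere_homotopic cindep2 (\<lambda>q. dcols f (r *\<^sub>R q)) (rep_frame (int (card {z \<in> ball 0 r. singular_at f z})))"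
proof -
  let ?P = "\<lambda>z. fst (dcols f z)" and ?Q = "\<lambda>z. snd (dcols f z)"
  let ?Z = "{z \<in> cball 0 r. singular_at f z}"
  have fin: "finite ?Z" by (rule finite_singular_set[OF cont cc])
  have Z_ball: "?Z \<subseteq> ball 0 r" using reg by (force simp: less_le)
  have Z: "?Z = {z \<in> cball 0 r. (?P z, ?Q z) \<notin> cindep2}" by (simp add: singular_at_def)
  \<comment> \<open>Each of the finitely many singular points excludes finitely many values of
    \<alpha>, because the columns do not both vanish there. At regular points independence excludes
    none.\<close>
  have "finite (\<Union>z\<in>?Z. {\<alpha>. ?Q z + csc3 \<alpha> (?P z) = 0})"
  proof (rule finite_UN_I[OF fin])
    fix z assume "z \<in> ?Z"
    then have "dcols f z \<noteq> 0" using crosscap_isolated(2) cc by blast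
    then show "finite {\<alpha>. ?Q z + csc3 \<alpha> (?P z) = 0}" by (intro finite_shear_parameters) simp
  qed
  then obtain \<alpha> where \<alpha>: "\<alpha> \<notin> (\<Union>z\<in>?Z. {\<alpha>. ?Q z + csc3 \<alpha> (?P z) = 0})"
    using ex_new_if_finite[OF infinite_UNIV_char_0] by blast
  have \<alpha>_nz: "?Q z + csc3 \<alpha> (?P z) \<noteq> 0" if z: "z \<in> cball 0 r" for z
  proof
    assume eq: "?Q z + csc3 \<alpha> (?P z) = 0"
    show False
    proof (cases "singular_at f z")
      case True
      then show False using \<alpha> z eq by blast
    next
      case False
      then have "(?P z, ?Q z) \<in> cindep2" by (simp add: singular_at_def)
      moreover have "csc3 \<alpha> (?P z) + csc3 1 (?Q z) = 0" using eq by (simp add: add.commute)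
      ultimately show False unfolding cindep2_def by fastforce
    qed
  qed
  have "sphere_homotopic cindep2 (\<lambda>q. (?P (r *\<^sub>R q), ?Q (r *\<^sub>R q)))
    (rep_frame (int (card {z \<in> cball 0 r. (?P z, ?Q z) \<notin> cindep2})))"
  proof (rule sphere_homotopic_rep_frame_card[OF r _ _ \<alpha>_nz])
    show "continuous_on (cball 0 r) ?P" "continuous_on (cball 0 r) ?Q"
      by (intro continuous_intros cont)+
    show "finite {z \<in> cball 0 r. (?P z, ?Q z) \<notin> cindep2}" "{z \<in> cball 0 r. (?P z, ?Q z) \<notin> cindep2} \<subseteq> ball 0 r"
      unfolding Z[symmetric] by (fact fin Z_ball)+
    fix E1 E2 p
    assume E: "continuous_on (cball 0 r) E1" "continuous_on (cball 0 r) E2"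
      and det: "\<forall>z\<in>cball 0 r. det3 (E1 z) (E2 z) (?Q z + csc3 \<alpha> (?P z)) = 1"
      and p: "p \<in> ball 0 r" "(?P p, ?Q p) \<notin> cindep2"
    have p': "p \<in> cball 0 r" using p by simp
    have "isCont E1 p" "isCont E2 p"
      using continuous_on_subset[OF E(1) ball_subset_cball] continuous_on_subset[OF E(2) ball_subset_cball] p(1)
      by (simp_all add: continuous_on_eq_continuous_at)
    moreover have "is_crosscap f p" using cc[OF p'] p(2) by (simp add: singular_at_def)
    moreover have det_p: "det3 (E1 p) (E2 p) (?Q p + csc3 \<alpha> (?P p)) \<noteq> 0" using det p' by auto
    ultimately obtain A where A: "((\<lambda>z. (det3 (?P z) (E2 z) (?Q z), det3 (E1 z) (?P z) (?Q z))) has_derivative A) (at p)"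
      "\<forall>c v. A (csc2 c v) = csc2 c (A v)" "\<forall>v. A v = 0 \<longrightarrow> v = 0"
      using crosscap_frame_coordinates_derivative[of f p E1 E2 \<alpha>] by blast
    show "simple_zero (\<lambda>z. (det3 (?P z) (E2 z) (?Q z), det3 (E1 z) (?P z) (?Q z))) p"
    proof (rule simple_zero_if_derivative[OF A(1)])
      show "(det3 (?P p) (E2 p) (?Q p), det3 (E1 p) (?P p) (?Q p)) = 0"
        using frame_coordinates_zero_iff[OF det_p] p(2) by blast
      show "continuous_on (ball 0 r) (\<lambda>z. (det3 (?P z) (E2 z) (?Q z), det3 (E1 z) (?P z) (?Q z)))"
        by (intro continuous_intros continuous_on_subset[OF E(1) ball_subset_cball]
            continuous_on_subset[OF E(2) ball_subset_cball] continuous_on_subset[OF cont ball_subset_cball])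
    qed (use A p in auto)
  qed
  moreover have "?Z = {z \<in> ball 0 r. singular_at f z}" using Z_ball by auto
  ultimately show ?thesis unfolding Z[symmetric] by simp
qed

section \<open>Families of maps\<close>

lemma holo_wrt_add:
  assumes "holo_wrt s (*) f S" "holo_wrt s (*) g S"
  shows "holo_wrt s (*) (\<lambda>z. f z + g z) S"
  unfolding holo_wrt_def
proof
  fix z assume z: "z \<in> S"
  note f = holo_wrt_frechet_derivative[OF assms(1) z] and g = holo_wrt_frechet_derivative[OF assms(2) z]
  show "\<exists>D. ((\<lambda>z. f z + g z) has_derivative D) (at z) \<and> (\<forall>c v. D (s c v) = c * D v)"
    using has_derivative_add[OF f(1) g(1)]
    by (intro exI conjI allI) (auto simp: f(2) g(2) algebra_simps)
qed

lemma holo_wrt_diff: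
  assumes "holo_wrt s (*) f S" "holo_wrt s (*) g S"
  shows "holo_wrt s (*) (\<lambda>z. f z - g z) S"
  unfolding holo_wrt_def
proof
  fix z assume z: "z \<in> S"
  note f = holo_wrt_frechet_derivative[OF assms(1) z] and g = holo_wrt_frechet_derivative[OF assms(2) z]
  show "\<exists>D. ((\<lambda>z. f z - g z) has_derivative D) (at z) \<and> (\<forall>c v. D (s c v) = c * D v)"
    using has_derivative_diff[OF f(1) g(1)]
    by (intro exI conjI allI) (auto simp: f(2) g(2) algebra_simps)
qed

lemma holo_wrt_mult:
  assumes "holo_wrt s (*) f S" "holo_wrt s (*) g S"
  shows "holo_wrt s (*) (\<lambda>z. f z * g z) S"
  unfolding holo_wrt_def
proof
  fix z assume z: "z \<in> S"
  note f = holo_wrt_frechet_derivative[OF assms(1) z] and g = holo_wrt_frechet_derivative[OF assms(2) z]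
  show "\<exists>D. ((\<lambda>z. f z * g z) has_derivative D) (at z) \<and> (\<forall>c v. D (s c v) = c * D v)"
    using has_derivative_mult[OF f(1) g(1)]
    by (intro exI conjI allI) (auto simp: f(2) g(2) algebra_simps)
qed

lemma holo_wrt_det3:
  assumes "holo_wrt s csc3 f S" "holo_wrt s csc3 g S" "holo_wrt s csc3 h S"
  shows "holo_wrt s (*) (\<lambda>z. det3 (f z) (g z) (h z)) S"
  unfolding det3_def
  by (intro holo_wrt_add holo_wrt_diff holo_wrt_mult holo_wrt_compose_linear(1)[OF assms(1)]
      holo_wrt_compose_linear(1)[OF assms(2)] holo_wrt_compose_linear(1)[OF assms(3)] csc3_coordinates)

lemma holo_wrt_const3: "complex_action s \<Longrightarrow> holo_wrt s csc3 (\<lambda>_. c) S"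
  unfolding holo_wrt_def by (auto intro!: exI[of _ "\<lambda>_. 0"])

text \<open>The continuity of the derivative that the inverse function theorem demands is a
  consequence of holomorphy here, and injectivity in finite dimension supplies the inverse
  operator.\<close>

lemma complex_linear_inverse_function:
  fixes f :: "complex \<times> complex \<times> complex \<Rightarrow> complex \<times> complex \<times> complex"
  assumes S: "open S" "x0 \<in> S" and f: "holo33 f S"
    and inj: "\<And>v. frechet_derivative f (at x0) v = 0 \<Longrightarrow> v = 0"
  obtains U V g where "open U" "U \<subseteq> S" "x0 \<in> U" "open V" "f x0 \<in> V" "homeomorphism U V f g"
proof -
  define f' where "f' x = Blinfun (frechet_derivative f (at x))" for x
  have f': "blinfun_apply (f' x) = frechet_derivative f (at x)" if "x \<in> S" for x
    unfolding f'_def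
    by (rule bounded_linear_Blinfun_apply[OF has_derivative_bounded_linear[OF holo_wrt_frechet_derivative(1)[OF f that]]])
  have "linear (frechet_derivative f (at x0))"
    by (rule bounded_linear.linear[OF has_derivative_bounded_linear[OF holo_wrt_frechet_derivative(1)[OF f S(2)]]])
  moreover from this have "inj (frechet_derivative f (at x0))"
    using inj by (simp add: linear_injective_0)
  ultimately obtain k where k: "linear k" "k \<circ> frechet_derivative f (at x0) = id"
    using linear_injective_left_inverse by blast
  have "bounded_linear k" using k(1) linear_conv_bounded_linear by blast
  then have inv: "Blinfun k o\<^sub>L f' x0 = id_blinfun"
    using pointfree_idE[OF k(2)] by (intro blinfun_eqI) (simp add: f'[OF S(2)] bounded_linear_Blinfun_apply)
  have der: "(f has_derivative blinfun_apply (f' x)) (at x)" if "x \<in> S" for x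
    unfolding f'[OF that] by (rule holo_wrt_frechet_derivative(1)[OF f that])
  have cont: "continuous_on S f'"
  proof (rule continuous_on_blinfun_componentwise)
    fix i :: "complex \<times> complex \<times> complex"
    show "continuous_on S (\<lambda>x. blinfun_apply (f' x) i)"
      using continuous_on_frechet_derivative3[OF complex_action_csc3 S(1) f, of i]
      by (rule continuous_on_eq) (simp add: f')
  qed
  show thesis
  proof (rule inverse_function_theorem[OF S(1) der cont S(2) inv])
    fix U V g
    assume "open U" "U \<subseteq> S" "x0 \<in> U" "open V" "f x0 \<in> V" "homeomorphism U V f g"
    then show thesis by (rule that)
  qed
qed

lemma finite_separation:
  fixes Z :: "'a::metric_space set"
  assumes "finite Z"
  shows "\<exists>d>0. \<forall>p\<in>Z. \<forall>q\<in>Z. p \<noteq> q \<longrightarrow> d \<le> dist p q"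
  using assms
proof (induction Z)
  case empty
  then show ?case by (intro exI[of _ 1]) simp
next
  case (insert x Z)
  then obtain d where d: "d > 0" "\<forall>p\<in>Z. \<forall>q\<in>Z. p \<noteq> q \<longrightarrow> d \<le> dist p q" by blast
  obtain e where e: "e > 0" "\<forall>q\<in>Z. q \<noteq> x \<longrightarrow> e \<le> dist x q"
    using finite_set_avoid[OF insert(1)] by blast
  have "min d e \<le> dist p q" if pq: "p \<in> insert x Z" "q \<in> insert x Z" "p \<noteq> q" for p q
  proof -
    consider "p = x" "q \<in> Z" | "q = x" "p \<in> Z" | "p \<in> Z" "q \<in> Z" using pq by blast
    then show ?thesis
    proof cases
      case 1
      then show ?thesis using e(2) pq(3) by (simp add: min.coboundedI2)
    next
      case 2
      then have "e \<le> dist x p" using e(2) pq(3) by blast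
      then show ?thesis using 2 by (simp add: dist_commute min.coboundedI2)
    next
      case 3
      then show ?thesis using d(2) pq(3) by (simp add: min.coboundedI1)
    qed
  qed
  then show ?case using d(1) e(1) by (intro exI[of _ "min d e"]) simp
qed

section \<open>Singular points in a holomorphic family\<close>

locale holomorphic_family =
  fixes F :: "complex \<Rightarrow> complex \<times> complex \<Rightarrow> complex \<times> complex \<times> complex"
    and W :: "(complex \<times> complex \<times> complex) set"
  assumes open_W: "open W" and holo_family: "holo33 (\<lambda>(l, z). F l z) W"
begin

text \<open>Taken from the total map and not from the slices \<open>F l\<close>, so that the columns
  are holomorphic in \<open>l\<close> and \<open>z\<close> jointly.\<close>

definition P :: "complex \<times> complex \<times> complex \<Rightarrow> complex \<times> complex \<times> complex" where
  "P x = frechet_derivative (\<lambda>(l, z). F l z) (at x) (0, 1, 0)"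

definition Q :: "complex \<times> complex \<times> complex \<Rightarrow> complex \<times> complex \<times> complex" where
  "Q x = frechet_derivative (\<lambda>(l, z). F l z) (at x) (0, 0, 1)"

lemma dcols_slice:
  assumes "(l, z) \<in> W"
  shows "dcols (F l) z = (P (l, z), Q (l, z))"
proof -
  have "((\<lambda>z. (l, z)) has_derivative (\<lambda>v. (0, v))) (at z)"
    by (intro has_derivative_Pair has_derivative_const has_derivative_ident)
  from has_derivative_compose[OF this holo_wrt_frechet_derivative(1)[OF holo_family assms]]
  have "(F l has_derivative (\<lambda>v. frechet_derivative (\<lambda>(l, z). F l z) (at (l, z)) (0, v))) (at z)"
    unfolding prod.case .
  then have "frechet_derivative (F l) (at z) = (\<lambda>v. frechet_derivative (\<lambda>(l, z). F l z) (at (l, z)) (0, v))"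
    by (rule frechet_derivative_at[symmetric])
  then show ?thesis unfolding dcols_def P_def Q_def by (simp only:)
qed

lemma continuous_PQ: "continuous_on W P" "continuous_on W Q"
  unfolding P_def Q_def by (intro continuous_on_frechet_derivative3[OF complex_action_csc3 open_W holo_family])+

lemma holo_PQ: "holo33 P W" "holo33 Q W"
  unfolding P_def Q_def by (intro holo_wrt_directional_derivative3[OF complex_action_csc3 open_W holo_family])+

lemma continuous_dcols:
  assumes "{l} \<times> K \<subseteq> W"
  shows "continuous_on K (dcols (F l))"
proof -
  have in_W: "(l, z) \<in> W" if "z \<in> K" for z using assms that by blast
  have pair: "continuous_on K (\<lambda>z. (l, z))" by (intro continuous_intros)
  have "continuous_on K (\<lambda>z. P (l, z))"
    by (rule continuous_on_compose2[OF continuous_PQ(1) pair]) (use in_W in blast)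
  moreover have "continuous_on K (\<lambda>z. Q (l, z))"
    by (rule continuous_on_compose2[OF continuous_PQ(2) pair]) (use in_W in blast)
  ultimately have "continuous_on K (\<lambda>z. (P (l, z), Q (l, z)))" by (rule continuous_on_Pair)
  then show ?thesis by (rule continuous_on_eq) (simp add: dcols_slice in_W)
qed

lemma singular_iff: "(l, z) \<in> W \<Longrightarrow> singular_at (F l) z \<longleftrightarrow> cr3 (P (l, z)) (Q (l, z)) = 0"
  by (simp add: singular_at_iff dcols_slice)

text \<open>Regularity is an open condition on \<open>(l, z)\<close>, and the tube lemma makes it
  uniform over the compact set \<open>K\<close>.\<close>

lemma eventually_regular:
  assumes K: "compact K" "{l0} \<times> K \<subseteq> W" and reg: "\<And>z. z \<in> K \<Longrightarrow> \<not> singular_at (F l0) z"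
  shows "\<forall>\<^sub>F l in nhds l0. \<forall>z\<in>K. (l, z) \<in> W \<and> \<not> singular_at (F l) z"
proof -
  define R where "R = W \<inter> (\<lambda>x. cr3 (P x) (Q x)) -` (- {0})"
  have R: "(l, z) \<in> R \<longleftrightarrow> (l, z) \<in> W \<and> \<not> singular_at (F l) z" for l z
    using singular_iff[of l z] by (auto simp: R_def)
  have "continuous_on W (\<lambda>x. cr3 (P x) (Q x))" by (intro continuous_intros continuous_PQ)
  then have "open R" unfolding R_def by (rule continuous_open_preimage) (simp_all add: open_W open_Compl)
  moreover have "{l0} \<times> K \<subseteq> R"
  proof (rule subsetI)
    fix x assume "x \<in> {l0} \<times> K"
    then obtain z where x: "x = (l0, z)" "z \<in> K" by (elim SigmaE) simp
    have "(l0, z) \<in> W" by (rule subsetD[OF K(2)]) (simp add: x(2))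
    then show "x \<in> R" unfolding x(1) R using reg[OF x(2)] by simp
  qed
  ultimately obtain X where X: "l0 \<in> X" "open X" "X \<times> K \<subseteq> R"
    using Elementary_Topology.tube_lemma[OF K(1), of R l0] by metis
  have "\<forall>z\<in>K. (l, z) \<in> W \<and> \<not> singular_at (F l) z" if "l \<in> X" for l
    using subsetD[OF X(3), of "(l, _)"] that unfolding R[symmetric] by simp
  then show ?thesis unfolding eventually_nhds by (intro exI[of _ X] conjI ballI X) simp_all
qed

text \<open>Near \<open>(l0, p)\<close> constant vectors \<open>E1\<close>, \<open>E2\<close>
  complete the frame, so the coordinates are holomorphic. Together with \<open>l\<close> they form a
  local homeomorphism \<Psi>, and the singular points are the solutions of
  \<open>\<Psi> (l, z) = (l, 0)\<close>.\<close>

lemma crosscap_persists_uniquely: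
  assumes lp: "(l0, p) \<in> W" and cc: "is_crosscap (F l0) p" and T: "open T" "p \<in> T"
  shows "\<exists>S. open S \<and> p \<in> S \<and> S \<subseteq> T \<and> (\<forall>\<^sub>F l in nhds l0. \<exists>!z. z \<in> S \<and> singular_at (F l) z)"
proof -
  have PQ: "dcols (F l0) p = (P (l0, p), Q (l0, p))" by (rule dcols_slice[OF lp])
  have "finite {\<alpha>. Q (l0, p) + csc3 \<alpha> (P (l0, p)) = 0}"
    using crosscap_isolated(2)[OF cc] unfolding PQ by (rule finite_shear_parameters)
  then obtain \<alpha> where \<alpha>: "Q (l0, p) + csc3 \<alpha> (P (l0, p)) \<noteq> 0"
    using ex_new_if_finite[OF infinite_UNIV_char_0] by blast
  obtain E1 E2 where E: "det3 E1 E2 (Q (l0, p) + csc3 \<alpha> (P (l0, p))) \<noteq> 0"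
    using ex_det3_nonzero[OF \<alpha>] by blast
  define W1 where "W1 = W \<inter> (\<lambda>x. det3 E1 E2 (Q x + csc3 \<alpha> (P x))) -` (- {0})"
  have "continuous_on W (\<lambda>x. det3 E1 E2 (Q x + csc3 \<alpha> (P x)))"
    by (intro continuous_intros continuous_PQ)
  then have "open W1" unfolding W1_def by (rule continuous_open_preimage) (auto intro: open_W)
  have lp1: "(l0, p) \<in> W1" using lp E by (simp add: W1_def)
  define \<Psi> where "\<Psi> x = (fst x, det3 (P x) E2 (Q x), det3 E1 (P x) (Q x))" for x
  have hol: "holo33 \<Psi> W1"
  proof (rule holo_wrt_subset[of _ _ _ W])
    have "holo_wrt csc3 (*) (fst :: complex \<times> complex \<times> complex \<Rightarrow> complex) W"
      unfolding holo_wrt_def using has_derivative_fst[OF has_derivative_ident] csc3_coordinates(2) by blast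
    then show "holo33 \<Psi> W" unfolding \<Psi>_def
      by (intro holo_wrt_triple holo_wrt_det3 holo_PQ holo_wrt_const3 complex_action_csc3)
  qed (simp add: W1_def)
  obtain A where A: "((\<lambda>z. (det3 (fst (dcols (F l0) z)) E2 (snd (dcols (F l0) z)), det3 E1 (fst (dcols (F l0) z)) (snd (dcols (F l0) z))))
      has_derivative A) (at p)" "\<forall>v. A v = 0 \<longrightarrow> v = 0"
    using crosscap_frame_coordinates_derivative[OF cc, of "\<lambda>_. E1" "\<lambda>_. E2" \<alpha>] E unfolding PQ by auto
  \<comment> \<open>The first component of \<Psi> forces the \<open>l\<close>-part of
    \<open>v\<close> to vanish; on the slice \<open>l = l0\<close> the derivative is the injective
    \<open>A\<close>.\<close>
  have inj: "v = 0" if v: "frechet_derivative \<Psi> (at (l0, p)) v = 0" for v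
  proof -
    define D where "D = frechet_derivative \<Psi> (at (l0, p))"
    have D: "(\<Psi> has_derivative D) (at (l0, p))"
      unfolding D_def by (rule holo_wrt_frechet_derivative(1)[OF hol lp1])
    have "((\<lambda>x. fst (\<Psi> x)) has_derivative (\<lambda>v. fst (D v))) (at (l0, p))"
      by (rule has_derivative_fst[OF D])
    moreover have "((\<lambda>x. fst (\<Psi> x)) has_derivative fst) (at (l0, p))"
      unfolding \<Psi>_def fst_conv by (rule has_derivative_fst[OF has_derivative_ident])
    ultimately have "(\<lambda>v. fst (D v)) = fst" by (rule has_derivative_unique)
    then have "fst v = fst (D v)" by metis
    then have v1: "fst v = 0" using v by (simp add: D_def)
    have slice: "((\<lambda>z. (l0, z)) has_derivative (\<lambda>v. (0, v))) (at p)"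
      by (intro has_derivative_Pair has_derivative_const has_derivative_ident)
    have "((\<lambda>z. snd (\<Psi> (l0, z))) has_derivative (\<lambda>v. snd (D (0, v)))) (at p)"
      by (rule has_derivative_snd[OF has_derivative_compose[OF slice D]])
    moreover have "((\<lambda>z. snd (\<Psi> (l0, z))) has_derivative A) (at p)"
    proof (rule has_derivative_transform_within_open[OF A(1)])
      have "open ((\<lambda>z. (l0, z)) -` W)" by (intro open_vimage open_W continuous_intros)
      then show "open {z. (l0, z) \<in> W}" by (simp add: vimage_def)
    qed (use lp in \<open>auto simp: \<Psi>_def dcols_slice\<close>)
    ultimately have "(\<lambda>v. snd (D (0, v))) = A" by (rule has_derivative_unique)
    then have "A (snd v) = snd (D (0, snd v))" by metis
    also have "(0, snd v) = v" using v1 by (simp add: prod_eq_iff)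
    finally have "A (snd v) = 0" using v by (simp add: D_def)
    then have "snd v = 0" using A(2) by blast
    with v1 show ?thesis by (simp add: prod_eq_iff)
  qed
  obtain U V g where U: "open U" "U \<subseteq> W1" "(l0, p) \<in> U" and V: "open V" "\<Psi> (l0, p) \<in> V"
    and homeo: "homeomorphism U V \<Psi> g"
    by (rule complex_linear_inverse_function[OF \<open>open W1\<close> lp1 hol inj]) (assumption, rule that)
  have sing: "singular_at (F l) z \<longleftrightarrow> \<Psi> (l, z) = (l, 0)" if "(l, z) \<in> U" for l z
  proof -
    have W1: "(l, z) \<in> W1" using U(2) that by blast
    then have "det3 E1 E2 (Q (l, z) + csc3 \<alpha> (P (l, z))) \<noteq> 0" "(l, z) \<in> W" by (simp_all add: W1_def)
    from frame_coordinates_zero_iff[OF this(1)] show ?thesis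
      unfolding singular_at_def dcols_slice[OF \<open>(l, z) \<in> W\<close>] by (simp add: \<Psi>_def)
  qed
  have \<Psi>0: "\<Psi> (l0, p) = (l0, 0)" using sing[OF U(3)] crosscap_isolated(1)[OF cc] by simp
  \<comment> \<open>A product neighbourhood inside \<open>U\<close> keeps every slice over
    \<open>B\<close> in the region where \<Psi> is injective; this gives uniqueness for all
    \<open>l\<close> in \<open>A\<close>.\<close>
  have "open (U \<inter> UNIV \<times> T)" by (intro open_Int U open_Times T) simp
  moreover have "(l0, p) \<in> U \<inter> UNIV \<times> T" using U T by simp
  ultimately obtain A B where AB: "open A" "open B" "(l0, p) \<in> A \<times> B" "A \<times> B \<subseteq> U \<inter> UNIV \<times> T"
    by (rule open_prod_elim)
  have l0p: "l0 \<in> A" "p \<in> B" using AB(3) by auto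
  have "open ((\<lambda>l. (l, 0 :: complex \<times> complex)) -` V)" by (intro open_vimage V continuous_intros)
  moreover have "l0 \<in> (\<lambda>l. (l, 0)) -` V" using V \<Psi>0 by simp
  ultimately have "\<forall>\<^sub>F l in nhds l0. l \<in> (\<lambda>l. (l, 0)) -` V" by (rule eventually_nhds_in_open)
  then have ev_V: "\<forall>\<^sub>F l in nhds l0. (l, 0) \<in> V" by simp
  \<comment> \<open>Existence: the solution \<open>g (l, 0)\<close> tends to \<open>(l0, p)\<close>,
    hence lies in \<open>A \<times> B\<close> for \<open>l\<close> near \<open>l0\<close>.\<close>
  have "continuous_on V g" using homeo by (simp add: homeomorphism_def)
  then have "isCont g (l0, 0)" using V \<Psi>0 by (simp add: continuous_on_eq_continuous_at)
  moreover have "((\<lambda>l. (l, 0)) \<longlongrightarrow> (l0, 0 :: complex \<times> complex)) (nhds l0)"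
    by (intro tendsto_intros) (simp add: filterlim_ident)
  ultimately have "((\<lambda>l. g (l, 0)) \<longlongrightarrow> g (l0, 0)) (nhds l0)" by (rule isCont_tendsto_compose)
  moreover have "g (l0, 0) = (l0, p)" using homeo U(3) \<Psi>0 unfolding homeomorphism_def by metis
  ultimately have ev_g: "\<forall>\<^sub>F l in nhds l0. g (l, 0) \<in> A \<times> B"
    using AB by (intro topological_tendstoD[of "\<lambda>l. g (l, 0)"] open_Times) auto
  have ev_A: "\<forall>\<^sub>F l in nhds l0. l \<in> A" by (rule eventually_nhds_in_open[OF AB(1) l0p(1)])
  have "\<forall>\<^sub>F l in nhds l0. \<exists>!z. z \<in> B \<and> singular_at (F l) z"
    using ev_V ev_g ev_A
  proof eventually_elim
    case (elim l)
    have gl: "\<Psi> (g (l, 0)) = (l, 0)" using homeo elim(1) unfolding homeomorphism_def by blast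
    then have "fst (g (l, 0)) = l" by (simp add: \<Psi>_def)
    then have "g (l, 0) = (l, snd (g (l, 0)))" by (metis prod.collapse)
    with gl have g: "\<Psi> (l, snd (g (l, 0))) = (l, 0)" by metis
    have B: "snd (g (l, 0)) \<in> B" using elim(2) by auto
    have inU: "(l, z) \<in> U" if "z \<in> B" for z using AB(4) elim(3) that by blast
    show ?case
    proof (rule ex1I[of _ "snd (g (l, 0))"])
      show "snd (g (l, 0)) \<in> B \<and> singular_at (F l) (snd (g (l, 0)))"
        using B sing[OF inU[OF B]] g by simp
      fix z assume z: "z \<in> B \<and> singular_at (F l) z"
      then have zU: "(l, z) \<in> U" using inU by blast
      then have "\<Psi> (l, z) = (l, 0)" using sing z by blast
      moreover have "g (\<Psi> (l, z)) = (l, z)" using homeo zU unfolding homeomorphism_def by blast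
      ultimately show "z = snd (g (l, 0))" by simp
    qed
  qed
  moreover have "B \<subseteq> T" using AB(4) l0p(1) by auto
  ultimately show ?thesis using AB(2) l0p(2) by blast
qed

text \<open>Disjoint neighbourhoods of the singular points of \<open>F l0\<close> each keep exactly
  one singular point, and by compactness none appears elsewhere. Sending each old point to the new
  one next to it is a bijection.\<close>

lemma eventually_card_singular_eq:
  assumes r: "{l0} \<times> cball 0 r \<subseteq> W"
    and cc: "\<And>z. z \<in> cball 0 r \<Longrightarrow> singular_at (F l0) z \<Longrightarrow> is_crosscap (F l0) z"
    and reg: "\<And>z. z \<in> sphere 0 r \<Longrightarrow> \<not> singular_at (F l0) z"
  shows "\<forall>\<^sub>F l in nhds l0. card {z \<in> ball 0 r. singular_at (F l) z} = card {z \<in> ball 0 r. singular_at (F l0) z}"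
proof -
  define Z where "Z = {z \<in> ball 0 r. singular_at (F l0) z}"
  have "Z \<subseteq> {z \<in> cball 0 r. singular_at (F l0) z}" by (auto simp: Z_def)
  then have fin: "finite Z"
    using finite_singular_set[OF continuous_dcols[OF r] cc] by (rule finite_subset)
  then obtain d where d: "d > 0" "\<forall>p\<in>Z. \<forall>q\<in>Z. p \<noteq> q \<longrightarrow> d \<le> dist p q" using finite_separation by blast
  have "\<forall>p\<in>Z. \<exists>S. open S \<and> p \<in> S \<and> S \<subseteq> ball p (d / 2) \<inter> ball 0 r \<and>
      (\<forall>\<^sub>F l in nhds l0. \<exists>!z. z \<in> S \<and> singular_at (F l) z)"
  proof
    fix p assume p: "p \<in> Z"
    then have p': "p \<in> cball 0 r" "singular_at (F l0) p" "p \<in> ball 0 r" by (simp_all add: Z_def)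
    show "\<exists>S. open S \<and> p \<in> S \<and> S \<subseteq> ball p (d / 2) \<inter> ball 0 r \<and> (\<forall>\<^sub>F l in nhds l0. \<exists>!z. z \<in> S \<and> singular_at (F l) z)"
    proof (rule crosscap_persists_uniquely)
      show "(l0, p) \<in> W" by (rule subsetD[OF r]) (use p'(1) in simp)
      show "is_crosscap (F l0) p" by (rule cc[OF p'(1,2)])
      show "p \<in> ball p (d / 2) \<inter> ball 0 r" using d(1) p'(3) by simp
    qed auto
  qed
  from bchoice[OF this] obtain S where S: "\<forall>p\<in>Z. open (S p) \<and> p \<in> S p \<and> S p \<subseteq> ball p (d / 2) \<inter> ball 0 r \<and>
      (\<forall>\<^sub>F l in nhds l0. \<exists>!z. z \<in> S p \<and> singular_at (F l) z)" by blast
  have disj: "p = q" if "p \<in> Z" "q \<in> Z" "z \<in> S p" "z \<in> S q" for p q z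
  proof (rule ccontr)
    assume "p \<noteq> q"
    have "z \<in> ball p (d / 2)" "z \<in> ball q (d / 2)" using S that by blast+
    then have "dist p q < d" using dist_triangle_half_r[of z p d q] by (simp add: dist_commute)
    then show False using d(2) that(1,2) \<open>p \<noteq> q\<close> by fastforce
  qed
  \<comment> \<open>Compact and free of singular points of \<open>F l0\<close>. It contains the
    boundary sphere, where \<open>reg\<close> applies, so none can enter from outside.\<close>
  define K where "K = cball 0 r - (\<Union>p\<in>Z. S p)"
  have "compact K" unfolding K_def by (intro compact_diff compact_cball open_UN) (use S in blast)
  moreover have "{l0} \<times> K \<subseteq> W" using r unfolding K_def by blast
  moreover have "\<not> singular_at (F l0) z" if z: "z \<in> K" for z
  proof (cases "z \<in> sphere 0 r")
    case True
    then show ?thesis by (rule reg)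
  next
    case False
    then have "z \<in> ball 0 r" using z by (auto simp: K_def)
    moreover have "z \<notin> Z" using z S unfolding K_def by blast
    ultimately show ?thesis by (simp add: Z_def)
  qed
  ultimately have "\<forall>\<^sub>F l in nhds l0. \<forall>z\<in>K. (l, z) \<in> W \<and> \<not> singular_at (F l) z"
    by (rule eventually_regular)
  moreover have "\<forall>\<^sub>F l in nhds l0. \<forall>p\<in>Z. \<exists>!z. z \<in> S p \<and> singular_at (F l) z"
    by (rule eventually_ball_finite[OF fin]) (use S in blast)
  ultimately show ?thesis unfolding Z_def[symmetric]
  proof eventually_elim
    case (elim l)
    from bchoice[of Z "\<lambda>p z. z \<in> S p \<and> singular_at (F l) z"] elim(2)
    obtain \<phi> where \<phi>: "\<forall>p\<in>Z. \<phi> p \<in> S p \<and> singular_at (F l) (\<phi> p)" by blast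
    have "bij_betw \<phi> Z {z \<in> ball 0 r. singular_at (F l) z}"
    proof (rule bij_betw_imageI)
      show "inj_on \<phi> Z"
      proof (rule inj_onI)
        fix p q assume pq: "p \<in> Z" "q \<in> Z" "\<phi> p = \<phi> q"
        then have "\<phi> p \<in> S p" "\<phi> p \<in> S q" using \<phi> by (blast, metis)
        then show "p = q" by (rule disj[OF pq(1,2)])
      qed
      show "\<phi> ` Z = {z \<in> ball 0 r. singular_at (F l) z}"
      proof (intro subset_antisym subsetI)
        fix z assume "z \<in> \<phi> ` Z"
        then obtain p where "p \<in> Z" "z = \<phi> p" by blast
        then show "z \<in> {z \<in> ball 0 r. singular_at (F l) z}" using \<phi> S by blast
      next
        fix z assume z: "z \<in> {z \<in> ball 0 r. singular_at (F l) z}"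
        then have "z \<notin> K" "z \<in> cball 0 r" using elim(1) by auto
        then obtain p where p: "p \<in> Z" "z \<in> S p" unfolding K_def by blast
        then have "z = \<phi> p" using elim(2) \<phi> z by blast
        then show "z \<in> \<phi> ` Z" using p(1) by blast
      qed
    qed
    then show ?case by (rule bij_betw_same_card[symmetric])
  qed
qed

text \<open>The singularity of \<open>F 0\<close> inside the ball may be degenerate, so local
  constancy is available only for nonzero \<open>l\<close>; the punctured disc is connected and
  makes the count constant. Regularity of \<open>F 0\<close> on the sphere keeps singular points
  from crossing it for small \<open>l\<close>.\<close>

lemma eventually_card_singular_const:
  assumes \<epsilon>: "\<delta> > 0" "cball 0 \<delta> \<times> cball 0 \<epsilon> \<subseteq> W"
    and cc: "\<And>l z. 0 < norm l \<Longrightarrow> norm l < \<delta> \<Longrightarrow> z \<in> cball 0 \<epsilon> \<Longrightarrow> singular_at (F l) z \<Longrightarrow> is_crosscap (F l) z"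
    and reg: "\<And>z. z \<in> sphere 0 \<epsilon> \<Longrightarrow> \<not> singular_at (F 0) z"
  shows "\<exists>n. \<forall>\<^sub>F l in at 0. card {z \<in> ball 0 \<epsilon>. singular_at (F l) z} = n"
proof -
  have "\<forall>\<^sub>F l in nhds 0. \<forall>z\<in>sphere 0 \<epsilon>. (l, z) \<in> W \<and> \<not> singular_at (F l) z"
  proof (rule eventually_regular[OF compact_sphere _ reg])
    have "{0} \<times> sphere 0 \<epsilon> \<subseteq> cball 0 \<delta> \<times> cball 0 \<epsilon>" using \<epsilon>(1) by auto
    then show "{0} \<times> sphere 0 \<epsilon> \<subseteq> W" using \<epsilon>(2) by blast
  qed
  then obtain d where d: "d > 0" "\<And>l. dist l 0 < d \<Longrightarrow> \<forall>z\<in>sphere 0 \<epsilon>. (l, z) \<in> W \<and> \<not> singular_at (F l) z"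
    unfolding eventually_nhds_metric by blast
  define D where "D = ball 0 (min d \<delta>) - {0 :: complex}"
  define N where "N l = card {z \<in> ball 0 \<epsilon>. singular_at (F l) z}" for l
  have conn: "connected D"
    unfolding D_def by (rule connected_open_diff_countable) (simp_all add: connected_ball)
  have loc: "\<forall>l\<in>D. \<forall>\<^sub>F l' in at l within D. N l = N l'"
  proof
    fix l assume l: "l \<in> D"
    then have l': "0 < norm l" "norm l < \<delta>" "dist l 0 < d" by (auto simp: D_def)
    have "\<forall>\<^sub>F l' in nhds l. N l' = N l"
      unfolding N_def
    proof (rule eventually_card_singular_eq)
      have "{l} \<times> cball 0 \<epsilon> \<subseteq> cball 0 \<delta> \<times> cball 0 \<epsilon>" using l' by auto
      then show "{l} \<times> cball 0 \<epsilon> \<subseteq> W" using \<epsilon>(2) by blast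
      show "is_crosscap (F l) z" if "z \<in> cball 0 \<epsilon>" "singular_at (F l) z" for z
        by (rule cc[OF l'(1,2) that])
      show "\<not> singular_at (F l) z" if "z \<in> sphere 0 \<epsilon>" for z using d(2)[OF l'(3)] that by blast
    qed
    then have "\<forall>\<^sub>F l' in at l within D. N l' = N l"
      by (rule filter_leD[OF at_within_le_nhds])
    then show "\<forall>\<^sub>F l' in at l within D. N l = N l'" by eventually_elim simp
  qed
  define l1 where "l1 = complex_of_real (min d \<delta> / 2)"
  have l1: "l1 \<in> D" using d(1) \<epsilon>(1) by (auto simp: D_def l1_def)
  have const: "N l = N l1" if "l \<in> D" for l
    by (rule connected_local_const[OF conn that l1 loc])
  have "\<forall>\<^sub>F l in at 0. l \<in> D"
    unfolding D_def eventually_at by (intro exI[of _ "min d \<delta>"]) (use d(1) \<epsilon>(1) in \<open>auto simp: dist_commute\<close>)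
  then have "\<forall>\<^sub>F l in at 0. N l = N l1" by (rule eventually_mono) (rule const)
  then show ?thesis unfolding N_def by blast
qed

lemma sphere_homotopic_dcols_family:
  assumes "\<And>t q. t \<in> {0..1} \<Longrightarrow> q \<in> sphere 0 1 \<Longrightarrow>
      (of_real t * l, r *\<^sub>R q) \<in> W \<and> \<not> singular_at (F (of_real t * l)) (r *\<^sub>R q)"
  shows "sphere_homotopic cindep2 (\<lambda>q. dcols (F 0) (r *\<^sub>R q)) (\<lambda>q. dcols (F l) (r *\<^sub>R q))"
proof (rule homotopic_with_canonI[where h = "\<lambda>t q. dcols (F (of_real t * l)) (r *\<^sub>R q)"])
  let ?m = "\<lambda>x :: real \<times> (complex \<times> complex). (of_real (fst x) * l, r *\<^sub>R snd x)"
  have m: "continuous_on ({0..1} \<times> sphere 0 1) ?m" by (intro continuous_intros)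
  have mW: "?m ` ({0..1} \<times> sphere 0 1) \<subseteq> W"
  proof (rule image_subsetI)
    fix x :: "real \<times> (complex \<times> complex)" assume "x \<in> {0..1} \<times> sphere 0 1"
    then show "?m x \<in> W" using assms[of "fst x" "snd x"] by (simp add: mem_Times_iff)
  qed
  have "continuous_on ({0..1} \<times> sphere 0 1) (\<lambda>x. (P (?m x), Q (?m x)))"
    by (intro continuous_on_Pair continuous_on_compose2[OF continuous_PQ(1) m mW]
        continuous_on_compose2[OF continuous_PQ(2) m mW])
  then show "continuous_on ({0..1} \<times> sphere 0 1) (\<lambda>(t, q). dcols (F (of_real t * l)) (r *\<^sub>R q))"
  proof (rule continuous_on_eq)
    fix x :: "real \<times> (complex \<times> complex)" assume "x \<in> {0..1} \<times> sphere 0 1"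
    then have "?m x \<in> W" using mW by blast
    then show "(P (?m x), Q (?m x)) = (case x of (t, q) \<Rightarrow> dcols (F (of_real t * l)) (r *\<^sub>R q))"
      unfolding case_prod_beta by (rule dcols_slice[symmetric])
  qed
  show "dcols (F (of_real t * l)) (r *\<^sub>R q) \<in> cindep2" if "t \<in> {0..1}" "q \<in> sphere 0 1" for t q
    using assms[OF that] by (simp add: singular_at_def)
qed simp_all

end

section \<open>Comparison of the Smale invariant with the cross cap count\<close>

lemma dcols_cong:
  assumes "open S" "z \<in> S" "\<And>y. y \<in> S \<Longrightarrow> f y = g y"
  shows "dcols f z = dcols g z"
proof -
  \<comment> \<open>\<open>frechet_derivative\<close> is a choice among derivatives, so agreement of
    the whole predicate is enough, even at points where none exists.\<close>
  have "(f has_derivative D) (at z) \<longleftrightarrow> (g has_derivative D) (at z)" for D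
    using has_derivative_transform_within_open[OF _ assms(1,2), of f D UNIV g]
      has_derivative_transform_within_open[OF _ assms(1,2), of g D UNIV f] assms(3) by auto
  then show ?thesis by (simp add: dcols_def frechet_derivative_def)
qed

text \<open>The radius is fixed before \<open>l\<close> tends to 0: how small \<open>l\<close> must
  be for the count to settle may depend on the ball, while the value \<open>N\<close> does
  not.\<close>

theorem theorem5p1:
  fixes \<Phi> :: "complex \<times> complex \<Rightarrow> complex \<times> complex \<times> complex"
    and F :: "complex \<Rightarrow> complex \<times> complex \<Rightarrow> complex \<times> complex \<times> complex"
    and U :: "(complex \<times> complex) set"
    and W :: "(complex \<times> complex \<times> complex) set"
  assumes U: "open U" "0 \<in> U" and hol: "holo23 \<Phi> U" and zero: "\<Phi> 0 = 0"
    and sing_origin: "\<exists>r>0. ball 0 r \<subseteq> U \<and> (\<forall>z\<in>ball 0 r. singular_at \<Phi> z \<longrightarrow> z = 0)"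
    and W: "open W" "(0, 0) \<in> W" and holF: "holo33 (\<lambda>(l, z). F l z) W"
    and F0: "\<forall>z. (0, z) \<in> W \<longrightarrow> F 0 z = \<Phi> z"
    and generic: "\<exists>V \<delta>. open V \<and> 0 \<in> V \<and> \<delta> > 0 \<and>
        (\<forall>l z. 0 < norm l \<and> norm l < \<delta> \<and> z \<in> V \<longrightarrow>
           (l, z) \<in> W \<and> (singular_at (F l) z \<longrightarrow> is_crosscap (F l) z))"
  shows "\<exists>N::nat. smale_invariant_is \<Phi> (int N) \<and>
    (\<exists>\<epsilon>0>0. \<forall>\<epsilon>. 0 < \<epsilon> \<and> \<epsilon> < \<epsilon>0 \<longrightarrow>
       (\<forall>\<^sub>F l in at 0. finite {z \<in> ball 0 \<epsilon>. is_crosscap (F l) z} \<and>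
                        card {z \<in> ball 0 \<epsilon>. is_crosscap (F l) z} = N))"
proof -
  interpret holomorphic_family F W by unfold_locales (fact W(1), fact holF)
  obtain r1 where r1: "r1 > 0" "\<And>z. z \<in> ball 0 r1 \<Longrightarrow> singular_at \<Phi> z \<Longrightarrow> z = 0" using sing_origin by blast
  obtain V \<delta>1 where V: "open V" "0 \<in> V" "\<delta>1 > 0" and
    V': "\<forall>l z. 0 < norm l \<and> norm l < \<delta>1 \<and> z \<in> V \<longrightarrow> (l, z) \<in> W \<and> (singular_at (F l) z \<longrightarrow> is_crosscap (F l) z)"
    using generic by (elim exE conjE) (rule that)
  have gen: "is_crosscap (F l) z" if "0 < norm l" "norm l < \<delta>1" "z \<in> V" "singular_at (F l) z" for l z
    using V'[rule_format, of l z] that by simp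
  obtain r2 where r2: "r2 > 0" "ball 0 r2 \<subseteq> V" using V(1,2) open_contains_ball by blast
  obtain A B where AB: "open A" "open B" "(0, 0) \<in> A \<times> B" "A \<times> B \<subseteq> W"
    by (rule open_prod_elim[OF W]) (rule that)
  have "0 \<in> A" "0 \<in> B" using AB(3) by simp_all
  obtain \<delta>2 where \<delta>2: "\<delta>2 > 0" "cball 0 \<delta>2 \<subseteq> A" using AB(1) \<open>0 \<in> A\<close> open_contains_cball by blast
  obtain r3 where r3: "r3 > 0" "cball 0 r3 \<subseteq> B" using AB(2) \<open>0 \<in> B\<close> open_contains_cball by blast
  \<comment> \<open>\<open>r1\<close> isolates the singularity of \<Phi>, \<open>r2\<close> keeps
    points where genericity holds, and \<open>r3\<close> keeps them in the domain of the
    family.\<close>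
  define \<epsilon>0 where "\<epsilon>0 = min r1 (min r2 r3)"
  define \<delta> where "\<delta> = min \<delta>1 \<delta>2"
  have \<epsilon>0: "\<epsilon>0 > 0" and \<delta>: "\<delta> > 0" using r1 r2 r3 V(3) \<delta>2 by (simp_all add: \<epsilon>0_def \<delta>_def)
  have in_W: "(l, z) \<in> W" if "norm l \<le> \<delta>" "norm z < \<epsilon>0" for l z
  proof -
    have "l \<in> A" by (rule subsetD[OF \<delta>2(2)]) (use that in \<open>simp add: \<delta>_def\<close>)
    moreover have "z \<in> B" by (rule subsetD[OF r3(2)]) (use that in \<open>simp add: \<epsilon>0_def\<close>)
    ultimately show ?thesis using AB(4) by blast
  qed
  have cc: "is_crosscap (F l) z" if "0 < norm l" "norm l < \<delta>" "norm z < \<epsilon>0" "singular_at (F l) z" for l z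
  proof (rule gen[OF that(1) _ _ that(4)])
    show "norm l < \<delta>1" using that by (simp add: \<delta>_def)
    show "z \<in> V" by (rule subsetD[OF r2(2)]) (use that in \<open>simp add: \<epsilon>0_def\<close>)
  qed
  have dcols0: "dcols (F 0) z = dcols \<Phi> z" if "norm z < \<epsilon>0" for z
  proof (rule dcols_cong[of "ball 0 \<epsilon>0"])
    fix y :: "complex \<times> complex" assume "y \<in> ball 0 \<epsilon>0"
    then have "(0, y) \<in> W" using \<delta> by (intro in_W) simp_all
    then show "F 0 y = \<Phi> y" using F0 by blast
  qed (use that in simp_all)
  have reg0: "\<not> singular_at (F 0) z" if "norm z < \<epsilon>0" "z \<noteq> 0" for z
  proof
    assume "singular_at (F 0) z"
    then have "singular_at \<Phi> z" unfolding singular_at_def dcols0[OF that(1)] .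
    moreover have "z \<in> ball 0 r1" using that by (simp add: \<epsilon>0_def)
    ultimately show False using r1(2) that(2) by blast
  qed
  \<comment> \<open>Cross caps are singular by \<open>crosscap_isolated\<close>, and genericity
    gives the converse, so cross caps can be counted as singular points.\<close>
  have crosscap_set: "{z \<in> ball 0 \<epsilon>. is_crosscap (F l) z} = {z \<in> ball 0 \<epsilon>. singular_at (F l) z}"
    if "\<epsilon> < \<epsilon>0" "0 < norm l" "norm l < \<delta>" for l \<epsilon>
  proof (rule Collect_cong, rule conj_cong[OF refl])
    fix z :: "complex \<times> complex" assume "z \<in> ball 0 \<epsilon>"
    then have "norm z < \<epsilon>0" using that(1) by simp
    then show "is_crosscap (F l) z \<longleftrightarrow> singular_at (F l) z"
      using cc[OF that(2,3)] crosscap_isolated(1) by blast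
  qed
  have rect: "S \<times> K \<subseteq> W" if "\<And>l. l \<in> S \<Longrightarrow> norm l \<le> \<delta>" "\<And>z. z \<in> K \<Longrightarrow> norm z < \<epsilon>0" for S K
  proof (rule subsetI)
    fix x assume "x \<in> S \<times> K"
    then have "fst x \<in> S" "snd x \<in> K" by (simp_all add: mem_Times_iff)
    then have "(fst x, snd x) \<in> W" by (intro in_W that)
    then show "x \<in> W" by simp
  qed
  have ev_small: "\<forall>\<^sub>F l :: complex in at 0. 0 < norm l \<and> norm l < \<delta>"
    unfolding eventually_at by (intro exI[of _ \<delta>]) (use \<delta> in auto)
  have const: "\<exists>n. \<forall>\<^sub>F l in at 0. card {z \<in> ball 0 \<epsilon>. singular_at (F l) z} = n" if "0 < \<epsilon>" "\<epsilon> < \<epsilon>0" for \<epsilon>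
  proof (rule eventually_card_singular_const[OF \<delta>])
    show "cball 0 \<delta> \<times> cball 0 \<epsilon> \<subseteq> W" using that by (intro rect) simp_all
    show "is_crosscap (F l) z" if "0 < norm l" "norm l < \<delta>" "z \<in> cball 0 \<epsilon>" "singular_at (F l) z" for l z
      using that \<open>\<epsilon> < \<epsilon>0\<close> by (intro cc) simp_all
    show "\<not> singular_at (F 0) z" if "z \<in> sphere 0 \<epsilon>" for z
      using that \<open>0 < \<epsilon>\<close> \<open>\<epsilon> < \<epsilon>0\<close> by (intro reg0) auto
  qed
  \<comment> \<open>The closed shell between the two radii is compact and regular for
    \<open>F 0\<close>, hence regular for small \<open>l\<close>: singular points stay in the inner
    ball.\<close>
  have mono: "\<forall>\<^sub>F l in at 0. {z \<in> ball 0 \<epsilon>. singular_at (F l) z} = {z \<in> ball 0 \<epsilon>'. singular_at (F l) z}"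
    if "0 < \<epsilon>" "\<epsilon> \<le> \<epsilon>'" "\<epsilon>' < \<epsilon>0" for \<epsilon> \<epsilon>'
  proof -
    have "\<forall>\<^sub>F l in nhds 0. \<forall>z\<in>cball 0 \<epsilon>' - ball 0 \<epsilon>. (l, z) \<in> W \<and> \<not> singular_at (F l) z"
    proof (rule eventually_regular)
      show "compact (cball 0 \<epsilon>' - ball (0 :: complex \<times> complex) \<epsilon>)" by (intro compact_diff) auto
      show "{0} \<times> (cball 0 \<epsilon>' - ball 0 \<epsilon>) \<subseteq> W" using \<delta> that by (intro rect) simp_all
      show "\<not> singular_at (F 0) z" if "z \<in> cball 0 \<epsilon>' - ball 0 \<epsilon>" for z
        using that \<open>0 < \<epsilon>\<close> \<open>\<epsilon>' < \<epsilon>0\<close> by (intro reg0) auto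
    qed
    then have "\<forall>\<^sub>F l in at 0. \<forall>z\<in>cball 0 \<epsilon>' - ball 0 \<epsilon>. (l, z) \<in> W \<and> \<not> singular_at (F l) z"
      by (rule filter_leD[OF at_within_le_nhds])
    then show ?thesis
    proof eventually_elim
      case (elim l)
      have "norm z < \<epsilon>" if "norm z < \<epsilon>'" "singular_at (F l) z" for z
        using bspec[OF elim, of z] that by (cases "norm z < \<epsilon>") simp_all
      then show ?case using that(2) by (intro Collect_cong) auto
    qed
  qed
  \<comment> \<open>The radius \<open>\<epsilon>0 / 2\<close> is only a reference;
    \<open>mono\<close> transfers the count to every other radius from either side.\<close>
  obtain N where N: "\<forall>\<^sub>F l in at 0. card {z \<in> ball 0 (\<epsilon>0 / 2). singular_at (F l) z} = N"
    using const[of "\<epsilon>0 / 2"] \<epsilon>0 by auto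
  have count: "\<forall>\<^sub>F l in at 0. card {z \<in> ball 0 \<epsilon>. singular_at (F l) z} = N" if "0 < \<epsilon>" "\<epsilon> < \<epsilon>0" for \<epsilon>
  proof (cases "\<epsilon> \<le> \<epsilon>0 / 2")
    case True
    have "\<forall>\<^sub>F l in at 0. {z \<in> ball 0 \<epsilon>. singular_at (F l) z} = {z \<in> ball 0 (\<epsilon>0 / 2). singular_at (F l) z}"
      using True that \<epsilon>0 by (intro mono) auto
    with N show ?thesis by eventually_elim simp
  next
    case False
    have "\<forall>\<^sub>F l in at 0. {z \<in> ball 0 (\<epsilon>0 / 2). singular_at (F l) z} = {z \<in> ball 0 \<epsilon>. singular_at (F l) z}"
      using False that \<epsilon>0 by (intro mono) auto
    with N show ?thesis by eventually_elim simp
  qed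
  have "smale_invariant_is \<Phi> (int N)"
    unfolding smale_invariant_is_def
  proof (intro exI[of _ \<epsilon>0] conjI allI impI)
    fix r assume "0 < r \<and> r < \<epsilon>0"
    then have r: "0 < r" "r < \<epsilon>0" by simp_all
    have "\<forall>\<^sub>F l in nhds 0. \<forall>z\<in>sphere 0 r. (l, z) \<in> W \<and> \<not> singular_at (F l) z"
    proof (rule eventually_regular[OF compact_sphere])
      show "{0} \<times> sphere 0 r \<subseteq> W" using \<delta> r by (intro rect) simp_all
      show "\<not> singular_at (F 0) z" if "z \<in> sphere 0 r" for z using that r by (intro reg0) auto
    qed
    then obtain d where d: "d > 0" "\<And>l. dist l 0 < d \<Longrightarrow> \<forall>z\<in>sphere 0 r. (l, z) \<in> W \<and> \<not> singular_at (F l) z"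
      unfolding eventually_nhds_metric by blast
    have "\<forall>\<^sub>F l in at 0. dist l 0 < d" unfolding eventually_at using d(1) by blast
    with count[OF r] ev_small have "\<forall>\<^sub>F l in at 0. card {z \<in> ball 0 r. singular_at (F l) z} = N
        \<and> (0 < norm l \<and> norm l < \<delta>) \<and> dist l 0 < d"
      by eventually_elim simp
    \<comment> \<open>A single parameter suffices, small enough for the count, for genericity, and
      for regularity on the sphere along the segment from 0 to \<open>l\<close>.\<close>
    then have "\<exists>l. card {z \<in> ball 0 r. singular_at (F l) z} = N \<and> (0 < norm l \<and> norm l < \<delta>) \<and> dist l 0 < d"
      by (rule eventually_happens'[OF at_neq_bot])
    then obtain l where l: "card {z \<in> ball 0 r. singular_at (F l) z} = N" "0 < norm l" "norm l < \<delta>" "norm l < d"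
      unfolding dist_0_norm by (elim exE conjE) (rule that; simp)
    have "sphere_homotopic cindep2 (\<lambda>q. dcols (F 0) (r *\<^sub>R q)) (\<lambda>q. dcols (F l) (r *\<^sub>R q))"
    proof (rule sphere_homotopic_dcols_family)
      fix t :: real and q :: "complex \<times> complex" assume t: "t \<in> {0..1}" and q: "q \<in> sphere 0 1"
      have "norm (of_real t * l) \<le> 1 * norm l" unfolding norm_mult using t by (intro mult_right_mono) auto
      then have "dist (of_real t * l) 0 < d" using l(4) by simp
      moreover have "r *\<^sub>R q \<in> sphere 0 r" using q r by simp
      ultimately show "(of_real t * l, r *\<^sub>R q) \<in> W \<and> \<not> singular_at (F (of_real t * l)) (r *\<^sub>R q)"
        using d(2) by blast
    qed
    moreover have "sphere_homotopic cindep2 (\<lambda>q. dcols (F l) (r *\<^sub>R q)) (rep_frame (int (card {z \<in> ball 0 r. singular_at (F l) z})))"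
    proof (rule dcols_sphere_homotopic_rep_frame[OF r(1)])
      show "continuous_on (cball 0 r) (dcols (F l))"
        using l(3) r(2) by (intro continuous_dcols rect) simp_all
      show "is_crosscap (F l) z" if "z \<in> cball 0 r" "singular_at (F l) z" for z
        using that r(2) by (intro cc l) simp_all
      show "\<not> singular_at (F l) z" if "z \<in> sphere 0 r" for z
        using d(2)[of l] l(4) that by simp
    qed
    ultimately have "sphere_homotopic cindep2 (\<lambda>q. dcols (F 0) (r *\<^sub>R q)) (rep_frame (int N))"
      unfolding l(1) by (rule homotopic_with_trans)
    then show "sphere_homotopic cindep2 (\<lambda>q. dcols \<Phi> (r *\<^sub>R q)) (rep_frame (int N))"
    proof (rule homotopic_with_canon_eq)
      fix q :: "complex \<times> complex" assume "q \<in> sphere 0 1"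
      then show "dcols \<Phi> (r *\<^sub>R q) = dcols (F 0) (r *\<^sub>R q)" using r by (intro dcols0[symmetric]) simp
    qed simp
  qed (rule \<epsilon>0)
  moreover have "\<forall>\<^sub>F l in at 0. finite {z \<in> ball 0 \<epsilon>. is_crosscap (F l) z} \<and> card {z \<in> ball 0 \<epsilon>. is_crosscap (F l) z} = N"
    if \<epsilon>: "0 < \<epsilon>" "\<epsilon> < \<epsilon>0" for \<epsilon>
    using count[OF \<epsilon>] ev_small
  proof eventually_elim
    case (elim l)
    \<comment> \<open>Finiteness rests on compactness, so it is proved on the closed ball, which
      still lies within the radius \<open>\<epsilon>0\<close>.\<close>
    have "finite {z \<in> cball 0 \<epsilon>. singular_at (F l) z}"
    proof (rule finite_singular_set)
      show "continuous_on (cball 0 \<epsilon>) (dcols (F l))"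
        using elim(2) \<epsilon>(2) by (intro continuous_dcols rect) simp_all
      show "is_crosscap (F l) z" if "z \<in> cball 0 \<epsilon>" "singular_at (F l) z" for z
        using that \<epsilon>(2) elim(2) by (intro cc) simp_all
    qed
    then have "finite {z \<in> ball 0 \<epsilon>. singular_at (F l) z}" by (rule rev_finite_subset) auto
    then show ?case using crosscap_set[OF \<epsilon>(2), of l] elim by simp
  qed
  ultimately show ?thesis using \<epsilon>0 by blast
qed

end
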